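(* Let $Z\to X\to B$ be a fiber bundle with 10-dimensional fiber $Z$, with vertical tangent bundle $TZ$ equipped with a metric $g^{TZ}$ and an associated Levi-Civita connection $\nabla^{TZ}$. Let $F$ be a Euclidean vector bundle over $X$ with Euclidean connection $\nabla^{F}$, and let $\xi$ be a rank two real oriented Euclidean vector bundle over $X$ with Euclidean connection $\nabla^\xi$ and Euler form $c=e(\xi,\nabla^\xi)$. If $\dim F=m$, then the following identity of differential forms on $X$ holds: $$\begin{aligned} &\{\widehat{A}(TZ)e^{\frac{c}{2}}\mathrm{ch}(\wedge^2{F}_{\mathbf C})\}^{(12)}+\{\widehat{A}(TZ)e^{\frac{c}{2}}\mathrm{ch}(T_{\mathbf C} Z)\}^{(12)}+\left(\tfrac{(m-32)(m-31)}{2}-2\right)\{\widehat{A}(TZ)e^{\frac{c}{2}}\}^{(12)}\\ &-(m-32)\{\widehat{A}(TZ)e^{\frac{c}{2}}\mathrm{ch}({F}_{\mathbf C})\}^{(12)}\\ &+5\{\widehat{A}(TZ)e^{\frac{c}{2}}\mathrm{ch}(\widetilde{\xi_{\mathbf C}}\otimes\widetilde{\xi_{\mathbf C}})\}^{(12)}+3\{\widehat{A}(TZ)e^{\frac{c}{2}}\mathrm{ch}((m-31-{F}_{\mathbf C})\otimes\widetilde{\xi_{\mathbf C}})\}^{(12)}\\ =\;&(p_1(TZ)-p_1(F))\cdot\left\{-\frac{e^{\frac{1}{24}(p_1(TZ)-p_1(F))}-1}{p_1(TZ)-p_1(F)}\widehat{A}(TZ)e^{\frac{c}{2}}\mathrm{ch}(\mathfrak{E})+e^{\frac{1}{24}(p_1(TZ)-p_1(F))}\widehat{A}(TZ)e^{\frac{c}{2}}\right\}^{(8)},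 \end{aligned}$$ where $$\mathfrak{E}=\wedge^2{F}_{\mathbf C}+T_{\mathbf C} Z+\tfrac{(m-32)(m-31)}{2}-2-(m-32){F}_{\mathbf C}+5\widetilde{\xi_{\mathbf C}}\otimes\widetilde{\xi_{\mathbf C}}+3(m-31-{F}_{\mathbf C})\otimes\widetilde{\xi_{\mathbf C}}.$$ If $\xi$ is trivial, the following identity holds: $$\begin{aligned} &\{\widehat{A}(TZ)\mathrm{ch}(\wedge^2{F}_{\mathbf C})\}^{(12)}+\{\widehat{A}(TZ)\mathrm{ch}(T_{\mathbf C} Z)\}^{(12)}+\left(\tfrac{(m-32)(m-31)}{2}-2\right)\{\widehat{A}(TZ)\}^{(12)}\\ &-(m-32)\{\widehat{A}(TZ)\mathrm{ch}({F}_{\mathbf C})\}^{(12)}\\ =\;&(p_1(TZ)-p_1(F))\left\{-\frac{e^{\frac{1}{24}(p_1(TZ)-p_1(F))}-1}{p_1(TZ)-p_1(F)}\widehat{A}(TZ)\mathrm{ch}(\mathfrak{F})+e^{\frac{1}{24}(p_1(TZ)-p_1(F))}\widehat{A}(TZ)\right\}^{(8)}, \end{aligned}$$ where $$\mathfrak{F}=\wedge^2{F}_{\mathbf C}+T_{\mathbf C} Z+\tfrac{(m-32)(m-31)}{2}-2-(m-32){F}_{\mathbf C}.$$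
   Context: For a differential form $\omega$, $\omega^{(j)}$ (or $\{\omega\}^{(j)}$) is its degree-$j$ component. For a real bundle $E$, $E_{\mathbf C}$ is its complexification with the induced Hermitian connection; $T_{\mathbf C}Z$ is the complexification of $TZ$. For a real (resp. complex) bundle $E$, $\widetilde{E}=E-\dim E$ in $KO(X)$ (resp. $K(X)$). Integers in $K(X)$ denote (virtual) trivial bundles with trivial connection; tensor products and exterior powers $\wedge^2$ carry the induced connections, and $\mathrm{ch}$ is extended additively to virtual bundles. $\widehat{A}(TZ)=\widehat{A}(TZ,\nabla^{TZ})$, $\mathrm{ch}(\cdot)$ and $p_i(\cdot)$ denote the Chern-Weil forms (Hirzebruch $\widehat{A}$-form, Chern character form, Pontryagin forms) of the given connections, connections being suppressed from notation. They are normalized so that, if the formal Chern roots of the complexification of a real bundle are $\pm y_j$ (plus possibly $0$), then $p_1=\sum_j y_j^2$, $\widehat{A}=\prod_j \frac{y_j/2}{\sinh(y_j/2)}$, $\mathrm{ch}$ is the sum of the exponentials of the roots, and the roots of $\xi_{\mathbf C}$ are $\pm c$. The quotient $\frac{e^{x/24}-1}{x}$ is understood as the power series $\sum_{k\ge 1}\frac{x^{k-1}}{24^k k!}$. *)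

theory Defs
  imports
    "HOL-Analysis.Analysis"
    "HOL-Library.Function_Algebras"
    "HOL-Library.Nat_Bijection"
    "HOL-Combinatorics.Permutations"
    "HOL-Computational_Algebra.Formal_Power_Series"
begin

text \<open>Pointwise real vector space structure on functions; tangent vectors and differential
  forms are represented by functions.\<close>

instantiation "fun" :: (type, real_vector) real_vector
begin

definition scaleR_fun :: "real \<Rightarrow> ('a \<Rightarrow> 'b) \<Rightarrow> 'a \<Rightarrow> 'b"
  where "scaleR_fun r f = (\<lambda>x. r *\<^sub>R f x)"

instance
  by standard (auto simp: scaleR_fun_def fun_eq_iff scaleR_add_left scaleR_add_right)

end

section \<open>Smooth manifolds\<close>

text \<open>On an open subset of a finite-dimensional space, \<open>Ck_on k\<close> is the class $C^k$.\<close>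

primrec Ck_on :: "nat \<Rightarrow> 'a::real_normed_vector set \<Rightarrow> ('a \<Rightarrow> 'b::real_normed_vector) \<Rightarrow> bool"
  where
    "Ck_on 0 S f \<longleftrightarrow> continuous_on S f"
  | "Ck_on (Suc k) S f \<longleftrightarrow> (\<forall>x\<in>S. f differentiable (at x)) \<and>
       (\<forall>v. Ck_on k S (\<lambda>x. frechet_derivative f (at x) v))"

definition smooth_on :: "'a::real_normed_vector set \<Rightarrow> ('a \<Rightarrow> 'b::real_normed_vector) \<Rightarrow> bool"
  where "smooth_on S f \<longleftrightarrow> (\<forall>k. Ck_on k S f)"

type_synonym ('x, 'e) chart = "'x set \<times> ('x \<Rightarrow> 'e)"

definition chart_inv :: "('x, 'e) chart \<Rightarrow> 'e \<Rightarrow> 'x"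
  where "chart_inv c = inv_into (fst c) (snd c)"

text \<open>The underlying set of the manifold is the whole type. The model space is a
  finite-dimensional normed space; unlike the class \<open>euclidean_space\<close> this does not exclude
  dimension 0.\<close>

definition smooth_manifold ::
    "('x::{t2_space, second_countable_topology}, 'e::real_normed_vector) chart set \<Rightarrow> bool"
  where "smooth_manifold A \<longleftrightarrow>
    (\<exists>S. finite S \<and> span S = (UNIV :: 'e set)) \<and>
    (\<Union>c\<in>A. fst c) = UNIV \<and>
    (\<forall>c\<in>A. open (fst c) \<and> open (snd c ` fst c) \<and>
       homeomorphism (fst c) (snd c ` fst c) (snd c) (chart_inv c)) \<and>
    (\<forall>c\<in>A. \<forall>d\<in>A. smooth_on (snd c ` (fst c \<inter> fst d)) (snd d \<circ> chart_inv c))"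

definition product_atlas ::
    "('b, 'd) chart set \<Rightarrow> ('z, 'e) chart set \<Rightarrow> ('b \<times> 'z, 'd \<times> 'e) chart set"
  where "product_atlas A A' =
    {(fst c \<times> fst d, \<lambda>p. (snd c (fst p), snd d (snd p))) | c d. c \<in> A \<and> d \<in> A'}"

text \<open>In \<open>smooth_map\<close>, \<open>smooth_fun\<close> and everything below, \<open>W\<close> is meant to be open.\<close>

definition smooth_map ::
    "('x::topological_space, 'e::real_normed_vector) chart set \<Rightarrow>
     ('y::topological_space, 'd::real_normed_vector) chart set \<Rightarrow> 'x set \<Rightarrow> ('x \<Rightarrow> 'y) \<Rightarrow> bool"
  where "smooth_map A A' W F \<longleftrightarrow> continuous_on W F \<and>
    (\<forall>c\<in>A. \<forall>d\<in>A'. smooth_on (snd c ` (fst c \<inter> W \<inter> F -` fst d)) (snd d \<circ> F \<circ> chart_inv c))"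

definition smooth_fun ::
    "('x, 'e::real_normed_vector) chart set \<Rightarrow> 'x set \<Rightarrow> ('x \<Rightarrow> real) \<Rightarrow> bool"
  where "smooth_fun A W f \<longleftrightarrow> (\<forall>c\<in>A. smooth_on (snd c ` (fst c \<inter> W)) (f \<circ> chart_inv c))"

definition smooth_near ::
    "('x::topological_space, 'e::real_normed_vector) chart set \<Rightarrow> 'x \<Rightarrow> ('x \<Rightarrow> real) \<Rightarrow> bool"
  where "smooth_near A x f \<longleftrightarrow> (\<exists>W. open W \<and> x \<in> W \<and> smooth_fun A W f)"

text \<open>\<open>AX\<close>, \<open>AB\<close>, \<open>AZ\<close> are atlases of the total space, the base and the typical fibre.\<close>

definition fibre_bundle ::
    "('x::topological_space, 'ex::real_normed_vector) chart set \<Rightarrow>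
     ('b::topological_space, 'eb::real_normed_vector) chart set \<Rightarrow>
     ('z::topological_space, 'ez::real_normed_vector) chart set \<Rightarrow> ('x \<Rightarrow> 'b) \<Rightarrow> bool"
  where "fibre_bundle AX AB AZ \<pi> \<longleftrightarrow>
    smooth_map AX AB UNIV \<pi> \<and>
    (\<forall>b. \<exists>V \<Phi> \<Psi>. open V \<and> b \<in> V \<and>
       bij_betw \<Phi> (\<pi> -` V) (V \<times> (UNIV :: 'z set)) \<and>
       (\<forall>x \<in> \<pi> -` V. fst (\<Phi> x) = \<pi> x \<and> \<Psi> (\<Phi> x) = x) \<and>
       smooth_map AX (product_atlas AB AZ) (\<pi> -` V) \<Phi> \<and>
       smooth_map (product_atlas AB AZ) AX (V \<times> UNIV) \<Psi>)"

section \<open>Tangent vectors and vector fields\<close>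

text \<open>Tangent vectors at \<open>x\<close> are derivations on germs at \<open>x\<close> of smooth functions, extended
  by 0 to functions that are not smooth near \<open>x\<close>.\<close>

type_synonym 'x tvec = "('x \<Rightarrow> real) \<Rightarrow> real"

definition tangent_space ::
    "('x::topological_space, 'e::real_normed_vector) chart set \<Rightarrow> 'x \<Rightarrow> 'x tvec set"
  where "tangent_space A x = {v.
    (\<forall>f. \<not> smooth_near A x f \<longrightarrow> v f = 0) \<and>
    (\<forall>f g. smooth_near A x f \<and> smooth_near A x g \<longrightarrow>
       v (\<lambda>y. f y + g y) = v f + v g \<and> v (\<lambda>y. f y * g y) = v f * g x + f x * v g) \<and>
    (\<forall>a f. smooth_near A x f \<longrightarrow> v (\<lambda>y. a * f y) = a * v f) \<and>
    (\<forall>f g W. smooth_near A x f \<and> open W \<and> x \<in> W \<and> (\<forall>y\<in>W. f y = g y) \<longrightarrow> v f = v g)}"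

definition smooth_vf ::
    "('x::topological_space, 'e::real_normed_vector) chart set \<Rightarrow> 'x set \<Rightarrow> ('x \<Rightarrow> 'x tvec) \<Rightarrow> bool"
  where "smooth_vf A W V \<longleftrightarrow> (\<forall>x\<in>W. V x \<in> tangent_space A x) \<and>
    (\<forall>W' f. open W' \<and> W' \<subseteq> W \<and> smooth_fun A W' f \<longrightarrow> smooth_fun A W' (\<lambda>x. V x f))"

definition lie_bracket ::
    "('x::topological_space, 'e::real_normed_vector) chart set \<Rightarrow>
     ('x \<Rightarrow> 'x tvec) \<Rightarrow> ('x \<Rightarrow> 'x tvec) \<Rightarrow> 'x \<Rightarrow> 'x tvec"
  where "lie_bracket A U V x = (\<lambda>f. if smooth_near A x f
    then U x (\<lambda>y. V y f) - V x (\<lambda>y. U y f) else 0)"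

definition pushforward ::
    "('y::topological_space, 'd::real_normed_vector) chart set \<Rightarrow> ('x \<Rightarrow> 'y) \<Rightarrow> 'x \<Rightarrow>
     'x tvec \<Rightarrow> 'y tvec"
  where "pushforward A' F x v = (\<lambda>g. if smooth_near A' (F x) g then v (g \<circ> F) else 0)"

definition vertical_space ::
    "('x::topological_space, 'ex::real_normed_vector) chart set \<Rightarrow>
     ('b::topological_space, 'eb::real_normed_vector) chart set \<Rightarrow> ('x \<Rightarrow> 'b) \<Rightarrow> 'x \<Rightarrow> 'x tvec set"
  where "vertical_space AX AB \<pi> x = {v \<in> tangent_space AX x. pushforward AB \<pi> x v = 0}"

text \<open>\<open>coord_vec A c y w\<close> is the tangent vector at \<open>y\<close> whose coordinates in the chart \<open>c\<close> are
  \<open>w\<close>; \<open>coord_ext A c x v\<close> extends \<open>v \<in> T\<^sub>xX\<close> to the vector field with constant coordinates.\<close>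

definition coord_vec ::
    "('x::topological_space, 'e::real_normed_vector) chart set \<Rightarrow> ('x, 'e) chart \<Rightarrow> 'x \<Rightarrow> 'e \<Rightarrow>
     'x tvec"
  where "coord_vec A c y w = (\<lambda>f. if smooth_near A y f
    then frechet_derivative (f \<circ> chart_inv c) (at (snd c y)) w else 0)"

definition coord_ext ::
    "('x::topological_space, 'e::real_normed_vector) chart set \<Rightarrow> ('x, 'e) chart \<Rightarrow> 'x \<Rightarrow>
     'x tvec \<Rightarrow> 'x \<Rightarrow> 'x tvec"
  where "coord_ext A c x v = (\<lambda>y. coord_vec A c y (THE w. coord_vec A c x w = v))"

definition chart_at :: "('x, 'e) chart set \<Rightarrow> 'x \<Rightarrow> ('x, 'e) chart"
  where "chart_at A x = (SOME c. c \<in> A \<and> x \<in> fst c)"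

section \<open>Euclidean vector bundles\<close>

text \<open>The fibres of a bundle are subspaces of one ambient real vector space (for instance the
  direct sum of all fibres). The smooth structure is given by an atlas of smooth local
  orthonormal frames \<open>(U, e)\<close>, where only \<open>e i\<close> with \<open>i < rank\<close> matters. By the Gram-Schmidt
  process every smooth vector bundle with a smooth fibre metric has such an atlas.\<close>

record ('x, 'v) vbundle =
  fibre :: "'x \<Rightarrow> 'v set"
  metric :: "'x \<Rightarrow> 'v \<Rightarrow> 'v \<Rightarrow> real"
  frames :: "('x set \<times> (nat \<Rightarrow> 'x \<Rightarrow> 'v)) set"

definition inner_product_on :: "'v::real_vector set \<Rightarrow> ('v \<Rightarrow> 'v \<Rightarrow> real) \<Rightarrow> bool"
  where "inner_product_on E h \<longleftrightarrow>
    (\<forall>u\<in>E. \<forall>v\<in>E. h u v = h v u) \<and>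
    (\<forall>u\<in>E. \<forall>v\<in>E. \<forall>w\<in>E. h (u + v) w = h u w + h v w) \<and>
    (\<forall>a. \<forall>u\<in>E. \<forall>v\<in>E. h (a *\<^sub>R u) v = a * h u v) \<and>
    (\<forall>u\<in>E. u \<noteq> 0 \<longrightarrow> h u u > 0)"

definition orthonormal_basis ::
    "nat \<Rightarrow> 'v::real_vector set \<Rightarrow> ('v \<Rightarrow> 'v \<Rightarrow> real) \<Rightarrow> (nat \<Rightarrow> 'v) \<Rightarrow> bool"
  where "orthonormal_basis n E h e \<longleftrightarrow>
    (\<forall>i<n. \<forall>j<n. h (e i) (e j) = (if i = j then 1 else 0)) \<and> span (e ` {..<n}) = E"

definition euclidean_bundle ::
    "('x::topological_space, 'e::real_normed_vector) chart set \<Rightarrow> nat \<Rightarrow>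
     ('x, 'v::real_vector) vbundle \<Rightarrow> bool"
  where "euclidean_bundle A n E \<longleftrightarrow>
    (\<forall>x. inner_product_on (fibre E x) (metric E x)) \<and>
    (\<Union>(U, e)\<in>frames E. U) = UNIV \<and>
    (\<forall>(U, e)\<in>frames E. open U \<and>
       (\<forall>x\<in>U. orthonormal_basis n (fibre E x) (metric E x) (\<lambda>i. e i x))) \<and>
    (\<forall>(U, e)\<in>frames E. \<forall>(U', e')\<in>frames E. \<forall>i<n. \<forall>j<n.
       smooth_fun A (U \<inter> U') (\<lambda>x. metric E x (e i x) (e' j x)))"

text \<open>Orientation: all transition matrices have positive determinant.\<close>

definition oriented_bundle :: "nat \<Rightarrow> ('x, 'v) vbundle \<Rightarrow> bool"
  where "oriented_bundle n E \<longleftrightarrow>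
    (\<forall>(U, e)\<in>frames E. \<forall>(U', e')\<in>frames E. \<forall>x \<in> U \<inter> U'.
       (\<Sum>p | p permutes {..<n}. of_int (sign p) * (\<Prod>i<n. metric E x (e i x) (e' (p i) x))) > 0)"

definition smooth_section ::
    "('x::topological_space, 'e::real_normed_vector) chart set \<Rightarrow> nat \<Rightarrow>
     ('x, 'v) vbundle \<Rightarrow> 'x set \<Rightarrow> ('x \<Rightarrow> 'v) \<Rightarrow> bool"
  where "smooth_section A n E W s \<longleftrightarrow> (\<forall>x\<in>W. s x \<in> fibre E x) \<and>
    (\<forall>(U, e)\<in>frames E. \<forall>i<n. smooth_fun A (U \<inter> W) (\<lambda>x. metric E x (s x) (e i x)))"

definition trivial_bundle ::
    "('x::topological_space, 'e::real_normed_vector) chart set \<Rightarrow> nat \<Rightarrow>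
     ('x, 'v::real_vector) vbundle \<Rightarrow> bool"
  where "trivial_bundle A n E \<longleftrightarrow>
    (\<exists>e. (\<forall>i<n. smooth_section A n E UNIV (e i)) \<and>
         (\<forall>x. span ((\<lambda>i. e i x) ` {..<n}) = fibre E x))"

text \<open>The rank \<open>n\<close> subbundle of the tangent bundle with fibres \<open>E x\<close> and metric \<open>g\<close>.\<close>

definition tangent_subbundle ::
    "('x::topological_space, 'e::real_normed_vector) chart set \<Rightarrow> nat \<Rightarrow> ('x \<Rightarrow> 'x tvec set) \<Rightarrow>
     ('x \<Rightarrow> 'x tvec \<Rightarrow> 'x tvec \<Rightarrow> real) \<Rightarrow> ('x, 'x tvec) vbundle"
  where "tangent_subbundle A n E g = \<lparr>fibre = E, metric = g,
    frames = {(U, e). open U \<and> (\<forall>i<n. smooth_vf A U (e i)) \<and>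
      (\<forall>x\<in>U. orthonormal_basis n (E x) (g x) (\<lambda>i. e i x))}\<rparr>"

definition tangent_bundle ::
    "('x::topological_space, 'e::real_normed_vector) chart set \<Rightarrow>
     ('x \<Rightarrow> 'x tvec \<Rightarrow> 'x tvec \<Rightarrow> real) \<Rightarrow> ('x, 'x tvec) vbundle"
  where "tangent_bundle A g = tangent_subbundle A (dim (UNIV :: 'e set)) (tangent_space A) g"

definition vertical_bundle ::
    "('x::topological_space, 'ex::real_normed_vector) chart set \<Rightarrow>
     ('b::topological_space, 'eb::real_normed_vector) chart set \<Rightarrow> ('x \<Rightarrow> 'b) \<Rightarrow> nat \<Rightarrow>
     ('x \<Rightarrow> 'x tvec \<Rightarrow> 'x tvec \<Rightarrow> real) \<Rightarrow> ('x, 'x tvec) vbundle"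
  where "vertical_bundle AX AB \<pi> n g = tangent_subbundle AX n (vertical_space AX AB \<pi>) g"

section \<open>Connections\<close>

text \<open>A connection is a covariant derivative: \<open>D x v s\<close> is the derivative at \<open>x\<close> of the local
  section \<open>s\<close> in the direction \<open>v \<in> T\<^sub>xX\<close>.\<close>

type_synonym ('x, 'v) covd = "'x \<Rightarrow> 'x tvec \<Rightarrow> ('x \<Rightarrow> 'v) \<Rightarrow> 'v"

definition connection ::
    "('x::topological_space, 'e::real_normed_vector) chart set \<Rightarrow> nat \<Rightarrow>
     ('x, 'v::real_vector) vbundle \<Rightarrow> ('x, 'v) covd \<Rightarrow> bool"
  where "connection A n E D \<longleftrightarrow>
    (\<forall>W. open W \<longrightarrow>
      (\<forall>s x u. smooth_section A n E W s \<and> x \<in> W \<and> u \<in> tangent_space A x \<longrightarrow>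
         D x u s \<in> fibre E x \<and>
         (\<forall>a. D x (a *\<^sub>R u) s = a *\<^sub>R D x u s) \<and>
         (\<forall>v \<in> tangent_space A x. D x (u + v) s = D x u s + D x v s) \<and>
         (\<forall>t. smooth_section A n E W t \<longrightarrow> D x u (\<lambda>y. s y + t y) = D x u s + D x u t) \<and>
         (\<forall>f. smooth_fun A W f \<longrightarrow>
            D x u (\<lambda>y. f y *\<^sub>R s y) = u f *\<^sub>R s x + f x *\<^sub>R D x u s) \<and>
         (\<forall>t. (\<forall>y\<in>W. t y = s y) \<longrightarrow> D x u t = D x u s)) \<and>
      (\<forall>s V. smooth_section A n E W s \<and> smooth_vf A W V \<longrightarrow>
         smooth_section A n E W (\<lambda>x. D x (V x) s)))"

definition euclidean_connection ::
    "('x::topological_space, 'e::real_normed_vector) chart set \<Rightarrow> nat \<Rightarrow>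
     ('x, 'v::real_vector) vbundle \<Rightarrow> ('x, 'v) covd \<Rightarrow> bool"
  where "euclidean_connection A n E D \<longleftrightarrow> connection A n E D \<and>
    (\<forall>W s t x u. open W \<and> smooth_section A n E W s \<and> smooth_section A n E W t \<and>
       x \<in> W \<and> u \<in> tangent_space A x \<longrightarrow>
       u (\<lambda>y. metric E y (s y) (t y)) =
         metric E x (D x u s) (t x) + metric E x (s x) (D x u t))"

definition riemannian_metric ::
    "('x::topological_space, 'e::real_normed_vector) chart set \<Rightarrow>
     ('x \<Rightarrow> 'x tvec \<Rightarrow> 'x tvec \<Rightarrow> real) \<Rightarrow> bool"
  where "riemannian_metric A g \<longleftrightarrow>
    euclidean_bundle A (dim (UNIV :: 'e set)) (tangent_bundle A g)"

definition levi_civita ::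
    "('x::topological_space, 'e::real_normed_vector) chart set \<Rightarrow>
     ('x \<Rightarrow> 'x tvec \<Rightarrow> 'x tvec \<Rightarrow> real) \<Rightarrow> ('x, 'x tvec) covd \<Rightarrow> bool"
  where "levi_civita A g D \<longleftrightarrow>
    euclidean_connection A (dim (UNIV :: 'e set)) (tangent_bundle A g) D \<and>
    (\<forall>W U V x. open W \<and> smooth_vf A W U \<and> smooth_vf A W V \<and> x \<in> W \<longrightarrow>
       D x (U x) V - D x (V x) U = lie_bracket A U V x)"

text \<open>A Levi-Civita connection associated with a metric \<open>g\<close> on the vertical tangent bundle:
  choose a Riemannian metric \<open>gX\<close> on the total space that restricts to \<open>g\<close> and makes the
  projection a Riemannian submersion, and project its Levi-Civita connection orthogonally onto
  the vertical tangent bundle. The result depends only on \<open>g\<close> and on the horizontal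
  distribution orthogonal to the fibres.\<close>

definition vertical_levi_civita ::
    "('x::topological_space, 'ex::real_normed_vector) chart set \<Rightarrow>
     ('b::topological_space, 'eb::real_normed_vector) chart set \<Rightarrow> ('x \<Rightarrow> 'b) \<Rightarrow> nat \<Rightarrow>
     ('x \<Rightarrow> 'x tvec \<Rightarrow> 'x tvec \<Rightarrow> real) \<Rightarrow> ('x, 'x tvec) covd \<Rightarrow> bool"
  where "vertical_levi_civita AX AB \<pi> n g D \<longleftrightarrow>
    euclidean_connection AX n (vertical_bundle AX AB \<pi> n g) D \<and>
    (\<exists>gX gB DX. riemannian_metric AX gX \<and> riemannian_metric AB gB \<and> levi_civita AX gX DX \<and>
       (\<forall>x. \<forall>u \<in> vertical_space AX AB \<pi> x. \<forall>v \<in> vertical_space AX AB \<pi> x.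
          gX x u v = g x u v) \<and>
       (\<forall>x. \<forall>u \<in> tangent_space AX x. \<forall>v \<in> tangent_space AX x.
          (\<forall>w \<in> vertical_space AX AB \<pi> x. gX x u w = 0 \<and> gX x v w = 0) \<longrightarrow>
          gX x u v = gB (\<pi> x) (pushforward AB \<pi> x u) (pushforward AB \<pi> x v)) \<and>
       (\<forall>W V x u. open W \<and> smooth_section AX n (vertical_bundle AX AB \<pi> n g) W V \<and>
          x \<in> W \<and> u \<in> tangent_space AX x \<longrightarrow>
          (\<forall>w \<in> vertical_space AX AB \<pi> x. gX x (DX x u V - D x u V) w = 0)))"

section \<open>Algebra of differential forms at a point\<close>

text \<open>A complex-valued form of mixed degree is a function on lists of tangent vectors; its
  value on lists of length \<open>j\<close> is its degree-\<open>j\<close> component. The wedge product is the sum over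
  shuffles, without factorials.\<close>

type_synonym 'v form = "'v list \<Rightarrow> complex"

definition shuffle_sign :: "nat \<Rightarrow> nat set \<Rightarrow> complex"
  where "shuffle_sign n I = (- 1) ^ card {(i, j). i \<in> I \<and> j \<in> {..<n} - I \<and> j < i}"

definition wedge :: "'v form \<Rightarrow> 'v form \<Rightarrow> 'v form"  (infixl \<open>\<^bold>\<and>\<close> 70)
  where "\<alpha> \<^bold>\<and> \<beta> = (\<lambda>vs. \<Sum>I\<in>Pow {..<length vs}.
    shuffle_sign (length vs) I * \<alpha> (nths vs I) * \<beta> (nths vs (- I)))"

definition const_form :: "complex \<Rightarrow> 'v form"
  where "const_form z = (\<lambda>vs. if vs = [] then z else 0)"

primrec wedge_power :: "'v form \<Rightarrow> nat \<Rightarrow> 'v form"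
  where
    "wedge_power \<alpha> 0 = const_form 1"
  | "wedge_power \<alpha> (Suc k) = \<alpha> \<^bold>\<and> wedge_power \<alpha> k"

definition component :: "nat \<Rightarrow> 'v form \<Rightarrow> 'v form"
  where "component j \<alpha> = (\<lambda>vs. if length vs = j then \<alpha> vs else 0)"

text \<open>\<open>f(\<alpha>)\<close> for a power series \<open>f\<close> and a form \<open>\<alpha>\<close> without component of degree 0: the
  \<open>k\<close>-th power then vanishes in degrees below \<open>k\<close>.\<close>

definition form_series :: "complex fps \<Rightarrow> 'v form \<Rightarrow> 'v form"
  where "form_series f \<alpha> = (\<lambda>vs. \<Sum>k\<le>length vs. fps_nth f k * wedge_power \<alpha> k vs)"

primrec matrix_power :: "nat set \<Rightarrow> (nat \<Rightarrow> nat \<Rightarrow> 'v form) \<Rightarrow> nat \<Rightarrow> nat \<Rightarrow> nat \<Rightarrow> 'v form"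
  where
    "matrix_power I M 0 = (\<lambda>i j. const_form (if i = j then 1 else 0))"
  | "matrix_power I M (Suc k) = (\<lambda>i j. \<Sum>l\<in>I. M i l \<^bold>\<and> matrix_power I M k l j)"

text \<open>\<open>tr f(M)\<close> for a matrix \<open>M\<close> of forms without component of degree 0.\<close>

definition trace_series :: "complex fps \<Rightarrow> nat set \<Rightarrow> (nat \<Rightarrow> nat \<Rightarrow> 'v form) \<Rightarrow> 'v form"
  where "trace_series f I M =
    (\<lambda>vs. \<Sum>k\<le>length vs. fps_nth f k * (\<Sum>i\<in>I. matrix_power I M k i i vs))"

section \<open>Complex bundles with connection in local frames\<close>

text \<open>A complex vector bundle with connection near a point, in a local frame: the index set of
  the frame and the connection matrix \<open>\<omega>\<close> of 1-forms,
  \<open>\<nabla>\<^sub>v e\<^sub>j = (\<Sum>i. \<omega> i j y v e\<^sub>i)\<close>. Frames of tensor products and exterior squares are indexed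
  by pairs, which are encoded as natural numbers.\<close>

type_synonym 'x local_conn = "nat set \<times> (nat \<Rightarrow> nat \<Rightarrow> 'x \<Rightarrow> 'x tvec \<Rightarrow> complex)"

definition frame_at :: "('x, 'v) vbundle \<Rightarrow> 'x \<Rightarrow> nat \<Rightarrow> 'x \<Rightarrow> 'v"
  where "frame_at E x = snd (SOME p. p \<in> frames E \<and> x \<in> fst p)"

text \<open>The complexification of \<open>(E, D)\<close> near \<open>x\<close>, in the complexification of an orthonormal
  frame of \<open>E\<close>.\<close>

definition complexification ::
    "nat \<Rightarrow> ('x, 'v) vbundle \<Rightarrow> ('x, 'v) covd \<Rightarrow> 'x \<Rightarrow> 'x local_conn"
  where "complexification n E D x = ({..<n}, \<lambda>i j y v.
    complex_of_real (metric E y (D y v (frame_at E x j)) (frame_at E x i y)))"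

definition trivial_line :: "'x local_conn"
  where "trivial_line = ({0}, \<lambda>i j y v. 0)"

definition tensor_conn :: "'x local_conn \<Rightarrow> 'x local_conn \<Rightarrow> 'x local_conn"
  where "tensor_conn P Q = (prod_encode ` (fst P \<times> fst Q), \<lambda>a b y v.
    case (prod_decode a, prod_decode b) of ((i, k), (j, l)) \<Rightarrow>
      (if k = l then snd P i j y v else 0) + (if i = j then snd Q k l y v else 0))"

text \<open>The frame of the exterior square consists of the \<open>e\<^sub>i \<and> e\<^sub>j\<close> with \<open>i < j\<close>, and
  \<open>\<nabla>(e\<^sub>i \<and> e\<^sub>j) = \<nabla>e\<^sub>i \<and> e\<^sub>j + e\<^sub>i \<and> \<nabla>e\<^sub>j\<close>.\<close>

definition exterior_square :: "'x local_conn \<Rightarrow> 'x local_conn"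
  where "exterior_square P =
    (prod_encode ` {(i, j). i \<in> fst P \<and> j \<in> fst P \<and> i < j}, \<lambda>a b y v.
      case (prod_decode a, prod_decode b) of ((k, l), (i, j)) \<Rightarrow>
        (if l = j then snd P k i y v else 0) - (if k = j then snd P l i y v else 0) +
        (if k = i then snd P l j y v else 0) - (if l = i then snd P k j y v else 0))"

text \<open>Exterior derivative of a 1-form at \<open>x\<close>, evaluated on \<open>u, v\<close> extended with constant
  coordinates (so that the bracket term in Cartan's formula vanishes).\<close>

definition deriv_along :: "'x tvec \<Rightarrow> ('x \<Rightarrow> complex) \<Rightarrow> complex"
  where "deriv_along v f = Complex (v (\<lambda>y. Re (f y))) (v (\<lambda>y. Im (f y)))"

definition ext_deriv ::
    "('x::topological_space, 'e::real_normed_vector) chart set \<Rightarrow>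
     ('x \<Rightarrow> 'x tvec \<Rightarrow> complex) \<Rightarrow> 'x \<Rightarrow> 'x tvec \<Rightarrow> 'x tvec \<Rightarrow> complex"
  where "ext_deriv A \<theta> x u v =
    deriv_along u (\<lambda>y. \<theta> y (coord_ext A (chart_at A x) x v y)) -
    deriv_along v (\<lambda>y. \<theta> y (coord_ext A (chart_at A x) x u y))"

text \<open>\<open>\<Omega> = d\<omega> + \<omega> \<and> \<omega>\<close> at \<open>x\<close>, so that \<open>R(u, v) e\<^sub>j = (\<Sum>i. \<Omega> i j [u, v] e\<^sub>i)\<close>.\<close>

definition curvature ::
    "('x::topological_space, 'e::real_normed_vector) chart set \<Rightarrow> 'x local_conn \<Rightarrow> 'x \<Rightarrow>
     nat \<Rightarrow> nat \<Rightarrow> 'x tvec form"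
  where "curvature A P x = (\<lambda>i j vs. case vs of
      [u, v] \<Rightarrow> ext_deriv A (snd P i j) x u v +
        (\<Sum>k\<in>fst P. snd P i k x u * snd P k j x v - snd P i k x v * snd P k j x u)
    | _ \<Rightarrow> 0)"

section \<open>Chern-Weil forms\<close>

text \<open>The Chern-Weil forms below do not depend on the local frames and charts used to compute
  the curvature matrix. The formal Chern roots are the eigenvalues of \<open>\<i>\<Omega>/2\<pi>\<close>.\<close>

definition chern_character ::
    "('x::topological_space, 'e::real_normed_vector) chart set \<Rightarrow> 'x local_conn \<Rightarrow> 'x \<Rightarrow>
     'x tvec form"
  where "chern_character A P x = trace_series (fps_exp (\<i> / (2 * pi))) (fst P) (curvature A P x)"

text \<open>For the complexification of a real bundle, \<open>p\<^sub>1 = - tr(\<Omega>\<^sup>2) / 8\<pi>\<^sup>2\<close>.\<close>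

definition pontryagin1 ::
    "('x::topological_space, 'e::real_normed_vector) chart set \<Rightarrow> 'x local_conn \<Rightarrow> 'x \<Rightarrow>
     'x tvec form"
  where "pontryagin1 A P x = (- 1 / (8 * pi\<^sup>2)) *\<^sub>R
    (\<Sum>i\<in>fst P. matrix_power (fst P) (curvature A P x) 2 i i)"

text \<open>\<open>ahat_log\<close> is the power series \<open>log ((t/2) / sinh (t/2))\<close>, and
  \<open>\<Prod>\<^sub>j (y\<^sub>j/2) / sinh (y\<^sub>j/2) = det\<^sup>1\<^sup>/\<^sup>2 ((R/2) / sinh (R/2)) = exp (tr (ahat_log R) / 2)\<close>
  for \<open>R = \<i>\<Omega>/2\<pi>\<close> with eigenvalues \<open>\<plusminus>y\<^sub>j\<close> and possibly 0.\<close>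

definition sinh_series :: "complex fps"
  where "sinh_series = Abs_fps (\<lambda>k. if even k then 1 / (2 ^ k * fact (k + 1)) else 0)"

definition ahat_log :: "complex fps"
  where "ahat_log = - (fps_ln 1 oo (sinh_series - 1))"

definition ahat_form ::
    "('x::topological_space, 'e::real_normed_vector) chart set \<Rightarrow> 'x local_conn \<Rightarrow> 'x \<Rightarrow>
     'x tvec form"
  where "ahat_form A P x = form_series (fps_exp 1) ((1 / 2) *\<^sub>R
    trace_series ahat_log (fst P) (\<lambda>i j vs. \<i> / (2 * pi) * curvature A P x i j vs))"

text \<open>Euler form of an oriented real bundle of rank 2, in the complexification of an oriented
  orthonormal frame \<open>(e\<^sub>0, e\<^sub>1)\<close>: \<open>\<langle>R e\<^sub>1, e\<^sub>0\<rangle> / 2\<pi>\<close>, which is the Gauss curvature form over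
  \<open>2\<pi>\<close> for the tangent bundle of a surface.\<close>

definition euler_form2 ::
    "('x::topological_space, 'e::real_normed_vector) chart set \<Rightarrow> 'x local_conn \<Rightarrow> 'x \<Rightarrow>
     'x tvec form"
  where "euler_form2 A P x = (1 / (2 * pi)) *\<^sub>R curvature A P x 0 1"

section \<open>Virtual bundles\<close>

text \<open>Elements of \<open>K(X)\<close> are represented by formal integral combinations of complex bundles
  with connection; integers stand for multiples of the trivial line bundle.\<close>

type_synonym 'x virtual = "(int \<times> 'x local_conn) list"

definition actual :: "'x local_conn \<Rightarrow> 'x virtual"
  where "actual P = [(1, P)]"

definition trivial_virtual :: "int \<Rightarrow> 'x virtual"
  where "trivial_virtual k = [(k, trivial_line)]"

definition scale_virtual :: "int \<Rightarrow> 'x virtual \<Rightarrow> 'x virtual"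
  where "scale_virtual k E = map (\<lambda>(a, P). (k * a, P)) E"

definition add_virtual :: "'x virtual \<Rightarrow> 'x virtual \<Rightarrow> 'x virtual"  (infixl \<open>\<oplus>\<close> 65)
  where "E \<oplus> E' = E @ E'"

definition sub_virtual :: "'x virtual \<Rightarrow> 'x virtual \<Rightarrow> 'x virtual"  (infixl \<open>\<ominus>\<close> 65)
  where "E \<ominus> E' = E @ scale_virtual (- 1) E'"

definition tensor_virtual :: "'x virtual \<Rightarrow> 'x virtual \<Rightarrow> 'x virtual"  (infixl \<open>\<otimes>\<close> 70)
  where "E \<otimes> E' = [(a * b, tensor_conn P Q). (a, P) \<leftarrow> E, (b, Q) \<leftarrow> E']"

definition reduced_virtual :: "'x local_conn \<Rightarrow> 'x virtual"
  where "reduced_virtual P = actual P \<ominus> trivial_virtual (int (card (fst P)))"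

definition chern_character_virtual ::
    "('x::topological_space, 'e::real_normed_vector) chart set \<Rightarrow> 'x virtual \<Rightarrow> 'x \<Rightarrow>
     'x tvec form"
  where "chern_character_virtual A E x =
    sum_list (map (\<lambda>(a, P). of_int a *\<^sub>R chern_character A P x) E)"

text \<open>The virtual bundles \<open>\<EE>\<close> and \<open>\<FF>\<close>, for the complexifications \<open>T\<close>, \<open>F\<close>, \<open>X\<close> of the vertical
  tangent bundle, of a bundle of rank \<open>m\<close> and of a bundle of rank 2. The product
  \<open>(m-32)(m-31)\<close> is even.\<close>

definition frakF :: "nat \<Rightarrow> 'x local_conn \<Rightarrow> 'x local_conn \<Rightarrow> 'x virtual"
  where "frakF m T F =
    actual (exterior_square F) \<oplus> actual T
      \<oplus> trivial_virtual ((int m - 32) * (int m - 31) div 2 - 2)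
      \<ominus> scale_virtual (int m - 32) (actual F)"

definition frakE :: "nat \<Rightarrow> 'x local_conn \<Rightarrow> 'x local_conn \<Rightarrow> 'x local_conn \<Rightarrow> 'x virtual"
  where "frakE m T F X = frakF m T F
    \<oplus> scale_virtual 5 (reduced_virtual X \<otimes> reduced_virtual X)
    \<oplus> scale_virtual 3 ((trivial_virtual (int m - 31) \<ominus> actual F) \<otimes> reduced_virtual X)"

text \<open>\<open>(exp (t/24) - 1) / t\<close>\<close>

definition exp24_quotient :: "complex fps"
  where "exp24_quotient = Abs_fps (\<lambda>k. 1 / (24 ^ (k + 1) * fact (k + 1)))"

end

theory Submission
  imports Defs
begin

text \<open>
  Write \<open>A\<close> for the Hirzebruch form, \<open>E\<close> for the virtual bundle \<open>frakE\<close>, and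
  \<open>t\<^sub>k\<close>, \<open>f\<^sub>k\<close> for the part of degree \<open>2 k\<close> of the Chern characters of the
  complexifications of \<open>TZ\<close> and \<open>F\<close>; they vanish for odd \<open>k\<close> since the curvature of a
  Euclidean connection is skew-symmetric, and \<open>p = t\<^sub>2 - f\<^sub>2\<close>. As
  \<open>p (e\<^bsup>p/24\<^esup> - 1) / p = e\<^bsup>p/24\<^esup> - 1\<close>, the claim says that the degree 12 part of
  \<open>e\<^bsup>p/24\<^esup> A e\<^bsup>c/2\<^esup> (ch E - p)\<close> vanishes. Using
  \<open>log A = - t\<^sub>2/24 + t\<^sub>4/240 - t\<^sub>6/504 + \<dots>\<close>,
  \<open>2 ch (\<and>\<^sup>2 F)\<^sub>k = (ch F ch F)\<^sub>k - 2\<^sup>k f\<^sub>k\<close> and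
  \<open>ch \<xi> = 2 + c\<^sup>2 + c\<^sup>4/12 + c\<^sup>6/360 + \<dots>\<close>, all of these are polynomials in
  \<open>t\<^sub>k\<close>, \<open>f\<^sub>k\<close> and \<open>c\<close>, and the degree 12 part is identically zero. The second identity
  is the same computation with \<open>c = 0\<close>.
\<close>

section \<open>The algebra of even forms\<close>

text \<open>The vanishing has a pattern. Put u = f_2 - 3 c^2. The t_2 cancels both in exp(p/24) A
  and in ch E - p: the degree 4 part of exp(p/24) A exp(c/2) is - u/24, that of ch E - p is 31 u,
  and the rank of E is 504 for every m. Hence t_6 drops out because 1 - 504/504 = 0, t_4 because (1
  + 504/240) / 24 = 31/240, and f_4 because its coefficients in ch E are 24 in degree 8 and u in
  degree 12. A cubic in f_2 and c^2 remains, and it is zero. The obstacle is where to compute. Forms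
  are arbitrary complex functions on lists, with no multilinearity or alternation built in, and the
  curvature is under control only on tangent vectors, whose action is additive only on smooth
  functions. So the functions supported on lists of even length are made into a commutative ring,
  the identity is proved there, and the result is carried back to lists of tangent vectors.\<close>

definition insertion :: "'v \<Rightarrow> 'v form \<Rightarrow> 'v form"
  where "insertion v \<alpha> = (\<lambda>vs. \<alpha> (v # vs))"

text \<open>The grading involution, which supplies the sign in the Leibniz rule for the contraction
  \<open>insertion\<close>.\<close>

definition parity :: "'v form \<Rightarrow> 'v form"
  where "parity \<alpha> = (\<lambda>vs. (- 1) ^ length vs * \<alpha> vs)"

section \<open>Shuffle product of arbitrary functions on lists\<close>

lemma shuffle_sign_insert_0:
  "shuffle_sign (Suc n) (insert 0 (Suc ` I)) = shuffle_sign n I"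
proof -
  have "{(i, j). i \<in> insert 0 (Suc ` I) \<and> j \<in> {..<Suc n} - insert 0 (Suc ` I) \<and> j < i}
      = map_prod Suc Suc ` {(i, j). i \<in> I \<and> j \<in> {..<n} - I \<and> j < i}" (is "?L = _ ` ?R")
  proof (intro equalityI subsetI)
    fix x assume "x \<in> ?L"
    then obtain i j where x: "x = (i, j)" and ij: "i \<in> insert 0 (Suc ` I)" "j < Suc n"
      "j \<notin> insert 0 (Suc ` I)" "j < i"
      by auto
    then obtain i' where "i = Suc i'" "i' \<in> I"
      by auto
    moreover obtain j' where "j = Suc j'"
      using ij(3) by (cases j) auto
    ultimately show "x \<in> map_prod Suc Suc ` ?R"
      using x ij by auto
  qed auto
  moreover have "card (map_prod Suc Suc ` ?R) = card ?R"
    by (intro card_image) (auto simp: inj_on_def)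
  ultimately show ?thesis
    by (simp add: shuffle_sign_def)
qed

text \<open>Position 0 now lies in the complement and forms one inversion with each element of
  \<open>I\<close>, whence the extra sign.\<close>

lemma shuffle_sign_Suc_image:
  assumes "finite I"
  shows "shuffle_sign (Suc n) (Suc ` I) = (- 1) ^ card I * shuffle_sign n I"
proof -
  let ?R = "{(i, j). i \<in> I \<and> j \<in> {..<n} - I \<and> j < i}"
  have "{(i, j). i \<in> Suc ` I \<and> j \<in> {..<Suc n} - Suc ` I \<and> j < i}
      = map_prod Suc Suc ` ?R \<union> (\<lambda>i. (Suc i, 0)) ` I" (is "?L = ?M")
  proof (intro equalityI subsetI)
    fix x assume "x \<in> ?L"
    then obtain i j where x: "x = (i, j)" and ij: "i \<in> Suc ` I" "j < Suc n"
      "j \<notin> Suc ` I" "j < i"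
      by auto
    then obtain i' where "i = Suc i'" "i' \<in> I"
      by auto
    then show "x \<in> ?M"
      using x ij by (cases j) (auto simp: image_iff)
  qed auto
  moreover have "finite ?R"
    by (rule finite_subset[of _ "I \<times> {..<n}"]) (use assms in auto)
  moreover have "card (map_prod Suc Suc ` ?R) = card ?R"
    by (intro card_image) (auto simp: inj_on_def)
  moreover have "card ((\<lambda>i. (Suc i, 0::nat)) ` I) = card I"
    by (intro card_image) (auto simp: inj_on_def)
  moreover have "map_prod Suc Suc ` ?R \<inter> (\<lambda>i. (Suc i, 0)) ` I = {}"
    by auto
  ultimately have "card {(i, j). i \<in> Suc ` I \<and> j \<in> {..<Suc n} - Suc ` I \<and> j < i}
      = card ?R + card I"
    using assms by (simp add: card_Un_disjoint)
  then show ?thesis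
    by (simp add: shuffle_sign_def power_add)
qed

lemma length_nths_subset: "I \<subseteq> {..<length vs} \<Longrightarrow> length (nths vs I) = card I"
  by (auto simp: length_nths intro: arg_cong[where f = card])

lemma length_nths_compl:
  assumes "I \<subseteq> {..<length vs}"
  shows "length (nths vs (- I)) = length vs - card I"
proof -
  have "{i. i < length vs \<and> i \<in> - I} = {..<length vs} - I"
    by auto
  then show ?thesis
    using assms finite_subset[OF assms] by (simp add: length_nths card_Diff_subset)
qed

lemma wedge_Nil: "(\<alpha> \<^bold>\<and> \<beta>) [] = \<alpha> [] * \<beta> []"
  by (simp add: wedge_def shuffle_sign_def)

text \<open>This Leibniz rule determines the shuffle product; associativity and graded commutativity
  follow from it by induction on the list, for arbitrary (not only alternating) forms.\<close>

lemma wedge_Cons: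
  "(\<alpha> \<^bold>\<and> \<beta>) (v # vs) = (insertion v \<alpha> \<^bold>\<and> \<beta>) vs + (parity \<alpha> \<^bold>\<and> insertion v \<beta>) vs"
proof -
  define n where "n = length vs"
  define G where "G I = shuffle_sign (Suc n) I * \<alpha> (nths (v # vs) I) * \<beta> (nths (v # vs) (- I))" for I
  \<comment> \<open>Subsets are sorted by whether position 0, which holds \<open>v\<close>, goes to
    the first factor or to the second; each sort is a shifted copy of the subsets for
    \<open>vs\<close>.\<close>
  have split: "Pow {..<Suc n} = image Suc ` Pow {..<n} \<union> (insert 0 \<circ> image Suc) ` Pow {..<n}"
    unfolding lessThan_Suc_eq_insert_0 Pow_insert image_Pow_surj[OF refl, symmetric] image_comp ..
  have disj: "image Suc ` Pow {..<n} \<inter> (insert 0 \<circ> image Suc) ` Pow {..<n} = {}"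
    by auto
  have inj: "inj_on (image Suc) (Pow {..<n})" "inj_on (insert 0 \<circ> image Suc) (Pow {..<n})"
    by (auto simp: inj_on_def image_iff set_eq_iff)
  have "(\<alpha> \<^bold>\<and> \<beta>) (v # vs) = sum G (Pow {..<Suc n})"
    by (simp add: wedge_def G_def n_def)
  also have "\<dots> = (\<Sum>I\<in>Pow {..<n}. G (Suc ` I)) + (\<Sum>I\<in>Pow {..<n}. G (insert 0 (Suc ` I)))"
    unfolding split
    by (subst sum.union_disjoint[OF _ _ disj])
      (use sum.reindex[OF inj(1), of G] sum.reindex[OF inj(2), of G] in \<open>simp_all add: comp_def\<close>)
  also have "(\<Sum>I\<in>Pow {..<n}. G (insert 0 (Suc ` I))) = (insertion v \<alpha> \<^bold>\<and> \<beta>) vs"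
    unfolding wedge_def n_def[symmetric]
  proof (intro sum.cong refl)
    fix I assume "I \<in> Pow {..<n}"
    have "{j. Suc j \<in> insert 0 (Suc ` I)} = I" "{j. Suc j \<in> - insert 0 (Suc ` I)} = - I"
      by auto
    then show "G (insert 0 (Suc ` I)) =
        shuffle_sign n I * insertion v \<alpha> (nths vs I) * \<beta> (nths vs (- I))"
      by (simp add: G_def nths_Cons shuffle_sign_insert_0 insertion_def)
  qed
  also have "(\<Sum>I\<in>Pow {..<n}. G (Suc ` I)) = (parity \<alpha> \<^bold>\<and> insertion v \<beta>) vs"
    unfolding wedge_def n_def[symmetric]
  proof (intro sum.cong refl)
    fix I assume I: "I \<in> Pow {..<n}"
    have "{j. Suc j \<in> Suc ` I} = I" "{j. Suc j \<in> - Suc ` I} = - I"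
      by auto
    moreover have "finite I" "length (nths vs I) = card I"
      using I by (auto simp: n_def intro: finite_subset length_nths_subset)
    ultimately show "G (Suc ` I) =
        shuffle_sign n I * parity \<alpha> (nths vs I) * insertion v \<beta> (nths vs (- I))"
      by (simp add: G_def nths_Cons shuffle_sign_Suc_image insertion_def parity_def)
  qed
  finally show ?thesis
    by simp
qed

lemma wedge_add_left: "(\<alpha> + \<beta>) \<^bold>\<and> \<gamma> = \<alpha> \<^bold>\<and> \<gamma> + \<beta> \<^bold>\<and> \<gamma>"
  by (auto simp: wedge_def fun_eq_iff algebra_simps sum.distrib)

lemma wedge_add_right: "\<gamma> \<^bold>\<and> (\<alpha> + \<beta>) = \<gamma> \<^bold>\<and> \<alpha> + \<gamma> \<^bold>\<and> \<beta>"
  by (auto simp: wedge_def fun_eq_iff algebra_simps sum.distrib)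

lemma wedge_scale_left: "(\<lambda>vs. z * \<alpha> vs) \<^bold>\<and> \<beta> = (\<lambda>vs. z * (\<alpha> \<^bold>\<and> \<beta>) vs)"
  by (auto simp: wedge_def fun_eq_iff sum_distrib_left algebra_simps)

lemma insertion_wedge: "insertion v (\<alpha> \<^bold>\<and> \<beta>) = insertion v \<alpha> \<^bold>\<and> \<beta> + parity \<alpha> \<^bold>\<and> insertion v \<beta>"
  by (simp add: insertion_def[of v "\<alpha> \<^bold>\<and> \<beta>"] wedge_Cons fun_eq_iff)

lemma parity_wedge: "parity (\<alpha> \<^bold>\<and> \<beta>) = parity \<alpha> \<^bold>\<and> parity \<beta>"
proof
  fix vs
  have "(- 1) ^ length vs * (shuffle_sign (length vs) I * \<alpha> (nths vs I) * \<beta> (nths vs (- I)))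
      = shuffle_sign (length vs) I * parity \<alpha> (nths vs I) * parity \<beta> (nths vs (- I))"
    if "I \<subseteq> {..<length vs}" for I
  proof -
    have "card I \<le> length vs"
      using card_mono[OF _ that] by simp
    then have "length vs = card I + (length vs - card I)"
      by simp
    then have "(- 1 :: complex) ^ length vs = (- 1) ^ card I * (- 1) ^ (length vs - card I)"
      by (metis power_add)
    then show ?thesis
      using that by (simp add: parity_def length_nths_subset length_nths_compl)
  qed
  moreover have "parity (\<alpha> \<^bold>\<and> \<beta>) vs = (- 1) ^ length vs * (\<alpha> \<^bold>\<and> \<beta>) vs"
    by (simp add: parity_def)
  ultimately show "parity (\<alpha> \<^bold>\<and> \<beta>) vs = (parity \<alpha> \<^bold>\<and> parity \<beta>) vs"
    unfolding wedge_def sum_distrib_left by (auto intro: sum.cong)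
qed

text \<open>By the Leibniz rule both sides expand into the same three products on the tail, since
  \<open>parity\<close> is multiplicative. The factors change on the way, so the induction must be
  general in them.\<close>

lemma wedge_assoc: "(\<alpha> \<^bold>\<and> \<beta>) \<^bold>\<and> \<gamma> = \<alpha> \<^bold>\<and> (\<beta> \<^bold>\<and> \<gamma>)"
proof
  fix vs
  show "((\<alpha> \<^bold>\<and> \<beta>) \<^bold>\<and> \<gamma>) vs = (\<alpha> \<^bold>\<and> (\<beta> \<^bold>\<and> \<gamma>)) vs"
    by (induction vs arbitrary: \<alpha> \<beta> \<gamma>)
      (simp_all add: wedge_Nil wedge_Cons insertion_wedge parity_wedge wedge_add_left wedge_add_right)
qed

lemma parity_insertion: "parity (insertion v \<alpha>) = (\<lambda>vs. - insertion v (parity \<alpha>) vs)"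
  by (simp add: parity_def insertion_def fun_eq_iff)

text \<open>The sign depends on a degree only through the eigenvalue of \<open>parity\<close>, and
  \<open>insertion\<close> flips that eigenvalue. This makes the induction work without homogeneous
  forms: the exponents pass from \<open>a\<close> to \<open>a + 1\<close>.\<close>

lemma wedge_graded_commute:
  assumes "parity \<alpha> = (\<lambda>vs. (- 1) ^ a * \<alpha> vs)" "parity \<beta> = (\<lambda>vs. (- 1) ^ b * \<beta> vs)"
  shows "(\<alpha> \<^bold>\<and> \<beta>) vs = (- 1) ^ (a * b) * (\<beta> \<^bold>\<and> \<alpha>) vs"
  using assms
proof (induction vs arbitrary: \<alpha> \<beta> a b)
  case Nil
  have "\<alpha> [] = (- 1) ^ a * \<alpha> []" "\<beta> [] = (- 1) ^ b * \<beta> []"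
    using fun_cong[OF Nil(1), of "[]"] fun_cong[OF Nil(2), of "[]"] by (simp_all add: parity_def)
  \<comment> \<open>The sign is - 1 only if both exponents are odd, and then both values on the
    empty list are 0.\<close>
  then have "\<alpha> [] = 0 \<or> even a" "\<beta> [] = 0 \<or> even b"
    by (auto simp: minus_one_power_iff split: if_splits)
  then show ?case
    by (auto simp: wedge_Nil)
next
  case (Cons v vs)
  have ins: "parity (insertion v \<alpha>) = (\<lambda>vs. (- 1) ^ (a + 1) * insertion v \<alpha> vs)"
    "parity (insertion v \<beta>) = (\<lambda>vs. (- 1) ^ (b + 1) * insertion v \<beta> vs)"
    unfolding parity_insertion Cons.prems by (simp_all add: insertion_def)
  have 1: "(insertion v \<alpha> \<^bold>\<and> \<beta>) vs = (- 1) ^ ((a + 1) * b) * (\<beta> \<^bold>\<and> insertion v \<alpha>) vs"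
    by (rule Cons.IH[OF ins(1) Cons.prems(2)])
  have 2: "(\<alpha> \<^bold>\<and> insertion v \<beta>) vs = (- 1) ^ (a * (b + 1)) * (insertion v \<beta> \<^bold>\<and> \<alpha>) vs"
    by (rule Cons.IH[OF Cons.prems(1) ins(2)])
  show ?case
    by (simp add: wedge_Cons Cons.prems wedge_scale_left 1 2 minus_one_power_iff)
qed

lemma wedge_const_form_left:
  fixes \<alpha> :: "'v form"
  shows "const_form z \<^bold>\<and> \<alpha> = (\<lambda>vs. z * \<alpha> vs)"
proof
  fix vs
  have 1: "parity (const_form z) = (const_form z :: 'v form)"
    by (auto simp: parity_def const_form_def)
  have 2: "(insertion v (const_form z) \<^bold>\<and> \<alpha>) vs = 0" for v :: 'v and \<alpha> vs
    by (simp add: insertion_def const_form_def wedge_def)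
  have 3: "insertion v \<alpha> vs = \<alpha> (v # vs)" for v :: 'v and \<alpha> vs
    by (simp add: insertion_def)
  show "(const_form z \<^bold>\<and> \<alpha>) vs = z * \<alpha> vs"
    by (induction vs arbitrary: \<alpha>) (simp_all add: wedge_Nil wedge_Cons 1 2 3, simp add: const_form_def)
qed

section \<open>The commutative ring of forms of even degree\<close>

typedef 'v eform = "{\<alpha> :: 'v form. \<forall>vs. odd (length vs) \<longrightarrow> \<alpha> vs = 0}"
  by (rule exI[of _ "\<lambda>_. 0"]) simp

setup_lifting type_definition_eform

text \<open>Evenness becomes an equation, so that closure under the product is multiplicativity of
  \<open>parity\<close>.\<close>

lemma even_form_iff_parity: "(\<forall>vs. odd (length vs) \<longrightarrow> \<alpha> vs = 0) \<longleftrightarrow> parity \<alpha> = \<alpha>"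
  by (auto simp: parity_def fun_eq_iff minus_one_power_iff)

lemma even_form_wedge:
  assumes "\<And>vs. odd (length vs) \<Longrightarrow> \<alpha> vs = 0" "\<And>vs. odd (length vs) \<Longrightarrow> \<beta> vs = 0"
    "odd (length vs)"
  shows "(\<alpha> \<^bold>\<and> \<beta>) vs = 0"
proof -
  have "parity \<alpha> = \<alpha>" "parity \<beta> = \<beta>"
    using assms by (auto simp flip: even_form_iff_parity)
  then have "parity (\<alpha> \<^bold>\<and> \<beta>) = \<alpha> \<^bold>\<and> \<beta>"
    by (simp add: parity_wedge)
  then show ?thesis
    using assms(3) even_form_iff_parity by blast
qed

instantiation eform :: (type) comm_ring_1
begin

lift_definition zero_eform :: "'a eform" is "\<lambda>_. 0" by simp
lift_definition one_eform :: "'a eform" is "const_form 1" by (auto simp: const_form_def)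
lift_definition plus_eform :: "'a eform \<Rightarrow> 'a eform \<Rightarrow> 'a eform" is "\<lambda>\<alpha> \<beta> vs. \<alpha> vs + \<beta> vs" by simp
lift_definition minus_eform :: "'a eform \<Rightarrow> 'a eform \<Rightarrow> 'a eform" is "\<lambda>\<alpha> \<beta> vs. \<alpha> vs - \<beta> vs" by simp
lift_definition uminus_eform :: "'a eform \<Rightarrow> 'a eform" is "\<lambda>\<alpha> vs. - \<alpha> vs" by simp
lift_definition times_eform :: "'a eform \<Rightarrow> 'a eform \<Rightarrow> 'a eform" is "\<lambda>\<alpha> \<beta>. \<alpha> \<^bold>\<and> \<beta>"
  by (blast intro: even_form_wedge)

instance
proof
  fix a b c :: "'a eform"
  show "a * b * c = a * (b * c)"
    by transfer (rule wedge_assoc)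
  show "a * b = b * a"
  proof transfer
    fix \<alpha> \<beta> :: "'a form"
    assume "\<forall>vs. odd (length vs) \<longrightarrow> \<alpha> vs = 0" "\<forall>vs. odd (length vs) \<longrightarrow> \<beta> vs = 0"
    then have "parity \<alpha> = (\<lambda>vs. (- 1) ^ 0 * \<alpha> vs)" "parity \<beta> = (\<lambda>vs. (- 1) ^ 0 * \<beta> vs)"
      by (simp_all add: even_form_iff_parity)
    from wedge_graded_commute[OF this] show "\<alpha> \<^bold>\<and> \<beta> = \<beta> \<^bold>\<and> \<alpha>"
      by (simp add: fun_eq_iff)
  qed
  show "1 * a = a"
    by transfer (simp add: wedge_const_form_left)
  show "(a + b) * c = a * c + b * c"
    by transfer (auto simp: wedge_def algebra_simps sum.distrib)
  show "(0 :: 'a eform) \<noteq> 1"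
    by transfer (auto simp: const_form_def fun_eq_iff)
qed (transfer; simp add: fun_eq_iff)+

end

text \<open>Complex coefficients enter as ring elements of degree 0, so that they take part in
  ordinary ring normalisation.\<close>

lift_definition scalar :: "complex \<Rightarrow> 'v eform" is const_form
  by (auto simp: const_form_def)

lemma Rep_scalar_mult: "Rep_eform (scalar z * a) vs = z * Rep_eform a vs"
  by transfer (simp add: wedge_const_form_left)

lemma scalar_1 [simp]: "scalar 1 = 1"
  by transfer simp

lemma scalar_0 [simp]: "scalar 0 = 0"
  by transfer (simp add: const_form_def)

lemma scalar_add: "scalar (a + b) = scalar a + scalar b"
  by transfer (auto simp: const_form_def)

lemma scalar_diff: "scalar (a - b) = scalar a - scalar b"
  by transfer (auto simp: const_form_def)

lemma scalar_minus: "scalar (- a) = - scalar a"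
  by transfer (auto simp: const_form_def)

lemma scalar_mult: "scalar (a * b) = scalar a * scalar b"
  by transfer (auto simp: wedge_const_form_left, simp add: const_form_def fun_eq_iff)

lemma scalar_power: "scalar (a ^ n) = scalar a ^ n"
  by (induction n) (simp_all add: scalar_mult)

lemma scalar_of_nat: "scalar (of_nat n) = of_nat n"
  by (induction n) (simp_all add: scalar_add)

lemma scalar_numeral: "scalar (numeral n) = numeral n"
  using scalar_of_nat[of "numeral n"] by simp

lemma Rep_eform_sum: "Rep_eform (sum f S) vs = (\<Sum>i\<in>S. Rep_eform (f i) vs)"
  by (induction S rule: infinite_finite_induct) (simp_all add: zero_eform.rep_eq plus_eform.rep_eq)

lemma Rep_eform_odd: "odd (length vs) \<Longrightarrow> Rep_eform a vs = 0"
  using Rep_eform[of a] by simp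

section \<open>Grading and power series\<close>

text \<open>Indexed by half the degree: the degrees 12 and 8 of the claim are \<open>gr 6\<close>
  and \<open>gr 4\<close>.\<close>

lift_definition gr :: "nat \<Rightarrow> 'v eform \<Rightarrow> 'v eform" is "\<lambda>n. component (2 * n)"
  by (auto simp: component_def)

lemma gr_add: "gr n (a + b) = gr n a + gr n b"
  by transfer (auto simp: component_def)

lemma gr_diff: "gr n (a - b) = gr n a - gr n b"
  by transfer (auto simp: component_def)

lemma gr_minus: "gr n (- a) = - gr n a"
  by transfer (auto simp: component_def)

lemma gr_0 [simp]: "gr n 0 = 0"
  by transfer (auto simp: component_def)

lemma gr_scalar: "gr n (scalar z) = (if n = 0 then scalar z else 0)"
  by transfer (auto simp: component_def const_form_def)

lemma gr_scalar_mult: "gr n (scalar z * a) = scalar z * gr n a"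
  by (simp flip: Rep_eform_inject add: fun_eq_iff Rep_scalar_mult gr.rep_eq component_def)

lemma gr_1: "gr n 1 = (if n = 0 then 1 else 0)"
  unfolding scalar_1[symmetric] gr_scalar ..

lemma gr_sum: "gr n (sum f S) = (\<Sum>i\<in>S. gr n (f i))"
  by (induction S rule: infinite_finite_induct) (simp_all add: gr_add)

text \<open>A subset of odd size contributes nothing, because an even form vanishes on lists of odd
  length; a subset of size \<open>2 * k\<close> contributes to the summand \<open>i = k\<close>
  only.\<close>

lemma gr_mult: "gr n (a * b) = (\<Sum>i\<le>n. gr i a * gr (n - i) b)"
proof -
  have "Rep_eform (gr n (a * b)) vs = Rep_eform (\<Sum>i\<le>n. gr i a * gr (n - i) b) vs" for vs
  proof -
    define \<alpha> \<beta> where "\<alpha> = Rep_eform a" and "\<beta> = Rep_eform b"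
    define s where "s = shuffle_sign (length vs)"
    have "(\<Sum>i\<le>n. s I * component (2 * i) \<alpha> (nths vs I) * component (2 * (n - i)) \<beta> (nths vs (- I)))
        = (if length vs = 2 * n then s I * \<alpha> (nths vs I) * \<beta> (nths vs (- I)) else 0)"
      if I: "I \<subseteq> {..<length vs}" for I
    proof (cases "odd (card I)")
      case True
      then have "\<alpha> (nths vs I) = 0"
        unfolding \<alpha>_def by (intro Rep_eform_odd) (simp add: length_nths_subset[OF I])
      then have "component d \<alpha> (nths vs I) = 0" for d
        by (simp add: component_def)
      then show ?thesis
        using \<open>\<alpha> (nths vs I) = 0\<close> by simp
    next
      case False
      then obtain k where k: "card I = 2 * k"
        by (auto elim: evenE)
      have "2 * k \<le> length vs"
        using card_mono[OF _ I] k by simp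
      then have "s I * component (2 * i) \<alpha> (nths vs I) * component (2 * (n - i)) \<beta> (nths vs (- I))
        = (if i = k then (if length vs = 2 * n then s I * \<alpha> (nths vs I) * \<beta> (nths vs (- I)) else 0) else 0)"
        if "i \<le> n" for i
        using that by (auto simp: component_def length_nths_subset[OF I] length_nths_compl[OF I] k)
      then show ?thesis
        using \<open>2 * k \<le> length vs\<close> by (simp add: sum.delta)
    qed
    then have "(\<Sum>I\<in>Pow {..<length vs}. \<Sum>i\<le>n.
        s I * component (2 * i) \<alpha> (nths vs I) * component (2 * (n - i)) \<beta> (nths vs (- I)))
      = (\<Sum>I\<in>Pow {..<length vs}.
          if length vs = 2 * n then s I * \<alpha> (nths vs I) * \<beta> (nths vs (- I)) else 0)"
      by (intro sum.cong) auto
    also have "\<dots> = Rep_eform (gr n (a * b)) vs"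
      by (simp add: gr.rep_eq times_eform.rep_eq component_def wedge_def \<alpha>_def \<beta>_def s_def)
    finally show ?thesis
      by (subst (asm) sum.swap)
        (simp add: Rep_eform_sum gr.rep_eq times_eform.rep_eq wedge_def \<alpha>_def \<beta>_def s_def)
  qed
  then show ?thesis
    by (simp flip: Rep_eform_inject add: fun_eq_iff)
qed

definition homogeneous :: "nat \<Rightarrow> 'v eform \<Rightarrow> bool"
  where "homogeneous n a \<longleftrightarrow> (\<forall>k. gr k a = (if k = n then a else 0))"

lemma homogeneous_gr: "homogeneous n (gr n a)"
  unfolding homogeneous_def by transfer (auto simp: component_def fun_eq_iff)

lemma homogeneous_mult:
  assumes "homogeneous m a" "homogeneous n b"
  shows "homogeneous (m + n) (a * b)"
proof -
  have "gr k (a * b) = (\<Sum>i\<le>k. if i = m then (if k - m = n then a * b else 0) else 0)" for k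
    unfolding gr_mult using assms by (intro sum.cong) (auto simp: homogeneous_def)
  then show ?thesis
    by (auto simp: homogeneous_def)
qed

lemma homogeneous_sum: "(\<And>i. i \<in> S \<Longrightarrow> homogeneous n (f i)) \<Longrightarrow> homogeneous n (sum f S)"
  by (auto simp: homogeneous_def gr_sum)

lemma homogeneous_scalar_mult: "homogeneous n a \<Longrightarrow> homogeneous n (scalar z * a)"
  by (auto simp: homogeneous_def gr_scalar_mult)

lemma homogeneous_diff: "homogeneous n a \<Longrightarrow> homogeneous n b \<Longrightarrow> homogeneous n (a - b)"
  by (auto simp: homogeneous_def gr_diff)

lemma homogeneous_0: "homogeneous n 0"
  by (auto simp: homogeneous_def)

lemma homogeneous_1: "homogeneous 0 1"
  by (auto simp: homogeneous_def gr_1)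

lemma homogeneous_power: "homogeneous n a \<Longrightarrow> homogeneous (n * k) (a ^ k)"
  by (induction k) (auto intro: homogeneous_mult homogeneous_1)

lemma gr_power_eq_0: "gr 0 a = 0 \<Longrightarrow> n < k \<Longrightarrow> gr n (a ^ k) = 0"
proof (induction k arbitrary: n)
  case (Suc k)
  have "gr i a * gr (n - i) (a ^ k) = 0" if "i \<le> n" for i
    using Suc that by (cases "i = 0") auto
  then show ?case
    by (simp add: gr_mult)
qed simp

lemma eform_eqI:
  assumes "\<And>n. gr n a = gr n b"
  shows "a = b"
proof -
  have "Rep_eform a vs = Rep_eform b vs" for vs
  proof (cases "odd (length vs)")
    case True
    then show ?thesis
      by (simp add: Rep_eform_odd)
  next
    case False
    then obtain n where "length vs = 2 * n"
      by (auto elim: evenE)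
    then show ?thesis
      using arg_cong[OF assms[of n], of "\<lambda>c. Rep_eform c vs"] by (simp add: gr.rep_eq component_def)
  qed
  then show ?thesis
    by (simp flip: Rep_eform_inject add: fun_eq_iff)
qed

text \<open>The cut-off at \<open>length vs\<close> is that of \<open>form_series\<close> and
  \<open>trace_series\<close>. The sequence \<open>s\<close> is arbitrary in order to cover both
  powers of a form and traces of matrix powers.\<close>

lift_definition ser :: "complex fps \<Rightarrow> (nat \<Rightarrow> 'v eform) \<Rightarrow> 'v eform"
  is "\<lambda>f s vs. \<Sum>k\<le>length vs. fps_nth f k * s k vs"
  by simp

lemma gr_ser: "gr n (ser f s) = (\<Sum>k\<le>2 * n. scalar (fps_nth f k) * gr n (s k))"
  by (simp flip: Rep_eform_inject add: fun_eq_iff Rep_scalar_mult Rep_eform_sum gr.rep_eq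
      component_def ser.rep_eq)

lemma gr_ser_homogeneous:
  assumes "\<And>k. homogeneous k (s k)"
  shows "gr n (ser f s) = scalar (fps_nth f n) * s n"
proof -
  have "gr n (ser f s) = (\<Sum>k\<le>2 * n. if k = n then scalar (fps_nth f n) * s n else 0)"
    unfolding gr_ser using assms by (intro sum.cong) (auto simp: homogeneous_def)
  then show ?thesis
    by simp
qed

text \<open>The cut-off in degree \<open>2 * n\<close> is twice what is needed: powers above the
  \<open>n\<close>-th start beyond that degree.\<close>

lemma gr_ser_power:
  assumes "gr 0 a = 0"
  shows "gr n (ser f (\<lambda>k. a ^ k)) = (\<Sum>k\<le>n. scalar (fps_nth f k) * gr n (a ^ k))"
  unfolding gr_ser by (rule sum.mono_neutral_right) (auto simp: gr_power_eq_0[OF assms])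

text \<open>The inverse of the integer is a complex scalar. This removes the factors 2 that come
  from skew-symmetry and from exterior squares.\<close>

lemma eform_cancel: "of_nat (Suc k) * a = of_nat (Suc k) * b \<Longrightarrow> a = (b :: 'v eform)"
proof -
  assume *: "of_nat (Suc k) * a = of_nat (Suc k) * b"
  have "scalar (1 / of_nat (Suc k)) * (of_nat (Suc k) * c) = c" for c :: "'v eform"
    by (simp only: scalar_of_nat[symmetric] mult.assoc[symmetric] scalar_mult[symmetric])
      (simp add: nonzero_divide_eq_eq flip: of_nat_Suc del: of_nat_Suc)
  then show "a = b"
    using * by metis
qed

lemma eform_cancel_numeral: "numeral k * a = numeral k * b \<Longrightarrow> a = (b :: 'v eform)"
  using eform_cancel[of "pred_numeral k" a b] by (simp flip: numeral_eq_Suc del: of_nat_Suc)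

section \<open>Forms agreeing on a space of vectors\<close>

text \<open>The bridge from the forms of the claim to the ring. The restriction to lists in
  \<open>V\<close> is essential, since nothing is known about the curvature on other
  functionals.\<close>

definition agrees :: "'v set \<Rightarrow> 'v form \<Rightarrow> 'v eform \<Rightarrow> bool"
  where "agrees V \<alpha> a \<longleftrightarrow> (\<forall>vs. set vs \<subseteq> V \<longrightarrow> \<alpha> vs = Rep_eform a vs)"

lemma sum_form_apply: "sum f S (vs :: 'v list) = (\<Sum>i\<in>S. f i vs :: complex)"
  by (induction S rule: infinite_finite_induct) simp_all

lemma agrees_wedge: "agrees V \<alpha> a \<Longrightarrow> agrees V \<beta> b \<Longrightarrow> agrees V (\<alpha> \<^bold>\<and> \<beta>) (a * b)"
  unfolding agrees_def times_eform.rep_eq wedge_def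
  by (intro allI impI sum.cong arg_cong2[where f = times] refl)
    (metis order_trans set_nths_subset)+

lemma agrees_add: "agrees V \<alpha> a \<Longrightarrow> agrees V \<beta> b \<Longrightarrow> agrees V (\<alpha> + \<beta>) (a + b)"
  by (simp add: agrees_def plus_eform.rep_eq)

lemma agrees_diff: "agrees V \<alpha> a \<Longrightarrow> agrees V \<beta> b \<Longrightarrow> agrees V (\<alpha> - \<beta>) (a - b)"
  by (simp add: agrees_def minus_eform.rep_eq)

lemma agrees_minus: "agrees V \<alpha> a \<Longrightarrow> agrees V (- \<alpha>) (- a)"
  by (simp add: agrees_def uminus_eform.rep_eq)

lemma agrees_0: "agrees V 0 0"
  by (simp add: agrees_def zero_eform.rep_eq)

lemma agrees_sum: "(\<And>i. i \<in> S \<Longrightarrow> agrees V (\<alpha> i) (a i)) \<Longrightarrow> agrees V (sum \<alpha> S) (sum a S)"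
  by (simp add: agrees_def Rep_eform_sum sum_form_apply)

lemma agrees_scaleR: "agrees V \<alpha> a \<Longrightarrow> agrees V (r *\<^sub>R \<alpha>) (scalar (of_real r) * a)"
  by (simp add: agrees_def Rep_scalar_mult scaleR_fun_def scaleR_conv_of_real)

lemma agrees_scale: "agrees V \<alpha> a \<Longrightarrow> agrees V (\<lambda>vs. z * \<alpha> vs) (scalar z * a)"
  by (simp add: agrees_def Rep_scalar_mult)

lemma agrees_const_form: "agrees V (const_form z) (scalar z)"
  by (simp add: agrees_def scalar.rep_eq)

lemma agrees_component: "agrees V \<alpha> a \<Longrightarrow> agrees V (component (2 * n) \<alpha>) (gr n a)"
  by (simp add: agrees_def gr.rep_eq component_def)

lemma agrees_wedge_power: "agrees V \<alpha> a \<Longrightarrow> agrees V (wedge_power \<alpha> k) (a ^ k)"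
  by (induction k) (auto intro: agrees_wedge agrees_const_form[of _ 1, simplified])

lemma agrees_form_series: "agrees V \<alpha> a \<Longrightarrow> agrees V (form_series f \<alpha>) (ser f (\<lambda>k. a ^ k))"
  using agrees_wedge_power[of V \<alpha> a] by (simp add: agrees_def form_series_def ser.rep_eq)

section \<open>Powers and traces of matrices\<close>

primrec mpow :: "nat set \<Rightarrow> (nat \<Rightarrow> nat \<Rightarrow> 'a::comm_ring_1) \<Rightarrow> nat \<Rightarrow> nat \<Rightarrow> nat \<Rightarrow> 'a"
  where
    "mpow I M 0 = (\<lambda>i j. if i = j then 1 else 0)"
  | "mpow I M (Suc k) = (\<lambda>i j. \<Sum>l\<in>I. M i l * mpow I M k l j)"

definition mtr :: "nat set \<Rightarrow> (nat \<Rightarrow> nat \<Rightarrow> 'a::comm_ring_1) \<Rightarrow> nat \<Rightarrow> 'a"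
  where "mtr I M k = (\<Sum>i\<in>I. mpow I M k i i)"

lemma agrees_matrix_power:
  assumes "\<And>i j. i \<in> I \<Longrightarrow> j \<in> I \<Longrightarrow> agrees V (\<Omega> i j) (R i j)" "i \<in> I" "j \<in> I"
  shows "agrees V (matrix_power I \<Omega> k i j) (mpow I R k i j)"
  using assms(2,3)
proof (induction k arbitrary: i)
  case 0
  show ?case
    using agrees_const_form[of V 1] agrees_const_form[of V 0] by simp
next
  case (Suc k)
  then show ?case
    using assms(1) by (auto intro!: agrees_sum agrees_wedge)
qed

lemma agrees_trace:
  assumes "\<And>i j. i \<in> I \<Longrightarrow> j \<in> I \<Longrightarrow> agrees V (\<Omega> i j) (R i j)"
  shows "agrees V (\<Sum>i\<in>I. matrix_power I \<Omega> k i i) (mtr I R k)"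
  unfolding mtr_def by (intro agrees_sum agrees_matrix_power assms)

lemma agrees_trace_series:
  assumes "\<And>i j. i \<in> I \<Longrightarrow> j \<in> I \<Longrightarrow> agrees V (\<Omega> i j) (R i j)"
  shows "agrees V (trace_series f I \<Omega>) (ser f (mtr I R))"
  using agrees_trace[OF assms]
  by (auto simp: agrees_def trace_series_def ser.rep_eq sum_form_apply)

lemma homogeneous_mpow:
  assumes "\<And>i j. i \<in> I \<Longrightarrow> j \<in> I \<Longrightarrow> homogeneous 1 (M i j)" "i \<in> I" "j \<in> I"
  shows "homogeneous k (mpow I M k i j)"
  using assms(2,3)
proof (induction k arbitrary: i)
  case 0
  show ?case
    by (simp add: homogeneous_1 homogeneous_0)
next
  case (Suc k)
  have "homogeneous (1 + k) (M i l * mpow I M k l j)" if "l \<in> I" for l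
    using Suc that by (intro homogeneous_mult assms(1)) auto
  then show ?case
    by (auto intro: homogeneous_sum)
qed

lemma homogeneous_mtr:
  "(\<And>i j. i \<in> I \<Longrightarrow> j \<in> I \<Longrightarrow> homogeneous 1 (M i j)) \<Longrightarrow> homogeneous k (mtr I M k)"
  unfolding mtr_def by (intro homogeneous_sum homogeneous_mpow)

lemma mpow_cong:
  assumes "\<And>i j. i \<in> I \<Longrightarrow> j \<in> I \<Longrightarrow> M i j = N i j" "i \<in> I" "j \<in> I"
  shows "mpow I M k i j = mpow I N k i j"
  using assms(2,3) by (induction k arbitrary: i) (simp_all add: assms(1))

lemma mtr_cong:
  "(\<And>i j. i \<in> I \<Longrightarrow> j \<in> I \<Longrightarrow> M i j = N i j) \<Longrightarrow> mtr I M k = mtr I N k"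
  unfolding mtr_def by (intro sum.cong refl mpow_cong)

lemma mtr_0: "mtr I M 0 = of_nat (card I)"
  by (simp add: mtr_def)

lemma mpow_scale: "mpow I (\<lambda>i j. c * M i j) k i j = c ^ k * mpow I M k i j"
  by (induction k arbitrary: i) (simp_all add: sum_distrib_left ac_simps)

lemma mtr_scale: "mtr I (\<lambda>i j. c * M i j) k = c ^ k * mtr I M k"
  by (simp add: mtr_def mpow_scale sum_distrib_left)

lemma mpow_add:
  assumes "finite I" "i \<in> I" "j \<in> I"
  shows "(\<Sum>l\<in>I. mpow I M a i l * mpow I M b l j) = mpow I M (a + b) i j"
  using assms(2)
proof (induction a arbitrary: i)
  case 0
  have "(\<Sum>l\<in>I. mpow I M 0 i l * mpow I M b l j) = (\<Sum>l\<in>I. if i = l then mpow I M b l j else 0)"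
    by (intro sum.cong) auto
  then show ?case
    using assms 0 by simp
next
  case (Suc a)
  have "(\<Sum>l\<in>I. mpow I M (Suc a) i l * mpow I M b l j)
      = (\<Sum>p\<in>I. M i p * (\<Sum>l\<in>I. mpow I M a p l * mpow I M b l j))"
    by (simp add: sum_distrib_left sum_distrib_right mult.assoc, rule sum.swap)
  then show ?case
    using Suc by simp
qed

lemma mpow_Suc_right:
  assumes "finite I" "i \<in> I" "j \<in> I"
  shows "mpow I M (Suc k) i j = (\<Sum>l\<in>I. mpow I M k i l * M l j)"
proof -
  have 1: "mpow I M 1 l j = M l j" if "l \<in> I" for l
  proof -
    have "mpow I M 1 l j = (\<Sum>p\<in>I. if p = j then M l p else 0)"
      unfolding One_nat_def mpow.simps by (intro sum.cong) auto
    then show ?thesis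
      using assms by simp
  qed
  show ?thesis
    using mpow_add[OF assms, of M k 1] by (simp add: 1 del: mpow.simps One_nat_def flip: Suc_eq_plus1)
qed

text \<open>Transposition reverses a product. So one side is expanded from the left, the other from
  the right by \<open>mpow_Suc_right\<close>, and commutativity of the entries matches them.\<close>

lemma mpow_skew:
  assumes "finite I" "\<And>i j. i \<in> I \<Longrightarrow> j \<in> I \<Longrightarrow> M i j = - M j i" "i \<in> I" "j \<in> I"
  shows "mpow I M k i j = (- 1) ^ k * mpow I M k j i"
  using assms(3,4)
proof (induction k arbitrary: i j)
  case (Suc k)
  have "mpow I M (Suc k) i j = (\<Sum>l\<in>I. (- 1) ^ Suc k * (mpow I M k j l * M l i))"
    unfolding mpow.simps
  proof (intro sum.cong refl)
    fix l assume l: "l \<in> I"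
    have "M i l * mpow I M k l j = - M l i * ((- 1) ^ k * mpow I M k j l)"
      by (intro arg_cong2[where f = times] Suc.IH assms(2) l Suc.prems)
    then show "M i l * mpow I M k l j = (- 1) ^ Suc k * (mpow I M k j l * M l i)"
      by (simp add: ac_simps)
  qed
  then show ?case
    by (simp add: mpow_Suc_right[OF assms(1) Suc.prems(2,1)] sum_distrib_left del: mpow.simps)
qed simp

lemma mtr_skew_odd:
  fixes M :: "nat \<Rightarrow> nat \<Rightarrow> 'v eform"
  assumes "finite I" "\<And>i j. i \<in> I \<Longrightarrow> j \<in> I \<Longrightarrow> M i j = - M j i" "odd k"
  shows "mtr I M k = 0"
proof -
  have "mtr I M k = - mtr I M k"
    unfolding mtr_def sum_negf[symmetric]
  proof (intro sum.cong refl)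
    fix i assume "i \<in> I"
    then have "mpow I M k i i = (- 1) ^ k * mpow I M k i i"
      by (intro mpow_skew assms(1,2))
    then show "mpow I M k i i = - mpow I M k i i"
      using assms(3) by simp
  qed
  then have "2 * mtr I M k = 2 * 0"
    by (metis add.right_inverse mult_2 mult_zero_right)
  then show ?thesis
    by (rule eform_cancel_numeral)
qed

text \<open>Entries of powers of \<open>A \<otimes> 1 + 1 \<otimes> B\<close>.\<close>

definition tensor_mpow ::
    "nat set \<Rightarrow> nat set \<Rightarrow> (nat \<Rightarrow> nat \<Rightarrow> 'a::comm_ring_1) \<Rightarrow> (nat \<Rightarrow> nat \<Rightarrow> 'a) \<Rightarrow>
     nat \<Rightarrow> nat \<Rightarrow> nat \<Rightarrow> nat \<Rightarrow> nat \<Rightarrow> 'a"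
  where "tensor_mpow I J A B n i k j l =
    (\<Sum>r\<le>n. of_nat (n choose r) * mpow I A r i j * mpow J B (n - r) k l)"

lemma pascal_sum:
  fixes x y :: "nat \<Rightarrow> 'a::comm_ring_1"
  shows "(\<Sum>r\<le>Suc n. of_nat (Suc n choose r) * x r * y (Suc n - r))
    = (\<Sum>r\<le>n. of_nat (n choose r) * x (Suc r) * y (n - r))
    + (\<Sum>r\<le>n. of_nat (n choose r) * x r * y (Suc (n - r)))"
proof -
  have "(\<Sum>r\<le>n. of_nat (n choose r) * x r * y (Suc (n - r)))
      = (\<Sum>r\<le>Suc n. of_nat (n choose r) * x r * y (Suc n - r))"
    by (simp add: Suc_diff_le binomial_eq_0)
  then have R: "(\<Sum>r\<le>n. of_nat (n choose r) * x r * y (Suc (n - r)))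
      = x 0 * y (Suc n) + (\<Sum>r\<le>n. of_nat (n choose Suc r) * x (Suc r) * y (n - r))"
    by (simp add: sum.atMost_Suc_shift del: sum.atMost_Suc)
  show ?thesis
    unfolding R by (simp add: sum.atMost_Suc_shift sum.distrib algebra_simps del: sum.atMost_Suc)
qed

lemma tensor_mpow_Suc:
  "tensor_mpow I J A B (Suc n) i k j l
    = (\<Sum>p\<in>I. A i p * tensor_mpow I J A B n p k j l) + (\<Sum>q\<in>J. B k q * tensor_mpow I J A B n i q j l)"
proof -
  have 1: "(\<Sum>p\<in>I. A i p * tensor_mpow I J A B n p k j l)
      = (\<Sum>r\<le>n. of_nat (n choose r) * mpow I A (Suc r) i j * mpow J B (n - r) k l)"
    by (simp add: tensor_mpow_def sum_distrib_left sum_distrib_right ac_simps, rule sum.swap)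
  have 2: "(\<Sum>q\<in>J. B k q * tensor_mpow I J A B n i q j l)
      = (\<Sum>r\<le>n. of_nat (n choose r) * mpow I A r i j * mpow J B (Suc (n - r)) k l)"
    by (simp add: tensor_mpow_def sum_distrib_left sum_distrib_right ac_simps, rule sum.swap)
  show ?thesis
    unfolding 1 2 unfolding tensor_mpow_def by (rule pascal_sum)
qed

text \<open>\<open>A \<otimes> 1 + 1 \<otimes> A\<close> commutes with the flip of the two factors.
  This symmetry is what lets it act on antisymmetric tensors.\<close>

lemma tensor_mpow_swap: "tensor_mpow I I A A n k i l j = tensor_mpow I I A A n i k j l"
  unfolding tensor_mpow_def
  by (rule sum.reindex_bij_witness[where i = "\<lambda>r. n - r" and j = "\<lambda>r. n - r"])
    (auto simp: binomial_symmetric[symmetric] ac_simps)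

text \<open>Kept over any commutative ring, because the same formula is applied to values of
  connection matrices, to values of curvature and to curvature in the ring
  \<open>eform\<close>.\<close>

definition tensor_mat ::
    "(nat \<Rightarrow> nat \<Rightarrow> 'a::comm_ring_1) \<Rightarrow> (nat \<Rightarrow> nat \<Rightarrow> 'a) \<Rightarrow> nat \<Rightarrow> nat \<Rightarrow> 'a"
  where "tensor_mat A B a b = (case (prod_decode a, prod_decode b) of ((i, k), (j, l)) \<Rightarrow>
    (if k = l then A i j else 0) + (if i = j then B k l else 0))"

definition ext_mat :: "(nat \<Rightarrow> nat \<Rightarrow> 'a::comm_ring_1) \<Rightarrow> nat \<Rightarrow> nat \<Rightarrow> 'a"
  where "ext_mat A a b = (case (prod_decode a, prod_decode b) of ((k, l), (i, j)) \<Rightarrow>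
    (if l = j then A k i else 0) - (if k = j then A l i else 0) +
    (if k = i then A l j else 0) - (if l = i then A k j else 0))"

lemma sum_prod_encode: "(\<Sum>a\<in>prod_encode ` S. f a) = (\<Sum>p\<in>S. f (prod_encode p))"
  by (subst sum.reindex) (auto simp: inj_prod_encode)

lemma sum_tensor_mat:
  fixes A B :: "nat \<Rightarrow> nat \<Rightarrow> 'a::comm_ring_1"
  assumes "finite I" "finite J" "i \<in> I" "k \<in> J"
  shows "(\<Sum>p\<in>I \<times> J. tensor_mat A B (prod_encode (i, k)) (prod_encode p) * f p)
    = (\<Sum>p\<in>I. A i p * f (p, k)) + (\<Sum>q\<in>J. B k q * f (i, q))"
proof -
  have "(\<Sum>p\<in>I \<times> J. tensor_mat A B (prod_encode (i, k)) (prod_encode p) * f p)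
    = (\<Sum>p\<in>I. \<Sum>q\<in>J. (if q = k then A i p * f (p, q) else 0) + (if p = i then B k q * f (p, q) else 0))"
    unfolding sum.cartesian_product
    by (intro sum.cong) (auto simp: tensor_mat_def algebra_simps)
  also have "\<dots> = (\<Sum>p\<in>I. A i p * f (p, k)) + (\<Sum>p\<in>I. \<Sum>q\<in>J. if p = i then B k q * f (p, q) else 0)"
    using assms by (simp add: sum.distrib)
  also have "(\<Sum>p\<in>I. \<Sum>q\<in>J. if p = i then B k q * f (p, q) else 0) = (\<Sum>q\<in>J. B k q * f (i, q))"
    using assms by (subst sum.swap) simp
  finally show ?thesis .
qed

lemma mpow_tensor_mat:
  assumes "finite I" "finite J" "i \<in> I" "k \<in> J" "j \<in> I" "l \<in> J"
  shows "mpow (prod_encode ` (I \<times> J)) (tensor_mat A B) n (prod_encode (i, k)) (prod_encode (j, l))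
    = tensor_mpow I J A B n i k j l"
  using assms(3,4)
proof (induction n arbitrary: i k)
  case 0
  show ?case
    by (simp add: tensor_mpow_def)
next
  case (Suc n)
  have "mpow (prod_encode ` (I \<times> J)) (tensor_mat A B) (Suc n) (prod_encode (i, k)) (prod_encode (j, l))
    = (\<Sum>p\<in>I \<times> J. tensor_mat A B (prod_encode (i, k)) (prod_encode p)
        * (case p of (p, q) \<Rightarrow> tensor_mpow I J A B n p q j l))"
    by (auto simp: sum_prod_encode Suc.IH intro!: sum.cong)
  then show ?case
    by (simp only: sum_tensor_mat[OF assms(1,2) Suc.prems] tensor_mpow_Suc split_conv)
qed

lemma mtr_tensor_mat:
  assumes "finite I" "finite J"
  shows "mtr (prod_encode ` (I \<times> J)) (tensor_mat A B) n
    = (\<Sum>r\<le>n. of_nat (n choose r) * mtr I A r * mtr J B (n - r))"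
proof -
  have "mtr (prod_encode ` (I \<times> J)) (tensor_mat A B) n
      = (\<Sum>i\<in>I. \<Sum>k\<in>J. tensor_mpow I J A B n i k i k)"
    unfolding mtr_def sum_prod_encode sum.cartesian_product
    by (intro sum.cong) (auto simp: mpow_tensor_mat[OF assms])
  also have "\<dots> = (\<Sum>r\<le>n. \<Sum>i\<in>I. \<Sum>k\<in>J. of_nat (n choose r) * mpow I A r i i * mpow J B (n - r) k k)"
    unfolding tensor_mpow_def by (subst sum.swap[of _ "{..n}"], subst sum.swap[of _ "{..n}"]) (rule refl)
  finally show ?thesis
    by (simp add: mtr_def[of I] mtr_def[of J] sum_product mult.assoc flip: sum_distrib_left)
qed

section \<open>Exterior squares as antisymmetric tensors\<close>

definition ordered_pairs :: "nat set \<Rightarrow> (nat \<times> nat) set"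
  where "ordered_pairs I = {(i, j). i \<in> I \<and> j \<in> I \<and> i < j}"

lemma finite_ordered_pairs: "finite I \<Longrightarrow> finite (ordered_pairs I)"
  by (rule finite_subset[of _ "I \<times> I"]) (auto simp: ordered_pairs_def)

lemma sum_ordered_pairs:
  fixes f :: "nat \<times> nat \<Rightarrow> 'a::comm_ring_1"
  assumes "finite I" "\<And>p. p \<in> I \<Longrightarrow> f (p, p) = 0"
  shows "(\<Sum>p\<in>I \<times> I. f p) = (\<Sum>(p, q)\<in>ordered_pairs I. f (p, q) + f (q, p))"
proof -
  let ?D = "(\<lambda>p. (p, p)) ` I" and ?L = "prod.swap ` ordered_pairs I"
  have "I \<times> I = (ordered_pairs I \<union> ?L) \<union> ?D"
    by (auto simp: ordered_pairs_def image_iff)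
  then have "(\<Sum>p\<in>I \<times> I. f p) = (\<Sum>p\<in>ordered_pairs I \<union> ?L. f p) + (\<Sum>p\<in>?D. f p)"
    using assms finite_ordered_pairs[of I]
    by (simp, subst sum.union_disjoint) (auto simp: ordered_pairs_def)
  also have "(\<Sum>p\<in>?D. f p) = 0"
    using assms by (intro sum.neutral) auto
  also have "(\<Sum>p\<in>ordered_pairs I \<union> ?L. f p) = (\<Sum>p\<in>ordered_pairs I. f p) + (\<Sum>p\<in>?L. f p)"
    using finite_ordered_pairs[OF assms(1)]
    by (subst sum.union_disjoint) (auto simp: ordered_pairs_def)
  also have "(\<Sum>p\<in>?L. f p) = (\<Sum>p\<in>ordered_pairs I. f (prod.swap p))"
    by (subst sum.reindex) (auto simp: inj_on_def)
  finally show ?thesis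
    by (simp add: case_prod_beta sum.distrib prod.swap_def)
qed

lemma ext_mat_eq: "ext_mat A (prod_encode (k, l)) (prod_encode (i, j)) =
  tensor_mat A A (prod_encode (k, l)) (prod_encode (i, j))
  - tensor_mat A A (prod_encode (k, l)) (prod_encode (j, i))"
  by (simp add: ext_mat_def tensor_mat_def)

text \<open>By antisymmetry of \<open>f\<close> the two terms of \<open>ext_mat\<close> at an
  ordered pair become the \<open>tensor_mat\<close> terms at the pair and at its flip, and the
  diagonal adds nothing. The sum is then one over the tensor square.\<close>

lemma sum_ext_mat:
  fixes A :: "nat \<Rightarrow> nat \<Rightarrow> 'a::comm_ring_1"
  assumes "finite I" "k \<in> I" "l \<in> I"
    and f: "\<And>p q. p \<in> I \<Longrightarrow> q \<in> I \<Longrightarrow> f (q, p) = - f (p, q)" "\<And>p. p \<in> I \<Longrightarrow> f (p, p) = 0"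
  shows "(\<Sum>p\<in>ordered_pairs I. ext_mat A (prod_encode (k, l)) (prod_encode p) * f p)
    = (\<Sum>p\<in>I. A k p * f (p, l)) + (\<Sum>q\<in>I. A l q * f (k, q))"
proof -
  have "(\<Sum>p\<in>ordered_pairs I. ext_mat A (prod_encode (k, l)) (prod_encode p) * f p)
    = (\<Sum>(p, q)\<in>ordered_pairs I. tensor_mat A A (prod_encode (k, l)) (prod_encode (p, q)) * f (p, q)
        + tensor_mat A A (prod_encode (k, l)) (prod_encode (q, p)) * f (q, p))"
  proof (intro sum.cong refl, clarify)
    fix p q assume "(p, q) \<in> ordered_pairs I"
    then have "f (q, p) = - f (p, q)"
      by (intro f(1)) (auto simp: ordered_pairs_def)
    then show "ext_mat A (prod_encode (k, l)) (prod_encode (p, q)) * f (p, q)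
      = tensor_mat A A (prod_encode (k, l)) (prod_encode (p, q)) * f (p, q)
        + tensor_mat A A (prod_encode (k, l)) (prod_encode (q, p)) * f (q, p)"
      by (simp add: ext_mat_eq left_diff_distrib)
  qed
  also have "\<dots> = (\<Sum>p\<in>I \<times> I. tensor_mat A A (prod_encode (k, l)) (prod_encode p) * f p)"
    by (rule sum_ordered_pairs[symmetric]) (simp_all add: assms(1) f(2))
  also have "\<dots> = (\<Sum>p\<in>I. A k p * f (p, l)) + (\<Sum>q\<in>I. A l q * f (k, q))"
    by (rule sum_tensor_mat[OF assms(1,1,2,3)])
  finally show ?thesis .
qed

text \<open>In the full tensor square \<open>e\<^sub>i \<and> e\<^sub>j\<close> is the tensor at
  \<open>(i, j)\<close> minus the one at \<open>(j, i)\<close>, which gives the difference of two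
  entries.\<close>

lemma mpow_ext_mat:
  assumes "finite I" "(k, l) \<in> ordered_pairs I" "(i, j) \<in> ordered_pairs I"
  shows "mpow (prod_encode ` ordered_pairs I) (ext_mat A) n (prod_encode (k, l)) (prod_encode (i, j))
    = tensor_mpow I I A A n k l i j - tensor_mpow I I A A n k l j i"
  using assms(2)
proof (induction n arbitrary: k l)
  case 0
  then show ?case
    using assms(3) by (auto simp: tensor_mpow_def ordered_pairs_def)
next
  case (Suc n)
  define f where "f = (\<lambda>(p, q). tensor_mpow I I A A n p q i j - tensor_mpow I I A A n p q j i)"
  have kl: "k \<in> I" "l \<in> I"
    using Suc.prems by (auto simp: ordered_pairs_def)
  have f1: "f (q, p) = - f (p, q)" for p q
    by (simp add: f_def tensor_mpow_swap[of I A n q p])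
  have f2: "f (p, p) = 0" for p
    by (simp add: f_def tensor_mpow_swap[of I A n p p i j])
  have "mpow (prod_encode ` ordered_pairs I) (ext_mat A) (Suc n) (prod_encode (k, l)) (prod_encode (i, j))
    = (\<Sum>p\<in>ordered_pairs I. ext_mat A (prod_encode (k, l)) (prod_encode p) * f p)"
    by (auto simp: sum_prod_encode Suc.IH f_def intro!: sum.cong)
  also have "\<dots> = (\<Sum>p\<in>I. A k p * f (p, l)) + (\<Sum>q\<in>I. A l q * f (k, q))"
    by (rule sum_ext_mat[where f = f, OF assms(1) kl f1 f2])
  finally show ?case
    by (simp add: f_def tensor_mpow_Suc algebra_simps sum_subtractf)
qed

text \<open>Twice the trace on antisymmetric tensors is the trace on the tensor square minus the
  trace after composing with the flip.\<close>

lemma mtr_ext_mat: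
  assumes "finite I"
  shows "2 * mtr (prod_encode ` ordered_pairs I) (ext_mat A) n
    = (\<Sum>r\<le>n. of_nat (n choose r) * mtr I A r * mtr I A (n - r)) - 2 ^ n * mtr I A n"
proof -
  define f where "f = (\<lambda>(k, l). tensor_mpow I I A A n k l k l - tensor_mpow I I A A n k l l k)"
  have "mtr (prod_encode ` ordered_pairs I) (ext_mat A) n = (\<Sum>p\<in>ordered_pairs I. f p)"
    unfolding mtr_def sum_prod_encode
    by (intro sum.cong) (auto simp: f_def mpow_ext_mat[OF assms])
  moreover have "(\<Sum>p\<in>I \<times> I. f p) = (\<Sum>(p, q)\<in>ordered_pairs I. f (p, q) + f (q, p))"
    using assms by (rule sum_ordered_pairs) (simp add: f_def)
  moreover have "(\<Sum>(p, q)\<in>ordered_pairs I. f (p, q) + f (q, p)) = (\<Sum>p\<in>ordered_pairs I. 2 * f p)"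
  proof (intro sum.cong refl, clarify)
    fix p q
    have "f (q, p) = f (p, q)"
      by (simp add: f_def tensor_mpow_swap[of I A n q p])
    then show "f (p, q) + f (q, p) = 2 * f (p, q)"
      by (simp only: mult_2)
  qed
  ultimately have "2 * mtr (prod_encode ` ordered_pairs I) (ext_mat A) n = (\<Sum>p\<in>I \<times> I. f p)"
    by (simp only: sum_distrib_left)
  also have "\<dots> = (\<Sum>k\<in>I. \<Sum>l\<in>I. tensor_mpow I I A A n k l k l)
      - (\<Sum>k\<in>I. \<Sum>l\<in>I. tensor_mpow I I A A n k l l k)"
    by (simp add: f_def sum.cartesian_product[symmetric] sum_subtractf)
  also have "(\<Sum>k\<in>I. \<Sum>l\<in>I. tensor_mpow I I A A n k l k l) = mtr (prod_encode ` (I \<times> I)) (tensor_mat A A) n"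
    unfolding mtr_def sum_prod_encode sum.cartesian_product
    by (intro sum.cong) (auto simp: mpow_tensor_mat[OF assms assms])
  \<comment> \<open>The flip composes the two tensor factors, so each \<open>r\<close> gives the
    trace of the same \<open>n\<close>-th power and the binomial coefficients add up to
    \<open>2 ^ n\<close>.\<close>
  also have "(\<Sum>k\<in>I. \<Sum>l\<in>I. tensor_mpow I I A A n k l l k)
      = (\<Sum>r\<le>n. \<Sum>k\<in>I. \<Sum>l\<in>I. of_nat (n choose r) * mpow I A r k l * mpow I A (n - r) l k)"
    unfolding tensor_mpow_def by (subst sum.swap[of _ "{..n}"], subst sum.swap[of _ "{..n}"]) (rule refl)
  also have "\<dots> = (\<Sum>r\<le>n. of_nat (n choose r) * mtr I A n)"
    unfolding mtr_def sum_distrib_left[symmetric] mult.assoc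
    by (intro sum.cong) (auto simp: mpow_add[OF assms] sum_distrib_left)
  also have "\<dots> = 2 ^ n * mtr I A n"
    using choose_row_sum[of n] by (simp flip: sum_distrib_right of_nat_sum)
  finally show ?thesis
    by (simp only: mtr_tensor_mat[OF assms assms])
qed

section \<open>Smooth functions and tangent vectors\<close>

lemma Ck_on_subset: "Ck_on k S f \<Longrightarrow> T \<subseteq> S \<Longrightarrow> Ck_on k T f"
  by (induction k arbitrary: f) (auto intro: continuous_on_subset)

lemma frechet_derivative_cong_open:
  assumes "f differentiable (at x)" "open S" "x \<in> S" "\<And>y. y \<in> S \<Longrightarrow> f y = g y"
  shows "g differentiable (at x)" "frechet_derivative g (at x) = frechet_derivative f (at x)"
proof -
  have "(g has_derivative frechet_derivative f (at x)) (at x)"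
    by (rule has_derivative_transform_within_open[OF _ assms(2,3,4)])
      (use assms(1) in \<open>simp_all flip: frechet_derivative_works\<close>)
  then show "g differentiable (at x)" "frechet_derivative g (at x) = frechet_derivative f (at x)"
    by (auto simp: differentiable_def frechet_derivative_at[symmetric])
qed

lemma Ck_on_cong:
  assumes "open S" "\<And>x. x \<in> S \<Longrightarrow> f x = g x" "Ck_on k S f"
  shows "Ck_on k S g"
  using assms(2,3)
proof (induction k arbitrary: f g)
  case 0
  have "continuous_on S f"
    using 0(2) by simp
  then have "continuous_on S g"
    by (rule continuous_on_eq) (rule 0(1))
  then show ?case
    by simp
next
  case (Suc k)
  have d: "f differentiable (at x)" if "x \<in> S" for x
    using Suc.prems(2) that by simp
  have "Ck_on k S (\<lambda>x. frechet_derivative g (at x) v)" for v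
  proof (rule Suc.IH)
    show "Ck_on k S (\<lambda>x. frechet_derivative f (at x) v)"
      using Suc.prems(2) by simp
    show "frechet_derivative f (at x) v = frechet_derivative g (at x) v" if "x \<in> S" for x
      using frechet_derivative_cong_open(2)[OF d[OF that] assms(1) that Suc.prems(1)] by simp
  qed
  moreover have "g differentiable (at x)" if "x \<in> S" for x
    by (rule frechet_derivative_cong_open(1)[OF d[OF that] assms(1) that Suc.prems(1)])
  ultimately show ?case
    by simp
qed

lemma Ck_on_SucI:
  assumes "open S" "\<And>x. x \<in> S \<Longrightarrow> (f has_derivative D x) (at x)" "\<And>v. Ck_on k S (\<lambda>x. D x v)"
  shows "Ck_on (Suc k) S f"
proof -
  have "D x = frechet_derivative f (at x)" if "x \<in> S" for x
    by (rule frechet_derivative_at[OF assms(2)[OF that]])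
  then have "Ck_on k S (\<lambda>x. frechet_derivative f (at x) v)" for v
    by (intro Ck_on_cong[OF assms(1) _ assms(3)]) simp
  then show ?thesis
    using assms(2) by (auto simp: differentiable_def)
qed

lemma Ck_on_Suc_has_derivative:
  "Ck_on (Suc k) S f \<Longrightarrow> x \<in> S \<Longrightarrow> (f has_derivative frechet_derivative f (at x)) (at x)"
  by (simp flip: frechet_derivative_works)

text \<open>For the product rule, in which one factor stays undifferentiated and is needed one order
  lower.\<close>

lemma Ck_on_Suc_imp: "Ck_on (Suc k) S f \<Longrightarrow> Ck_on k S f"
proof (induction k arbitrary: f)
  case 0
  then show ?case
    by (auto intro!: continuous_at_imp_continuous_on differentiable_imp_continuous_within)
next
  case (Suc k)
  have "Ck_on k S (\<lambda>x. frechet_derivative f (at x) v)" for v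
    using Suc.prems by (intro Suc.IH) (simp add: Ck_on.simps(2)[of "Suc k"] del: Ck_on.simps)
  then show ?case
    using Suc.prems by simp
qed

lemma Ck_on_const: "open S \<Longrightarrow> Ck_on k S (\<lambda>_. c)"
proof (induction k arbitrary: c)
  case (Suc k)
  then show ?case
    by (intro Ck_on_SucI[where D = "\<lambda>_ _. 0"]) simp_all
qed simp

lemma Ck_on_add:
  "open S \<Longrightarrow> Ck_on k S f \<Longrightarrow> Ck_on k S g \<Longrightarrow> Ck_on k S (\<lambda>x. f x + g x)"
proof (induction k arbitrary: f g)
  case (Suc k)
  show ?case
  proof (rule Ck_on_SucI[OF Suc.prems(1)])
    show "((\<lambda>x. f x + g x) has_derivative
        (\<lambda>v. frechet_derivative f (at x) v + frechet_derivative g (at x) v)) (at x)" if "x \<in> S" for x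
      by (rule has_derivative_add[OF Ck_on_Suc_has_derivative[OF Suc.prems(2) that]
            Ck_on_Suc_has_derivative[OF Suc.prems(3) that]])
    show "Ck_on k S (\<lambda>x. frechet_derivative f (at x) v + frechet_derivative g (at x) v)" for v
      using Suc.prems(2,3) by (intro Suc.IH Suc.prems(1)) simp_all
  qed
qed (simp add: continuous_on_add)

lemma Ck_on_mult:
  fixes f g :: "'a::real_normed_vector \<Rightarrow> real"
  shows "open S \<Longrightarrow> Ck_on k S f \<Longrightarrow> Ck_on k S g \<Longrightarrow> Ck_on k S (\<lambda>x. f x * g x)"
proof (induction k arbitrary: f g)
  case (Suc k)
  show ?case
  proof (rule Ck_on_SucI[OF Suc.prems(1)])
    show "((\<lambda>x. f x * g x) has_derivative
        (\<lambda>v. f x * frechet_derivative g (at x) v + frechet_derivative f (at x) v * g x)) (at x)"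
      if "x \<in> S" for x
      by (rule has_derivative_mult[OF Ck_on_Suc_has_derivative[OF Suc.prems(2) that]
            Ck_on_Suc_has_derivative[OF Suc.prems(3) that]])
    show "Ck_on k S (\<lambda>x. f x * frechet_derivative g (at x) v + frechet_derivative f (at x) v * g x)" for v
    proof -
      have fg: "Ck_on k S f" "Ck_on k S g"
        by (rule Ck_on_Suc_imp[OF Suc.prems(2)], rule Ck_on_Suc_imp[OF Suc.prems(3)])
      have d: "Ck_on k S (\<lambda>x. frechet_derivative f (at x) v)" "Ck_on k S (\<lambda>x. frechet_derivative g (at x) v)"
        using Suc.prems(2,3) by simp_all
      show ?thesis
        by (rule Ck_on_add[OF Suc.prems(1) Suc.IH[OF Suc.prems(1) fg(1) d(2)] Suc.IH[OF Suc.prems(1) d(1) fg(2)]])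
    qed
  qed
qed (simp add: continuous_on_mult)

section \<open>Charts, germs and derivations on a manifold\<close>

context
  fixes A :: "('x::{t2_space, second_countable_topology}, 'e::real_normed_vector) chart set"
  assumes A: "smooth_manifold A"
begin

lemma chart_exists: "\<exists>c\<in>A. x \<in> fst c"
  using A by (auto simp: smooth_manifold_def)

lemma chart_at: "chart_at A x \<in> A" "x \<in> fst (chart_at A x)"
  using chart_exists[of x] unfolding chart_at_def by (metis (mono_tags, lifting) someI_ex)+

lemma chart_domain_open: "c \<in> A \<Longrightarrow> open (fst c)"
  using A by (auto simp: smooth_manifold_def)

lemma chart_inv_left: "c \<in> A \<Longrightarrow> x \<in> fst c \<Longrightarrow> chart_inv c (snd c x) = x"
  using A by (auto simp: smooth_manifold_def homeomorphism_def)

lemma chart_image_open: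
  assumes "c \<in> A" "open W"
  shows "open (snd c ` (fst c \<inter> W))"
proof -
  have h: "homeomorphism (fst c) (snd c ` fst c) (snd c) (chart_inv c)" and o: "open (snd c ` fst c)"
    using A assms(1) by (auto simp: smooth_manifold_def)
  have "openin (top_of_set (fst c)) (fst c \<inter> W)"
    using assms(2) by (auto simp: openin_open)
  from homeomorphism_imp_open_map[OF h this] o show ?thesis
    by (rule openin_open_trans)
qed

lemma smooth_fun_subset: "smooth_fun A W f \<Longrightarrow> W' \<subseteq> W \<Longrightarrow> smooth_fun A W' f"
  unfolding smooth_fun_def smooth_on_def by (meson Ck_on_subset Int_mono image_mono order_refl)

lemma smooth_fun_cong:
  assumes "open W" "\<And>y. y \<in> W \<Longrightarrow> f y = g y" "smooth_fun A W f"
  shows "smooth_fun A W g"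
  unfolding smooth_fun_def smooth_on_def
proof (intro ballI allI)
  fix c k assume c: "c \<in> A"
  then have "Ck_on k (snd c ` (fst c \<inter> W)) (f \<circ> chart_inv c)"
    using assms(3) by (auto simp: smooth_fun_def smooth_on_def)
  then show "Ck_on k (snd c ` (fst c \<inter> W)) (g \<circ> chart_inv c)"
    by (rule Ck_on_cong[OF chart_image_open[OF c assms(1)], rotated])
      (auto simp: chart_inv_left[OF c] assms(2))
qed

lemma smooth_near_const: "smooth_near A x (\<lambda>_. a)"
  unfolding smooth_near_def smooth_fun_def smooth_on_def
  by (rule exI[of _ UNIV]) (auto simp: comp_def intro!: Ck_on_const chart_image_open[where W = UNIV, simplified])

lemma smooth_near_combine:
  assumes "smooth_near A x f" "smooth_near A x g"
  shows "smooth_near A x (\<lambda>y. f y + g y)" "smooth_near A x (\<lambda>y. f y * g y)"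
proof -
  obtain W W' where W: "open W" "x \<in> W" "smooth_fun A W f" and W': "open W'" "x \<in> W'" "smooth_fun A W' g"
    using assms by (auto simp: smooth_near_def)
  then have *: "smooth_fun A (W \<inter> W') f" "smooth_fun A (W \<inter> W') g"
    by (auto intro: smooth_fun_subset)
  have "smooth_fun A (W \<inter> W') (\<lambda>y. f y + g y)" "smooth_fun A (W \<inter> W') (\<lambda>y. f y * g y)"
    using * W(1) W'(1) unfolding smooth_fun_def smooth_on_def comp_def
    by (auto intro!: Ck_on_add Ck_on_mult chart_image_open)
  then show "smooth_near A x (\<lambda>y. f y + g y)" "smooth_near A x (\<lambda>y. f y * g y)"
    unfolding smooth_near_def using W W' by (auto intro!: exI[of _ "W \<inter> W'"])
qed

lemma smooth_near_cong:
  assumes "open W" "x \<in> W" "\<And>y. y \<in> W \<Longrightarrow> f y = g y" "smooth_near A x f"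
  shows "smooth_near A x g"
proof -
  obtain W' where W': "open W'" "x \<in> W'" "smooth_fun A W' f"
    using assms(4) by (auto simp: smooth_near_def)
  have "smooth_fun A (W \<inter> W') g"
    using assms W' by (intro smooth_fun_cong[of _ f g] smooth_fun_subset[OF W'(3)]) auto
  then show ?thesis
    unfolding smooth_near_def using assms W' by (auto intro!: exI[of _ "W \<inter> W'"])
qed

lemma smooth_near_has_derivative:
  assumes "smooth_near A x f" "c \<in> A" "x \<in> fst c"
  shows "((f \<circ> chart_inv c) has_derivative frechet_derivative (f \<circ> chart_inv c) (at (snd c x))) (at (snd c x))"
proof -
  obtain W where W: "open W" "x \<in> W" "smooth_fun A W f"
    using assms(1) by (auto simp: smooth_near_def)
  then have "Ck_on (Suc 0) (snd c ` (fst c \<inter> W)) (f \<circ> chart_inv c)"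
    using assms(2) by (auto simp: smooth_fun_def smooth_on_def simp del: Ck_on.simps)
  then show ?thesis
    by (rule Ck_on_Suc_has_derivative) (use W assms in auto)
qed

text \<open>\<open>ext_deriv\<close> evaluates connection matrices on fields of this kind, while
  skew-symmetry of those matrices is known only on tangent vectors.\<close>

lemma coord_vec_tangent:
  assumes c: "c \<in> A" "x \<in> fst c"
  shows "coord_vec A c x w \<in> tangent_space A x"
proof -
  note D = smooth_near_has_derivative[OF _ c]
  have *: "coord_vec A c x w h = H w"
    if "((h \<circ> chart_inv c) has_derivative H) (at (snd c x))" "smooth_near A x h" for h H
    using frechet_derivative_at[OF that(1)] that(2) by (simp add: coord_vec_def)
  have add: "coord_vec A c x w (\<lambda>y. f y + g y) = coord_vec A c x w f + coord_vec A c x w g"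
    and mult: "coord_vec A c x w (\<lambda>y. f y * g y) = coord_vec A c x w f * g x + f x * coord_vec A c x w g"
    if fg: "smooth_near A x f" "smooth_near A x g" for f g
  proof -
    have eq: "(\<lambda>y. f y + g y) \<circ> chart_inv c = (\<lambda>z. (f \<circ> chart_inv c) z + (g \<circ> chart_inv c) z)"
      "(\<lambda>y. f y * g y) \<circ> chart_inv c = (\<lambda>z. (f \<circ> chart_inv c) z * (g \<circ> chart_inv c) z)"
      by (simp_all add: fun_eq_iff)
    have "((\<lambda>y. f y + g y) \<circ> chart_inv c has_derivative (\<lambda>w.
        frechet_derivative (f \<circ> chart_inv c) (at (snd c x)) w
        + frechet_derivative (g \<circ> chart_inv c) (at (snd c x)) w)) (at (snd c x))"
      unfolding eq by (rule has_derivative_add[OF D[OF fg(1)] D[OF fg(2)]])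
    from *[OF this smooth_near_combine(1)[OF fg]]
    show "coord_vec A c x w (\<lambda>y. f y + g y) = coord_vec A c x w f + coord_vec A c x w g"
      using fg by (simp add: coord_vec_def)
    have "((\<lambda>y. f y * g y) \<circ> chart_inv c has_derivative (\<lambda>w.
        (f \<circ> chart_inv c) (snd c x) * frechet_derivative (g \<circ> chart_inv c) (at (snd c x)) w
        + frechet_derivative (f \<circ> chart_inv c) (at (snd c x)) w * (g \<circ> chart_inv c) (snd c x))) (at (snd c x))"
      unfolding eq by (rule has_derivative_mult[OF D[OF fg(1)] D[OF fg(2)]])
    from *[OF this smooth_near_combine(2)[OF fg]]
    show "coord_vec A c x w (\<lambda>y. f y * g y) = coord_vec A c x w f * g x + f x * coord_vec A c x w g"
      using fg by (simp add: coord_vec_def chart_inv_left[OF c])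
  qed
  have const: "coord_vec A c x w (\<lambda>_. a) = 0" for a
    using *[of "\<lambda>_. a" "\<lambda>_. 0"] smooth_near_const by (simp add: comp_def)
  have local: "coord_vec A c x w f = coord_vec A c x w g"
    if f: "smooth_near A x f" and W: "open W" "x \<in> W" "\<forall>y\<in>W. f y = g y" for f g W
  proof -
    have "((g \<circ> chart_inv c) has_derivative frechet_derivative (f \<circ> chart_inv c) (at (snd c x))) (at (snd c x))"
      by (rule has_derivative_transform_within_open[OF D[OF f] chart_image_open[OF c(1) W(1)]])
        (use W c in \<open>auto simp: chart_inv_left\<close>)
    moreover have "smooth_near A x g"
      using smooth_near_cong[OF W(1,2) _ f] W(3) by simp
    ultimately have "coord_vec A c x w g = frechet_derivative (f \<circ> chart_inv c) (at (snd c x)) w"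
      by (rule *)
    then show ?thesis
      using f by (simp add: coord_vec_def)
  qed
  have scale: "coord_vec A c x w (\<lambda>y. a * f y) = a * coord_vec A c x w f" if "smooth_near A x f" for a f
    using mult[OF smooth_near_const that, of a] const by simp
  have 1: "\<forall>f. \<not> smooth_near A x f \<longrightarrow> coord_vec A c x w f = 0"
    by (simp add: coord_vec_def)
  have 2: "\<forall>f g. smooth_near A x f \<and> smooth_near A x g \<longrightarrow>
      coord_vec A c x w (\<lambda>y. f y + g y) = coord_vec A c x w f + coord_vec A c x w g \<and>
      coord_vec A c x w (\<lambda>y. f y * g y) = coord_vec A c x w f * g x + f x * coord_vec A c x w g"
    by (intro allI impI conjI add mult) auto
  have 3: "\<forall>a f. smooth_near A x f \<longrightarrow> coord_vec A c x w (\<lambda>y. a * f y) = a * coord_vec A c x w f"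
    by (intro allI impI scale)
  have 4: "\<forall>f g W. smooth_near A x f \<and> open W \<and> x \<in> W \<and> (\<forall>y\<in>W. f y = g y) \<longrightarrow>
      coord_vec A c x w f = coord_vec A c x w g"
    using local by blast
  show ?thesis
    unfolding tangent_space_def by (intro CollectI conjI 1 2 3 4)
qed

lemma coord_ext_tangent: "c \<in> A \<Longrightarrow> y \<in> fst c \<Longrightarrow> coord_ext A c x v y \<in> tangent_space A y"
  by (simp add: coord_ext_def coord_vec_tangent)

text \<open>Smoothness near \<open>x\<close> is itself a local property, so for non-smooth functions
  both sides have the default value 0.\<close>

lemma tangent_cong:
  assumes "v \<in> tangent_space A x" "open W" "x \<in> W" "\<And>y. y \<in> W \<Longrightarrow> f y = g y"
  shows "v f = v g"
proof (cases "smooth_near A x f")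
  case True
  then show ?thesis
    using assms unfolding tangent_space_def by blast
next
  case False
  then have "\<not> smooth_near A x g"
    using smooth_near_cong[OF assms(2,3), of g f] assms(4) by metis
  with False show ?thesis
    using assms(1) by (simp add: tangent_space_def)
qed

lemma tangent_const:
  assumes "v \<in> tangent_space A x"
  shows "v (\<lambda>_. a) = 0"
proof -
  have "v (\<lambda>y. 1 * 1) = v (\<lambda>_. 1) * 1 + 1 * v (\<lambda>_. 1)" "v (\<lambda>y. a * 1) = a * v (\<lambda>_. 1)"
    using assms smooth_near_const[of x 1] unfolding tangent_space_def by blast+
  then show ?thesis
    by simp
qed

text \<open>Negation preserves smoothness and non-smoothness alike, so unlike additivity this holds
  for all functions.\<close>

lemma tangent_minus:
  assumes "v \<in> tangent_space A x"
  shows "v (\<lambda>y. - f y) = - v f"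
proof (cases "smooth_near A x f")
  case True
  then have "v (\<lambda>y. - 1 * f y) = - 1 * v f"
    using assms unfolding tangent_space_def by blast
  then show ?thesis
    by simp
next
  case False
  have "\<not> smooth_near A x (\<lambda>y. - f y)"
  proof
    assume "smooth_near A x (\<lambda>y. - f y)"
    from smooth_near_combine(2)[OF smooth_near_const[of x "- 1"] this] False show False
      by simp
  qed
  with False show ?thesis
    using assms by (simp add: tangent_space_def)
qed

lemma deriv_along_cong:
  assumes "v \<in> tangent_space A x" "open W" "x \<in> W" "\<And>y. y \<in> W \<Longrightarrow> f y = g y"
  shows "deriv_along v f = deriv_along v g"
  unfolding deriv_along_def
  by (intro arg_cong2[where f = Complex] tangent_cong[OF assms(1-3)]) (simp_all add: assms(4))

lemma deriv_along_minus:
  "v \<in> tangent_space A x \<Longrightarrow> deriv_along v (\<lambda>y. - f y) = - deriv_along v f"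
  by (simp add: deriv_along_def tangent_minus[of v x] complex_eq_iff)

lemma ext_deriv_cong:
  assumes "u \<in> tangent_space A x" "v \<in> tangent_space A x" "open W" "x \<in> W"
    "\<And>y v. y \<in> W \<Longrightarrow> v \<in> tangent_space A y \<Longrightarrow> \<theta> y v = \<theta>' y v"
  shows "ext_deriv A \<theta> x u v = ext_deriv A \<theta>' x u v"
proof -
  \<comment> \<open>Inside the chart domain the extensions with constant coordinates are tangent, so
    the assumption on \<theta> and \<theta>' applies to them.\<close>
  let ?W = "W \<inter> fst (chart_at A x)"
  have "open ?W" "x \<in> ?W"
    using assms(3,4) chart_at[of x] by (auto intro: chart_domain_open)
  moreover have "\<theta> y (coord_ext A (chart_at A x) x w y) = \<theta>' y (coord_ext A (chart_at A x) x w y)"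
    if "y \<in> ?W" for y w
    using that chart_at[of x] by (intro assms(5) coord_ext_tangent) auto
  ultimately show ?thesis
    unfolding ext_deriv_def using assms(1,2)
    by (intro arg_cong2[where f = "(-)"] deriv_along_cong[where W = ?W])
qed

lemma ext_deriv_minus:
  "u \<in> tangent_space A x \<Longrightarrow> v \<in> tangent_space A x \<Longrightarrow>
    ext_deriv A (\<lambda>y w. - \<theta> y w) x u v = - ext_deriv A \<theta> x u v"
  by (simp add: ext_deriv_def deriv_along_minus[of _ x])

lemma ext_deriv_0:
  "u \<in> tangent_space A x \<Longrightarrow> v \<in> tangent_space A x \<Longrightarrow> ext_deriv A (\<lambda>y w. 0) x u v = 0"
  by (simp add: ext_deriv_def deriv_along_def tangent_const[of _ x] complex_eq_iff)

end

section \<open>Curvature of connections with skew-symmetric matrix\<close>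

text \<open>Skew-symmetry is required on a neighbourhood because it gets differentiated in the
  curvature.\<close>

definition skew_conn ::
    "('x::topological_space, 'e::real_normed_vector) chart set \<Rightarrow> 'x \<Rightarrow> 'x local_conn \<Rightarrow> bool"
  where "skew_conn A x P \<longleftrightarrow> finite (fst P) \<and> (\<exists>W. open W \<and> x \<in> W \<and>
    (\<forall>y\<in>W. \<forall>v\<in>tangent_space A y. \<forall>i\<in>fst P. \<forall>j\<in>fst P. snd P i j y v = - snd P j i y v))"

lemma skew_conn_trivial_line: "skew_conn A x trivial_line"
  unfolding skew_conn_def trivial_line_def by (auto intro!: exI[of _ UNIV])

text \<open>The inner products of an orthonormal frame are constant, so every tangent vector kills
  them, and metric compatibility turns this into skew-symmetry.\<close>

lemma skew_conn_complexification:
  fixes A :: "('x::{t2_space, second_countable_topology}, 'e::real_normed_vector) chart set"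
  assumes A: "smooth_manifold A" and E: "euclidean_bundle A n E" "euclidean_connection A n E D"
  shows "skew_conn A x (complexification n E D x)"
proof -
  have "x \<in> (\<Union>(U, e)\<in>frames E. U)"
    using E(1) by (simp add: euclidean_bundle_def)
  then obtain p where "p \<in> frames E" "x \<in> fst p"
    by auto
  then have "\<exists>p. p \<in> frames E \<and> x \<in> fst p"
    by blast
  from someI_ex[OF this] obtain U where U: "(U, frame_at E x) \<in> frames E" "x \<in> U"
    unfolding frame_at_def by (metis (no_types, lifting) prod.collapse)
  define e where "e = frame_at E x"
  have "open U" and on: "\<And>y. y \<in> U \<Longrightarrow> orthonormal_basis n (fibre E y) (metric E y) (\<lambda>i. e i y)"
    using E(1) U unfolding euclidean_bundle_def e_def by blast+
  have ip: "inner_product_on (fibre E y) (metric E y)" for y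
    using E(1) by (simp add: euclidean_bundle_def)
  have fib: "e i y \<in> fibre E y" if "y \<in> U" "i < n" for i y
  proof -
    have "e i y \<in> span ((\<lambda>i. e i y) ` {..<n})"
      using that(2) by (intro span_base imageI) simp
    then show ?thesis
      using on[OF that(1)] by (simp add: orthonormal_basis_def)
  qed
  have sec: "smooth_section A n E U (e i)" if "i < n" for i
    unfolding smooth_section_def
  proof (intro conjI ballI, goal_cases)
    case (1 y)
    then show ?case
      using fib that by simp
  next
    case (2 q)
    have "smooth_fun A (U \<inter> U') (\<lambda>y. metric E y (e i y) (e' j y))"
      if "(U', e') \<in> frames E" "j < n" for U' e' j
      using E(1) U(1) that \<open>i < n\<close> unfolding euclidean_bundle_def e_def by blast
    then show ?case
      using 2 by (auto simp: Int_commute)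
  qed
  have "metric E y (D y v (e j)) (e i y) = - metric E y (D y v (e i)) (e j y)"
    if y: "y \<in> U" and v: "v \<in> tangent_space A y" and ij: "i < n" "j < n" for y v i j
  proof -
    have "v (\<lambda>y. metric E y (e i y) (e j y))
        = metric E y (D y v (e i)) (e j y) + metric E y (e i y) (D y v (e j))"
      using E(2) \<open>open U\<close> sec ij y v unfolding euclidean_connection_def by blast
    moreover have "v (\<lambda>y. metric E y (e i y) (e j y)) = v (\<lambda>_. if i = j then 1 else 0)"
      using on ij by (intro tangent_cong[OF A v \<open>open U\<close> y]) (simp add: orthonormal_basis_def)
    moreover have "v (\<lambda>_. if i = j then 1 else 0) = 0"
      by (rule tangent_const[OF A v])
    moreover have "D y v (e j) \<in> fibre E y"
      using E(2) \<open>open U\<close> sec[OF ij(2)] y v unfolding euclidean_connection_def connection_def by blast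
    then have "metric E y (e i y) (D y v (e j)) = metric E y (D y v (e j)) (e i y)"
      using ip fib[OF y ij(1)] by (simp add: inner_product_on_def)
    ultimately show ?thesis
      by linarith
  qed
  then show ?thesis
    using \<open>open U\<close> U(2) unfolding skew_conn_def complexification_def e_def[symmetric]
    by (auto intro!: exI[of _ U] simp flip: of_real_minus)
qed

text \<open>The purpose is the last summand: it is unchanged when \<open>(M, N)\<close> and
  \<open>(M', N')\<close> trade places, and hence drops out of the difference over \<open>u\<close>,
  \<open>v\<close> in the curvature.\<close>

lemma tensor_mat_mult:
  fixes M N M' N' :: "nat \<Rightarrow> nat \<Rightarrow> 'a::comm_ring_1"
  assumes "finite I" "finite J" "i \<in> I" "k \<in> J" "j \<in> I" "l \<in> J"
  shows "(\<Sum>p\<in>prod_encode ` (I \<times> J).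
      tensor_mat M N (prod_encode (i, k)) p * tensor_mat M' N' p (prod_encode (j, l)))
    = (if k = l then \<Sum>p\<in>I. M i p * M' p j else 0) + (if i = j then \<Sum>q\<in>J. N k q * N' q l else 0)
      + (M i j * N' k l + N k l * M' i j)"
proof -
  have 1: "(\<Sum>p\<in>I. M i p * tensor_mat M' N' (prod_encode (p, k)) (prod_encode (j, l)))
      = (if k = l then \<Sum>p\<in>I. M i p * M' p j else 0) + M i j * N' k l"
  proof -
    have "(\<Sum>p\<in>I. M i p * tensor_mat M' N' (prod_encode (p, k)) (prod_encode (j, l)))
      = (\<Sum>p\<in>I. (if k = l then M i p * M' p j else 0) + (if p = j then M i p * N' k l else 0))"
      by (intro sum.cong) (auto simp: tensor_mat_def algebra_simps)
    then show ?thesis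
      using assms by (simp add: sum.distrib)
  qed
  have 2: "(\<Sum>q\<in>J. N k q * tensor_mat M' N' (prod_encode (i, q)) (prod_encode (j, l)))
      = (if i = j then \<Sum>q\<in>J. N k q * N' q l else 0) + N k l * M' i j"
  proof -
    have "(\<Sum>q\<in>J. N k q * tensor_mat M' N' (prod_encode (i, q)) (prod_encode (j, l)))
      = (\<Sum>q\<in>J. (if i = j then N k q * N' q l else 0) + (if q = l then N k q * M' i j else 0))"
      by (intro sum.cong) (auto simp: tensor_mat_def algebra_simps)
    then show ?thesis
      using assms by (simp add: sum.distrib)
  qed
  show ?thesis
    unfolding sum_prod_encode sum_tensor_mat[OF assms(1-4), where f = "\<lambda>p. tensor_mat M' N' (prod_encode p) (prod_encode (j, l))"] 1 2
    by simp
qed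

lemma snd_tensor_conn: "snd (tensor_conn P Q) a b y w = tensor_mat (\<lambda>i j. snd P i j y w) (\<lambda>i j. snd Q i j y w) a b"
  by (simp add: tensor_conn_def tensor_mat_def)

text \<open>As for tensor products, the mixed terms are symmetric in \<open>M\<close> and
  \<open>N\<close> and cancel in the curvature.\<close>

lemma ext_mat_mult:
  fixes M N :: "nat \<Rightarrow> nat \<Rightarrow> 'a::comm_ring_1"
  assumes "finite I" "(k, l) \<in> ordered_pairs I" "(i, j) \<in> ordered_pairs I"
  shows "(\<Sum>p\<in>prod_encode ` ordered_pairs I.
      ext_mat M (prod_encode (k, l)) p * ext_mat N p (prod_encode (i, j)))
    = ext_mat (\<lambda>i j. \<Sum>p\<in>I. M i p * N p j) (prod_encode (k, l)) (prod_encode (i, j))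
      + (M k i * N l j + M l j * N k i - M k j * N l i - M l i * N k j)"
proof -
  define f where "f p = ext_mat N (prod_encode p) (prod_encode (i, j))" for p
  have f1: "f (q, p) = - f (p, q)" for p q
    by (simp add: f_def ext_mat_def)
  have f2: "f (p, p) = 0" for p
    by (simp add: f_def ext_mat_def)
  have I: "k \<in> I" "l \<in> I" "i \<in> I" "j \<in> I"
    using assms by (auto simp: ordered_pairs_def)
  have 1: "(\<Sum>p\<in>I. M k p * f (p, l)) = (if l = j then \<Sum>p\<in>I. M k p * N p i else 0)
      - (if l = i then \<Sum>p\<in>I. M k p * N p j else 0) + M k i * N l j - M k j * N l i"
  proof -
    have "(\<Sum>p\<in>I. M k p * f (p, l)) = (\<Sum>p\<in>I. (if l = j then M k p * N p i else 0)
      - (if l = i then M k p * N p j else 0) + (if p = i then M k p * N l j else 0)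
      - (if p = j then M k p * N l i else 0))"
      by (intro sum.cong) (auto simp: f_def ext_mat_def algebra_simps)
    then show ?thesis
      using assms(1) I by (simp add: sum.distrib sum_subtractf)
  qed
  have 2: "(\<Sum>q\<in>I. M l q * f (k, q)) = (if k = i then \<Sum>p\<in>I. M l p * N p j else 0)
      - (if k = j then \<Sum>p\<in>I. M l p * N p i else 0) + M l j * N k i - M l i * N k j"
  proof -
    have "(\<Sum>q\<in>I. M l q * f (k, q)) = (\<Sum>q\<in>I. (if k = i then M l q * N q j else 0)
      - (if k = j then M l q * N q i else 0) + (if q = j then M l q * N k i else 0)
      - (if q = i then M l q * N k j else 0))"
      by (intro sum.cong) (auto simp: f_def ext_mat_def algebra_simps)
    then show ?thesis
      using assms(1) I by (simp add: sum.distrib sum_subtractf)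
  qed
  have "(\<Sum>p\<in>ordered_pairs I. ext_mat M (prod_encode (k, l)) (prod_encode p) * f p)
      = (\<Sum>p\<in>I. M k p * f (p, l)) + (\<Sum>q\<in>I. M l q * f (k, q))"
    by (rule sum_ext_mat[where f = f, OF assms(1) I(1,2) f1 f2])
  then show ?thesis
    unfolding sum_prod_encode 1 2 by (simp add: f_def ext_mat_def algebra_simps)
qed

lemma fst_exterior_square: "fst (exterior_square P) = prod_encode ` ordered_pairs (fst P)"
  by (simp add: exterior_square_def ordered_pairs_def)

lemma snd_exterior_square: "snd (exterior_square P) a b y w = ext_mat (\<lambda>i j. snd P i j y w) a b"
  by (simp add: exterior_square_def ext_mat_def)

lemma fst_complexification: "fst (complexification n E D x) = {..<n}"
  by (simp add: complexification_def)

lemma curvature_pair: "curvature A P x i j [u, v] = ext_deriv A (snd P i j) x u v +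
    ((\<Sum>k\<in>fst P. snd P i k x u * snd P k j x v) - (\<Sum>k\<in>fst P. snd P i k x v * snd P k j x u))"
  by (simp add: curvature_def sum_subtractf)

context
  fixes A :: "('x::{t2_space, second_countable_topology}, 'e::real_normed_vector) chart set"
    and x :: 'x and u v :: "'x tvec"
  assumes A: "smooth_manifold A" and uv: "u \<in> tangent_space A x" "v \<in> tangent_space A x"
begin

lemma skew_conn_ext_deriv:
  assumes "skew_conn A x P" "i \<in> fst P" "j \<in> fst P"
  shows "ext_deriv A (snd P i j) x u v = - ext_deriv A (snd P j i) x u v"
proof -
  obtain W where W: "open W" "x \<in> W"
    "\<And>y v. y \<in> W \<Longrightarrow> v \<in> tangent_space A y \<Longrightarrow> snd P i j y v = - snd P j i y v"
    using assms unfolding skew_conn_def by blast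
  show ?thesis
    using ext_deriv_cong[OF A uv W(1,2), of "snd P i j" "\<lambda>y v. - snd P j i y v"] W(3)
    by (simp add: ext_deriv_minus[OF A uv])
qed

lemma skew_conn_diagonal:
  assumes "skew_conn A x P" "i \<in> fst P"
  shows "ext_deriv A (snd P i i) x u v = 0"
    "\<exists>W. open W \<and> x \<in> W \<and> (\<forall>y\<in>W. \<forall>v\<in>tangent_space A y. snd P i i y v = 0)"
proof -
  show "ext_deriv A (snd P i i) x u v = 0"
    using skew_conn_ext_deriv[OF assms assms(2)] by simp
  obtain W where W: "open W" "x \<in> W"
    "\<forall>y\<in>W. \<forall>v\<in>tangent_space A y. snd P i i y v = - snd P i i y v"
    using assms unfolding skew_conn_def by blast
  then show "\<exists>W. open W \<and> x \<in> W \<and> (\<forall>y\<in>W. \<forall>v\<in>tangent_space A y. snd P i i y v = 0)"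
    by (intro exI[of _ W]) auto
qed

text \<open>In the quadratic part the signs of two skew factors cancel, while transposing the
  product exchanges \<open>u\<close> and \<open>v\<close>, in which that part is
  antisymmetric.\<close>

lemma curvature_skew:
  assumes P: "skew_conn A x P" "i \<in> fst P" "j \<in> fst P"
  shows "curvature A P x i j [u, v] = - curvature A P x j i [u, v]"
proof -
  obtain W where W: "open W" "x \<in> W" and skew:
    "\<forall>y\<in>W. \<forall>v\<in>tangent_space A y. \<forall>i\<in>fst P. \<forall>j\<in>fst P. snd P i j y v = - snd P j i y v"
    using P unfolding skew_conn_def by blast
  have "snd P i k x u * snd P k j x v = snd P j k x v * snd P k i x u"
    "snd P i k x v * snd P k j x u = snd P j k x u * snd P k i x v" if "k \<in> fst P" for k
  proof -
    have *: "snd P k j x w = - snd P j k x w" "snd P i k x w = - snd P k i x w"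
      if "w \<in> tangent_space A x" for w
      using skew W(2) that \<open>k \<in> fst P\<close> P by blast+
    show "snd P i k x u * snd P k j x v = snd P j k x v * snd P k i x u"
      "snd P i k x v * snd P k j x u = snd P j k x u * snd P k i x v"
      by (simp_all only: *[OF uv(1)] *[OF uv(2)]) simp_all
  qed
  then show ?thesis
    unfolding curvature_pair using skew_conn_ext_deriv[OF P] by simp
qed

lemma curvature_trivial_line: "curvature A trivial_line x i j [u, v] = 0"
  by (simp add: curvature_pair trivial_line_def ext_deriv_0[OF A uv])

text \<open>Tangent vectors are 0 on non-smooth functions, so the derivative of a sum may not be
  split. Off the diagonal at most one summand is present, and on the diagonal both vanish near
  \<open>x\<close> by skew-symmetry.\<close>

lemma ext_deriv_tensor_conn:
  assumes P: "skew_conn A x P" "i \<in> fst P" "j \<in> fst P" and Q: "skew_conn A x Q" "k \<in> fst Q" "l \<in> fst Q"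
  shows "ext_deriv A (snd (tensor_conn P Q) (prod_encode (i, k)) (prod_encode (j, l))) x u v
    = (if k = l then ext_deriv A (snd P i j) x u v else 0) + (if i = j then ext_deriv A (snd Q k l) x u v else 0)"
proof (cases "i = j \<and> k = l")
  case True
  obtain W W' where W: "open W" "x \<in> W" "\<forall>y\<in>W. \<forall>v\<in>tangent_space A y. snd P i i y v = 0"
    "open W'" "x \<in> W'" "\<forall>y\<in>W'. \<forall>v\<in>tangent_space A y. snd Q k k y v = 0"
    using skew_conn_diagonal(2)[OF P(1,2)] skew_conn_diagonal(2)[OF Q(1,2)] by blast
  have "ext_deriv A (snd (tensor_conn P Q) (prod_encode (i, k)) (prod_encode (j, l))) x u v
      = ext_deriv A (\<lambda>_ _. 0) x u v"
    using W True by (intro ext_deriv_cong[OF A uv, of "W \<inter> W'"]) (auto simp: tensor_conn_def)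
  then show ?thesis
    using True P Q by (simp add: ext_deriv_0[OF A uv] skew_conn_diagonal(1))
next
  case False
  then have "snd (tensor_conn P Q) (prod_encode (i, k)) (prod_encode (j, l))
    = (if k = l then snd P i j else if i = j then snd Q k l else (\<lambda>_ _. 0))"
    by (auto simp: tensor_conn_def fun_eq_iff)
  then show ?thesis
    using False by (auto simp: ext_deriv_0[OF A uv])
qed

lemma curvature_tensor_conn:
  assumes P: "skew_conn A x P" and Q: "skew_conn A x Q" and ab: "a \<in> fst (tensor_conn P Q)" "b \<in> fst (tensor_conn P Q)"
  shows "curvature A (tensor_conn P Q) x a b [u, v]
    = tensor_mat (\<lambda>i j. curvature A P x i j [u, v]) (\<lambda>i j. curvature A Q x i j [u, v]) a b"
proof -
  obtain i k j l where ab: "a = prod_encode (i, k)" "b = prod_encode (j, l)"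
    and ij: "i \<in> fst P" "j \<in> fst P" and kl: "k \<in> fst Q" "l \<in> fst Q"
    using ab by (auto simp: tensor_conn_def)
  have fin: "finite (fst P)" "finite (fst Q)"
    using P Q by (simp_all add: skew_conn_def)
  have "fst (tensor_conn P Q) = prod_encode ` (fst P \<times> fst Q)"
    by (simp add: tensor_conn_def)
  then show ?thesis
    unfolding curvature_pair[of A "tensor_conn P Q"] ab ext_deriv_tensor_conn[OF P ij Q kl] snd_tensor_conn
    by (simp only: tensor_mat_mult[OF fin ij(1) kl(1) ij(2) kl(2)])
      (simp add: tensor_mat_def curvature_pair)
qed

text \<open>Away from the diagonal at most one of the four terms of the connection matrix is present,
  and on the diagonal they vanish near \<open>x\<close>; so additivity of \<open>ext_deriv\<close>, which fails for
  non-smooth functions, is not needed.\<close>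

lemma ext_deriv_exterior_square:
  assumes P: "skew_conn A x P" and kl: "(k, l) \<in> ordered_pairs (fst P)" and ij: "(i, j) \<in> ordered_pairs (fst P)"
  shows "ext_deriv A (snd (exterior_square P) (prod_encode (k, l)) (prod_encode (i, j))) x u v
    = ext_mat (\<lambda>i j. ext_deriv A (snd P i j) x u v) (prod_encode (k, l)) (prod_encode (i, j))"
proof (cases "k = i \<and> l = j")
  case True
  have I: "k \<in> fst P" "l \<in> fst P" "k \<noteq> l"
    using kl by (auto simp: ordered_pairs_def)
  obtain W W' where W: "open W" "x \<in> W" "\<forall>y\<in>W. \<forall>v\<in>tangent_space A y. snd P k k y v = 0"
    "open W'" "x \<in> W'" "\<forall>y\<in>W'. \<forall>v\<in>tangent_space A y. snd P l l y v = 0"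
    using skew_conn_diagonal(2)[OF P I(1)] skew_conn_diagonal(2)[OF P I(2)] by blast
  have "ext_deriv A (snd (exterior_square P) (prod_encode (k, l)) (prod_encode (i, j))) x u v
      = ext_deriv A (\<lambda>_ _. 0) x u v"
    using W True I by (intro ext_deriv_cong[OF A uv, of "W \<inter> W'"]) (auto simp: exterior_square_def)
  then show ?thesis
    using True I P by (simp add: ext_deriv_0[OF A uv] ext_mat_def skew_conn_diagonal(1))
next
  case False
  have "k < l" "i < j"
    using kl ij by (auto simp: ordered_pairs_def)
  then have "snd (exterior_square P) (prod_encode (k, l)) (prod_encode (i, j))
    = (if l = j then snd P k i else if k = j then (\<lambda>y w. - snd P l i y w)
       else if k = i then snd P l j else if l = i then (\<lambda>y w. - snd P k j y w) else (\<lambda>_ _. 0))"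
    using False by (auto simp: exterior_square_def fun_eq_iff)
  then show ?thesis
    using False \<open>k < l\<close> \<open>i < j\<close> by (auto simp: ext_mat_def ext_deriv_0[OF A uv] ext_deriv_minus[OF A uv])
qed

lemma curvature_exterior_square:
  assumes P: "skew_conn A x P" and ab: "a \<in> fst (exterior_square P)" "b \<in> fst (exterior_square P)"
  shows "curvature A (exterior_square P) x a b [u, v] = ext_mat (\<lambda>i j. curvature A P x i j [u, v]) a b"
proof -
  obtain k l i j where ab: "a = prod_encode (k, l)" "b = prod_encode (i, j)"
    and kl: "(k, l) \<in> ordered_pairs (fst P)" and ij: "(i, j) \<in> ordered_pairs (fst P)"
    using ab by (auto simp: fst_exterior_square)
  have fin: "finite (fst P)"
    using P by (simp add: skew_conn_def)
  show ?thesis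
    unfolding curvature_pair[of A "exterior_square P"] ab ext_deriv_exterior_square[OF P kl ij]
      snd_exterior_square fst_exterior_square ext_mat_mult[OF fin kl ij]
    by (simp add: ext_mat_def curvature_pair algebra_simps)
qed

end

section \<open>Characteristic forms as even forms\<close>

lemma curvature_eq_0: "length vs \<noteq> 2 \<Longrightarrow> curvature A P x i j vs = 0"
  by (auto simp: curvature_def split: list.splits)

text \<open>Cut off outside the tangent space, so that skew-symmetry and the curvature formulas hold
  as equations of the ring.\<close>

lift_definition curv ::
    "('x::topological_space, 'e::real_normed_vector) chart set \<Rightarrow> 'x local_conn \<Rightarrow> 'x \<Rightarrow>
     nat \<Rightarrow> nat \<Rightarrow> 'x tvec eform"
  is "\<lambda>A P x i j vs. if set vs \<subseteq> tangent_space A x then curvature A P x i j vs else 0"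
  by (metis curvature_eq_0 even_numeral)

lemma agrees_curv: "agrees (tangent_space A x) (curvature A P x i j) (curv A P x i j)"
  by (simp add: agrees_def curv.rep_eq)

lemma homogeneous_curv: "homogeneous 1 (curv A P x i j)"
  unfolding homogeneous_def
  by transfer (auto simp: component_def fun_eq_iff curvature_eq_0)

lemma Rep_tensor_mat: "Rep_eform (tensor_mat M N a b) vs
  = tensor_mat (\<lambda>i j. Rep_eform (M i j) vs) (\<lambda>i j. Rep_eform (N i j) vs) a b"
  by (simp add: tensor_mat_def plus_eform.rep_eq zero_eform.rep_eq split: prod.split)

lemma Rep_ext_mat: "Rep_eform (ext_mat M a b) vs = ext_mat (\<lambda>i j. Rep_eform (M i j) vs) a b"
  by (simp add: ext_mat_def plus_eform.rep_eq minus_eform.rep_eq zero_eform.rep_eq split: prod.split)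

lemma tensor_mat_0: "tensor_mat (\<lambda>i j. 0) (\<lambda>i j. 0) a b = 0"
  by (simp add: tensor_mat_def split: prod.split)

lemma ext_mat_0: "ext_mat (\<lambda>i j. 0) a b = 0"
  by (simp add: ext_mat_def split: prod.split)

section \<open>Chern characters\<close>

definition chr ::
    "('x::topological_space, 'e::real_normed_vector) chart set \<Rightarrow> 'x local_conn \<Rightarrow> 'x \<Rightarrow> 'x tvec eform"
  where "chr A P x = ser (fps_exp (\<i> / (2 * pi))) (mtr (fst P) (curv A P x))"

lemma agrees_chern_character: "agrees (tangent_space A x) (chern_character A P x) (chr A P x)"
  unfolding chern_character_def chr_def by (intro agrees_trace_series agrees_curv)

lemma gr_chr: "gr n (chr A P x) = scalar ((\<i> / (2 * pi)) ^ n / fact n) * mtr (fst P) (curv A P x) n"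
  unfolding chr_def by (simp add: gr_ser_homogeneous homogeneous_mtr homogeneous_curv[simplified])

lemma gr_0_chr: "gr 0 (chr A P x) = of_nat (card (fst P))"
  by (simp add: gr_chr mtr_0)

text \<open>The factorials of the exponential series absorb the binomial coefficients, which makes
  the Chern character multiplicative on tensor products.\<close>

lemma binomial_convolution:
  fixes z :: complex
  assumes "r \<le> n"
  shows "scalar (z ^ n / fact n) * (of_nat (n choose r) * s * t)
    = (scalar (z ^ r / fact r) * s) * (scalar (z ^ (n - r) / fact (n - r)) * t)"
proof -
  have "z ^ n / fact n * of_nat (n choose r) = z ^ r / fact r * (z ^ (n - r) / fact (n - r))"
    using assms by (simp add: binomial_fact power_add[symmetric])
  then have "scalar (z ^ n / fact n) * of_nat (n choose r)
    = scalar (z ^ r / fact r) * scalar (z ^ (n - r) / fact (n - r))"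
    by (metis scalar_mult scalar_of_nat)
  then have "scalar (z ^ n / fact n) * of_nat (n choose r) * (s * t)
    = scalar (z ^ r / fact r) * scalar (z ^ (n - r) / fact (n - r)) * (s * t)"
    by (rule arg_cong)
  then show ?thesis
    by (simp only: ac_simps)
qed

context
  fixes A :: "('x::{t2_space, second_countable_topology}, 'e::real_normed_vector) chart set"
    and x :: 'x
  assumes A: "smooth_manifold A"
begin

lemma curv_pair_cases:
  assumes "\<And>u v. u \<in> tangent_space A x \<Longrightarrow> v \<in> tangent_space A x \<Longrightarrow> Rep_eform a [u, v] = Rep_eform b [u, v]"
    and "\<And>vs. \<not> (set vs \<subseteq> tangent_space A x \<and> length vs = 2) \<Longrightarrow> Rep_eform a vs = Rep_eform b vs"
  shows "a = b"
proof -
  have "Rep_eform a vs = Rep_eform b vs" for vs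
  proof (cases "set vs \<subseteq> tangent_space A x \<and> length vs = 2")
    case True
    then obtain u v where "vs = [u, v]"
      by (auto simp: length_Suc_conv numeral_2_eq_2)
    then show ?thesis
      using True assms(1) by simp
  qed (rule assms(2))
  then show ?thesis
    by (simp flip: Rep_eform_inject add: fun_eq_iff)
qed

lemma curv_skew:
  assumes "skew_conn A x P" "i \<in> fst P" "j \<in> fst P"
  shows "curv A P x i j = - curv A P x j i"
  by (rule curv_pair_cases)
    (simp_all add: uminus_eform.rep_eq curv.rep_eq curvature_eq_0 curvature_skew[OF A _ _ assms])

lemma curv_tensor_conn:
  assumes "skew_conn A x P" "skew_conn A x Q" "a \<in> fst (tensor_conn P Q)" "b \<in> fst (tensor_conn P Q)"
  shows "curv A (tensor_conn P Q) x a b = tensor_mat (curv A P x) (curv A Q x) a b"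
  by (rule curv_pair_cases)
    (simp_all add: Rep_tensor_mat curv.rep_eq curvature_eq_0 tensor_mat_0 curvature_tensor_conn[OF A _ _ assms])

lemma curv_exterior_square:
  assumes "skew_conn A x P" "a \<in> fst (exterior_square P)" "b \<in> fst (exterior_square P)"
  shows "curv A (exterior_square P) x a b = ext_mat (curv A P x) a b"
  by (rule curv_pair_cases)
    (simp_all add: Rep_ext_mat curv.rep_eq curvature_eq_0 ext_mat_0 curvature_exterior_square[OF A _ _ assms])

lemma curv_trivial_line: "curv A trivial_line x i j = 0"
  by (rule curv_pair_cases)
    (simp_all add: zero_eform.rep_eq curv.rep_eq curvature_eq_0 curvature_trivial_line[OF A])

lemma gr_chr_odd:
  assumes "skew_conn A x P" "odd n"
  shows "gr n (chr A P x) = 0"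
proof -
  have "mtr (fst P) (curv A P x) n = 0"
    using assms by (intro mtr_skew_odd curv_skew) (simp_all add: skew_conn_def)
  then show ?thesis
    by (simp add: gr_chr)
qed

lemma chr_trivial_line: "chr A trivial_line x = 1"
proof (rule eform_eqI)
  fix n
  have "mtr (fst (trivial_line :: 'x local_conn)) (curv A trivial_line x) n = (if n = 0 then 1 else 0)"
    by (cases n) (simp_all add: mtr_def trivial_line_def curv_trivial_line[unfolded trivial_line_def])
  then show "gr n (chr A trivial_line x) = gr n 1"
    by (cases "n = 0") (simp_all add: gr_chr gr_1)
qed

lemma chr_tensor_conn:
  assumes "skew_conn A x P" "skew_conn A x Q"
  shows "chr A (tensor_conn P Q) x = chr A P x * chr A Q x"
proof (rule eform_eqI)
  fix n
  have fin: "finite (fst P)" "finite (fst Q)"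
    using assms by (simp_all add: skew_conn_def)
  have I: "fst (tensor_conn P Q) = prod_encode ` (fst P \<times> fst Q)"
    by (simp add: tensor_conn_def)
  have "mtr (fst (tensor_conn P Q)) (curv A (tensor_conn P Q) x) n
      = mtr (fst (tensor_conn P Q)) (tensor_mat (curv A P x) (curv A Q x)) n"
    by (intro mtr_cong curv_tensor_conn assms)
  then show "gr n (chr A (tensor_conn P Q) x) = gr n (chr A P x * chr A Q x)"
    by (simp add: gr_chr gr_mult I mtr_tensor_mat[OF fin] sum_distrib_left binomial_convolution)
qed

text \<open>This is \<open>\<and>^2 F = (F \<otimes> F - \<psi>^2 F) / 2\<close>, where the Adams
  operation \<open>\<psi>^2\<close> multiplies the degree \<open>2 * n\<close> part of the Chern
  character by \<open>2 ^ n\<close>.\<close>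

lemma gr_chr_exterior_square:
  assumes "skew_conn A x P"
  shows "2 * gr n (chr A (exterior_square P) x)
    = gr n (chr A P x * chr A P x) - 2 ^ n * gr n (chr A P x)"
proof -
  have fin: "finite (fst P)"
    using assms by (simp add: skew_conn_def)
  have "mtr (fst (exterior_square P)) (curv A (exterior_square P) x) n
      = mtr (fst (exterior_square P)) (ext_mat (curv A P x)) n"
    by (intro mtr_cong curv_exterior_square assms)
  then have "2 * gr n (chr A (exterior_square P) x)
    = scalar ((\<i> / (2 * pi)) ^ n / fact n) * (2 * mtr (fst (exterior_square P)) (ext_mat (curv A P x)) n)"
    by (simp add: gr_chr ac_simps)
  also have "\<dots> = gr n (chr A P x * chr A P x) - 2 ^ n * gr n (chr A P x)"
    unfolding fst_exterior_square mtr_ext_mat[OF fin] gr_chr gr_mult right_diff_distrib sum_distrib_left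
    by (simp add: binomial_convolution mult.left_commute[of _ "2 ^ n"])
  finally show ?thesis .
qed

text \<open>A skew 2 by 2 matrix with upper right entry \<open>a\<close> has square
  \<open>- a\<^sup>2\<close> times the identity.\<close>

lemma rank_2_trace:
  assumes "skew_conn A x P" "fst P = {..<2}"
  shows "mtr (fst P) (curv A P x) (n + 2) = - (curv A P x 0 1)\<^sup>2 * mtr (fst P) (curv A P x) n"
proof -
  define M where "M = curv A P x"
  have "M i i = - M i i" if "i < 2" for i
    using curv_skew[OF assms(1), of i i] assms(2) that by (simp add: M_def)
  then have "2 * M i i = 2 * 0" if "i < 2" for i
    using that by (metis add.right_inverse mult_2 mult_zero_right)
  then have diag: "M 0 0 = 0" "M (Suc 0) (Suc 0) = 0"
    using eform_cancel_numeral[of "Num.Bit0 Num.One" "M 0 0" 0]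
      eform_cancel_numeral[of "Num.Bit0 Num.One" "M (Suc 0) (Suc 0)" 0] by simp_all
  have skew: "M (Suc 0) 0 = - M 0 (Suc 0)"
    using curv_skew[OF assms(1), of 1 0] assms(2) by (simp add: M_def)
  have two: "{..<2} = {0, Suc 0}"
    by auto
  show ?thesis
    unfolding assms(2) M_def[symmetric] mtr_def two
    by (simp add: diag skew power2_eq_square algebra_simps)
qed

end

section \<open>Virtual bundles, Pontryagin, Hirzebruch and Euler forms\<close>

definition vchr ::
    "('x::topological_space, 'e::real_normed_vector) chart set \<Rightarrow> 'x virtual \<Rightarrow> 'x \<Rightarrow> 'x tvec eform"
  where "vchr A E x = sum_list (map (\<lambda>(k, P). scalar (of_int k) * chr A P x) E)"

lemma agrees_chern_character_virtual:
  "agrees (tangent_space A x) (chern_character_virtual A E x) (vchr A E x)"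
proof (induction E)
  case Nil
  show ?case
    using agrees_0[of "tangent_space A x"]
    by (simp add: chern_character_virtual_def vchr_def agrees_def zero_eform.rep_eq)
next
  case (Cons p E)
  obtain k P where p: "p = (k, P)"
    by (cases p)
  have *: "agrees (tangent_space A x) (of_int k *\<^sub>R chern_character A P x) (scalar (of_int k) * chr A P x)"
    using agrees_scaleR[OF agrees_chern_character, of A x "of_int k" P] by simp
  show ?case
    using agrees_add[OF * Cons]
    unfolding chern_character_virtual_def vchr_def p list.map sum_list.Cons split_conv .
qed

lemma vchr_Cons: "vchr A ((k, P) # E) x = scalar (of_int k) * chr A P x + vchr A E x"
  by (simp add: vchr_def)

lemma vchr_append: "vchr A (E @ E') x = vchr A E x + vchr A E' x"
  by (simp add: vchr_def)

lemma vchr_scale: "vchr A (scale_virtual k E) x = scalar (of_int k) * vchr A E x"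
  by (induction E) (auto simp: vchr_def scale_virtual_def scalar_mult algebra_simps)

lemma vchr_add: "vchr A (E \<oplus> E') x = vchr A E x + vchr A E' x"
  by (simp add: add_virtual_def vchr_append)

lemma vchr_sub: "vchr A (E \<ominus> E') x = vchr A E x - vchr A E' x"
  by (simp add: sub_virtual_def vchr_append vchr_scale scalar_minus)

lemma vchr_actual: "vchr A (actual P) x = chr A P x"
  by (simp add: vchr_def actual_def)

lemma vchr_trivial:
  fixes A :: "('x::{t2_space, second_countable_topology}, 'e::real_normed_vector) chart set"
  shows "smooth_manifold A \<Longrightarrow> vchr A (trivial_virtual k) x = scalar (of_int k)"
  by (simp add: vchr_def trivial_virtual_def chr_trivial_line)

lemma vchr_tensor:
  fixes A :: "('x::{t2_space, second_countable_topology}, 'e::real_normed_vector) chart set"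
  assumes A: "smooth_manifold A"
    and E: "\<And>k P. (k, P) \<in> set E \<Longrightarrow> skew_conn A x P"
    and E': "\<And>k P. (k, P) \<in> set E' \<Longrightarrow> skew_conn A x P"
  shows "vchr A (E \<otimes> E') x = vchr A E x * vchr A E' x"
  using E
proof (induction E)
  case Nil
  show ?case
    by (simp add: vchr_def tensor_virtual_def)
next
  case (Cons p E)
  obtain k P where p: "p = (k, P)"
    by (cases p)
  have "skew_conn A x P"
    using Cons.prems[of k P] p by simp
  have "vchr A (map (\<lambda>(b, Q). (k * b, tensor_conn P Q)) E') x = scalar (of_int k) * chr A P x * vchr A E' x"
    using E'
  proof (induction E')
    case Nil
    show ?case
      by (simp add: vchr_def)
  next
    case (Cons q E')
    obtain l Q where q: "q = (l, Q)"
      by (cases q)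
    have "skew_conn A x Q"
      using Cons.prems[of l Q] q by simp
    have IH: "vchr A (map (\<lambda>(b, Q). (k * b, tensor_conn P Q)) E') x = scalar (of_int k) * chr A P x * vchr A E' x"
      by (rule Cons.IH, rule Cons.prems[OF list.set_intros(2)])
    show ?case
      using \<open>skew_conn A x Q\<close> by (simp add: IH q vchr_Cons chr_tensor_conn[OF A \<open>skew_conn A x P\<close>] scalar_mult distrib_left)
  qed
  moreover have "(p # E) \<otimes> E' = map (\<lambda>(b, Q). (k * b, tensor_conn P Q)) E' @ (E \<otimes> E')"
    by (simp add: tensor_virtual_def p)
  moreover have "vchr A (p # E) x = scalar (of_int k) * chr A P x + vchr A E x"
    by (simp add: vchr_def p)
  moreover have "vchr A (E \<otimes> E') x = vchr A E x * vchr A E' x"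
    by (rule Cons.IH, rule Cons.prems[OF list.set_intros(2)])
  ultimately show ?case
    by (simp add: vchr_append algebra_simps)
qed

lemma i_2pi_squared: "(\<i> / (2 * complex_of_real pi))\<^sup>2 = - (1 / (2 * complex_of_real pi))\<^sup>2"
  by (simp add: power_divide)

text \<open>A pair of roots \<open>y\<close>, \<open>- y\<close> contributes
  \<open>y\<^sup>2\<close> both to the degree 4 part of the Chern character and to the first
  Pontryagin form.\<close>

lemma agrees_pontryagin1: "agrees (tangent_space A x) (pontryagin1 A P x) (gr 2 (chr A P x))"
proof -
  have "gr 2 (chr A P x) = scalar (of_real (- 1 / (8 * pi\<^sup>2))) * mtr (fst P) (curv A P x) 2"
    by (simp add: gr_chr i_2pi_squared power_divide power_mult_distrib)
  then show ?thesis
    unfolding pontryagin1_def by (simp only: agrees_scaleR agrees_trace agrees_curv)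
qed

section \<open>Euler form and Chern character in rank 2\<close>

definition euler :: "('x::topological_space, 'e::real_normed_vector) chart set \<Rightarrow> 'x local_conn \<Rightarrow> 'x \<Rightarrow> 'x tvec eform"
  where "euler A P x = scalar (of_real (1 / (2 * pi))) * curv A P x 0 1"

lemma agrees_euler_form2: "agrees (tangent_space A x) (euler_form2 A P x) (euler A P x)"
  unfolding euler_form2_def euler_def by (intro agrees_scaleR agrees_curv)

lemma homogeneous_euler: "homogeneous 1 (euler A P x)"
  unfolding euler_def by (intro homogeneous_scalar_mult homogeneous_curv)

text \<open>The Chern character is \<open>e^c + e^(-c)\<close>; this is the coefficient form of the
  equation \<open>y'' = c^2 y\<close> solved by \<open>e^(ct) + e^(-ct)\<close>. The sign of the
  squared skew matrix cancels against that of the squared \<open>\<i>\<close>.\<close>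

lemma gr_chr_rank_2:
  fixes A :: "('x::{t2_space, second_countable_topology}, 'e::real_normed_vector) chart set"
  assumes "smooth_manifold A" "skew_conn A x P" "fst P = {..<2}"
  shows "of_nat ((n + 2) * (n + 1)) * gr (n + 2) (chr A P x) = (euler A P x)\<^sup>2 * gr n (chr A P x)"
proof -
  define z where "z = \<i> / (2 * pi)"
  have "of_nat ((n + 2) * (n + 1)) * (z ^ (n + 2) / fact (n + 2)) = - (1 / (2 * complex_of_real pi))\<^sup>2 * (z ^ n / fact n)"
  proof -
    have f: "fact (n + 2) = of_nat ((n + 2) * (n + 1)) * (fact n :: complex)"
      by (simp add: algebra_simps)
    have "of_nat ((n + 2) * (n + 1)) \<noteq> (0 :: complex)"
      unfolding of_nat_eq_0_iff by simp
    then have "of_nat ((n + 2) * (n + 1)) * (z ^ (n + 2) / fact (n + 2)) = z\<^sup>2 * (z ^ n / fact n)"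
      unfolding f by (simp only: power_add) (simp del: of_nat_mult of_nat_add)
    then show ?thesis
      by (simp only: z_def of_real_mult of_real_numeral i_2pi_squared)
  qed
  from arg_cong[OF this, of scalar]
  have E: "of_nat ((n + 2) * (n + 1)) * scalar (z ^ (n + 2) / fact (n + 2))
    = - (scalar (1 / (2 * complex_of_real pi)))\<^sup>2 * scalar (z ^ n / fact n)"
    by (simp only: scalar_mult scalar_of_nat scalar_minus scalar_power)
  have "of_nat ((n + 2) * (n + 1)) * gr (n + 2) (chr A P x)
    = of_nat ((n + 2) * (n + 1)) * scalar (z ^ (n + 2) / fact (n + 2))
      * (- (curv A P x 0 1)\<^sup>2 * mtr (fst P) (curv A P x) n)"
    unfolding gr_chr rank_2_trace[OF assms] z_def[symmetric] by (simp only: mult.assoc)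
  also have "\<dots> = (scalar (1 / (2 * complex_of_real pi)) * curv A P x 0 1)\<^sup>2
      * (scalar (z ^ n / fact n) * mtr (fst P) (curv A P x) n)"
    unfolding E by (simp add: power_mult_distrib ac_simps)
  finally show ?thesis
    by (simp add: gr_chr z_def euler_def)
qed

section \<open>Logarithm of the Hirzebruch form\<close>

definition log_ahat :: "('x::topological_space, 'e::real_normed_vector) chart set \<Rightarrow> 'x local_conn \<Rightarrow> 'x \<Rightarrow> 'x tvec eform"
  where "log_ahat A P x = scalar (of_real (1 / 2)) *
    ser ahat_log (mtr (fst P) (\<lambda>i j. scalar (\<i> / (2 * pi)) * curv A P x i j))"

lemma agrees_ahat_form:
  "agrees (tangent_space A x) (ahat_form A P x) (ser (fps_exp 1) (\<lambda>k. log_ahat A P x ^ k))"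
  unfolding ahat_form_def log_ahat_def
  by (intro agrees_form_series agrees_scaleR agrees_trace_series agrees_scale agrees_curv)

text \<open>With Bernoulli numbers \<open>B\<^sub>n\<close> the even coefficients of
  \<open>ahat_log\<close> are \<open>- B\<^sub>n / (n * n!)\<close> for \<open>n > 0\<close>, so
  those against the Chern character are \<open>- B\<^sub>n / (2 * n)\<close>: - 1/24, 1/240 and -
  1/504.\<close>

lemma gr_log_ahat:
  "gr n (log_ahat A P x) = scalar (fps_nth ahat_log n * fact n / 2) * gr n (chr A P x)"
proof -
  have "gr n (log_ahat A P x) = scalar (of_real (1 / 2)) * (scalar (fps_nth ahat_log n) *
      mtr (fst P) (\<lambda>i j. scalar (\<i> / (2 * pi)) * curv A P x i j) n)"
    unfolding log_ahat_def gr_scalar_mult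
    by (intro arg_cong2[where f = times] refl gr_ser_homogeneous homogeneous_mtr
        homogeneous_scalar_mult homogeneous_curv)
  also have "\<dots> = scalar (1 / 2 * fps_nth ahat_log n * (\<i> / (2 * pi)) ^ n) * mtr (fst P) (curv A P x) n"
    by (simp only: mtr_scale scalar_mult scalar_power mult.assoc of_real_divide of_real_1 of_real_numeral)
  also have "1 / 2 * fps_nth ahat_log n * (\<i> / (2 * pi)) ^ n
      = fps_nth ahat_log n * fact n / 2 * ((\<i> / (2 * pi)) ^ n / fact n)"
    by simp
  finally show ?thesis
    by (simp only: gr_chr scalar_mult mult.assoc)
qed

text \<open>\<open>sinh_series - 1\<close> starts in degree 2, so in the logarithm only its first
  three powers reach degree 6.\<close>

lemma ahat_log_nth:
  "fps_nth ahat_log 0 = 0" "fps_nth ahat_log 2 = - 1 / 24"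
  "fps_nth ahat_log 4 = 1 / 2880" "fps_nth ahat_log 6 = - 1 / 181440"
proof -
  define b where "b = sinh_series - 1"
  have le_6: "k \<in> {0, 1, 2, 3, 4, 5, 6}" if "k \<le> 6" for k :: nat
    using that by (simp add: le_Suc_eq numeral_eq_Suc)
  \<comment> \<open>Coefficients of \<open>sinh (t/2) / (t/2) - 1\<close>, that is
    \<open>1 / (2 ^ k * (k + 1)!)\<close> for even \<open>k > 0\<close>.\<close>
  have b: "fps_nth b k = [0, 0, 1 / 24, 0, 1 / 1920, 0, 1 / 322560] ! k" if "k \<le> 6" for k
    using le_6[OF that] by (auto simp: b_def sinh_series_def fact_numeral)
  have b2: "fps_nth (b * b) k = [0, 0, 0, 0, 1 / 576, 0, 1 / 23040] ! k" if "k \<le> 6" for k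
    using le_6[OF that] by (auto simp: fps_mult_nth b numeral_eq_Suc)
  have b3: "fps_nth (b * (b * b)) k = [0, 0, 0, 0, 0, 0, 1 / 13824] ! k" if "k \<le> 6" for k
    using le_6[OF that] by (auto simp: fps_mult_nth[of b "b * b"] b b2 numeral_eq_Suc)
  have b4: "fps_nth (b * (b * (b * b))) k = 0" if "k \<le> 6" for k
    using le_6[OF that] by (auto simp: fps_mult_nth[of b "b * (b * b)"] b b3 numeral_eq_Suc)
  have b5: "fps_nth (b * (b * (b * (b * b)))) k = 0" if "k \<le> 6" for k
    using that by (simp add: fps_mult_nth[of b "b * (b * (b * b))"] b4)
  have b6: "fps_nth (b * (b * (b * (b * (b * b))))) k = 0" if "k \<le> 6" for k
    using that by (simp add: fps_mult_nth[of b "b * (b * (b * (b * b)))"] b5)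
  have "fps_nth ahat_log k = - (fps_nth b k - fps_nth (b * b) k / 2 + fps_nth (b * (b * b)) k / 3)" if "k \<le> 6" for k
  proof -
    have "fps_nth (fps_ln 1 oo b) k = (\<Sum>i = 0..k. fps_nth (fps_ln 1) i * fps_nth (b ^ i) k)"
      by (rule fps_compose_nth)
    also have "\<dots> = (\<Sum>i = 0..6. fps_nth (fps_ln 1) i * fps_nth (b ^ i) k)"
      using that b[of 0] by (intro sum.mono_neutral_left) (auto intro: startsby_zero_power_prefix[rule_format])
    also have "\<dots> = fps_nth b k - fps_nth (b * b) k / 2 + fps_nth (b * (b * b)) k / 3"
      using b4[OF that] b5[OF that] b6[OF that] by (simp add: numeral_eq_Suc fps_ln_def)
    finally show ?thesis
      by (simp add: ahat_log_def b_def)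
  qed
  then show "fps_nth ahat_log 0 = 0" "fps_nth ahat_log 2 = - 1 / 24"
    "fps_nth ahat_log 4 = 1 / 2880" "fps_nth ahat_log 6 = - 1 / 181440"
    by (simp_all add: b b2 b3)
qed

lemma gr_ser_power_even:
  assumes "homogeneous 2 a"
  shows "gr (2 * n) (ser f (\<lambda>k. a ^ k)) = scalar (fps_nth f n) * a ^ n"
    "odd n \<Longrightarrow> gr n (ser f (\<lambda>k. a ^ k)) = 0"
proof -
  have g: "gr n (a ^ k) = (if n = 2 * k then a ^ k else 0)" for n k
    using homogeneous_power[OF assms, of k] by (simp add: homogeneous_def)
  have "gr (2 * n) (ser f (\<lambda>k. a ^ k)) = (\<Sum>k\<le>2 * (2 * n). if k = n then scalar (fps_nth f n) * a ^ n else 0)"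
    unfolding gr_ser g by (intro sum.cong) auto
  then show "gr (2 * n) (ser f (\<lambda>k. a ^ k)) = scalar (fps_nth f n) * a ^ n"
    by simp
  show "gr n (ser f (\<lambda>k. a ^ k)) = 0" if "odd n"
    unfolding gr_ser g using that by (intro sum.neutral) auto
qed

section \<open>Forms concentrated in degrees divisible by 4\<close>

definition even_graded :: "'v eform \<Rightarrow> bool"
  where "even_graded a \<longleftrightarrow> (\<forall>n. odd n \<longrightarrow> gr n a = 0)"

lemma even_graded_add: "even_graded a \<Longrightarrow> even_graded b \<Longrightarrow> even_graded (a + b)"
  by (simp add: even_graded_def gr_add)

lemma even_graded_diff: "even_graded a \<Longrightarrow> even_graded b \<Longrightarrow> even_graded (a - b)"
  by (simp add: even_graded_def gr_diff)

lemma even_graded_scalar: "even_graded (scalar z)"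
  by (auto simp: even_graded_def gr_scalar)

lemma even_graded_mult: "even_graded a \<Longrightarrow> even_graded b \<Longrightarrow> even_graded (a * b)"
  unfolding even_graded_def gr_mult
  by (intro allI impI sum.neutral ballI) (metis add_diff_inverse_nat atMost_iff even_add leD mult_zero_left mult_zero_right)

lemma even_graded_power: "even_graded a \<Longrightarrow> even_graded (a ^ k)"
  using even_graded_scalar[of 1] by (induction k) (auto intro: even_graded_mult)

lemma even_graded_ser: "(\<And>k. even_graded (s k)) \<Longrightarrow> even_graded (ser f s)"
  by (simp add: even_graded_def gr_ser)

text \<open>One such factor is enough to kill all products of two odd parts. The weak assumption
  matters for \<open>e^(c/2)\<close>, which has odd parts.\<close>

lemma gr_even_mult:
  assumes "even_graded a \<or> even_graded b"
  shows "gr 0 (a * b) = gr 0 a * gr 0 b"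
    "gr 2 (a * b) = gr 0 a * gr 2 b + gr 2 a * gr 0 b"
    "gr 4 (a * b) = gr 0 a * gr 4 b + gr 2 a * gr 2 b + gr 4 a * gr 0 b"
    "gr 6 (a * b) = gr 0 a * gr 6 b + gr 2 a * gr 4 b + gr 4 a * gr 2 b + gr 6 a * gr 0 b"
proof -
  have "gr 1 a * gr 1 b = 0" "gr 1 a * gr 3 b = 0" "gr 3 a * gr 1 b = 0"
    "gr 1 a * gr 5 b = 0" "gr 3 a * gr 3 b = 0" "gr 5 a * gr 1 b = 0"
    using assms by (auto simp: even_graded_def)
  then show "gr 0 (a * b) = gr 0 a * gr 0 b"
    "gr 2 (a * b) = gr 0 a * gr 2 b + gr 2 a * gr 0 b"
    "gr 4 (a * b) = gr 0 a * gr 4 b + gr 2 a * gr 2 b + gr 4 a * gr 0 b"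
    "gr 6 (a * b) = gr 0 a * gr 6 b + gr 2 a * gr 4 b + gr 4 a * gr 2 b + gr 6 a * gr 0 b"
    by (simp_all add: gr_mult numeral_eq_Suc)
qed

section \<open>The identity in degree 12\<close>

text \<open>Turns a rational coefficient into an integral one, so that the later polynomial
  identities involve numerals only.\<close>

lemma scalar_divide_cancel: "x = numeral n * y \<Longrightarrow> scalar (1 / numeral n) * x = (y :: 'v eform)"
proof -
  have "scalar (1 / numeral n) * (numeral n * y) = scalar (1 / numeral n * numeral n) * y"
    by (simp only: scalar_mult scalar_numeral mult.assoc)
  then show "x = numeral n * y \<Longrightarrow> scalar (1 / numeral n) * x = y"
    by simp
qed

lemma numeral_scalar_cancel: "numeral n * (scalar (1 / numeral n) * x) = (x :: 'v eform)"
proof -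
  have "numeral n * (scalar (1 / numeral n) * x) = scalar (numeral n * (1 / numeral n)) * x"
    by (simp only: scalar_mult scalar_numeral mult.assoc)
  then show ?thesis
    by simp
qed

text \<open>Such a form starts in degree 4, so in its exponential only powers up to the third reach
  degree 12.\<close>

lemma gr_power_even_eq_0:
  "even_graded a \<Longrightarrow> gr 0 a = 0 \<Longrightarrow> n < 2 * k \<Longrightarrow> gr n (a ^ k) = 0"
proof (induction k arbitrary: n)
  case (Suc k)
  have "gr i a * gr (n - i) (a ^ k) = 0" if "i \<le> n" for i
  proof (cases "i \<le> 1")
    case True
    then have "i = 0 \<or> odd i"
      by (cases i) auto
    then show ?thesis
      using Suc.prems by (auto simp: even_graded_def)
  qed (use Suc that in auto)
  then show ?case
    by (simp add: gr_mult)
qed simp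

text \<open>With \<open>6 * b\<close> in degree 4 the quadratic and cubic terms of the exponential,
  \<open>18 * b\<^sup>2\<close> and \<open>36 * b ^ 3\<close>, are integral.\<close>

lemma gr_exp_even:
  assumes l: "even_graded l" "gr 0 l = 0" "gr 2 l = 6 * b" and A: "A = ser (fps_exp 1) (\<lambda>k. l ^ k)"
  shows "even_graded A" "gr 0 A = 1" "gr 2 A = 6 * b" "gr 4 A = gr 4 l + 18 * b\<^sup>2"
    "gr 6 A = gr 6 l + 6 * b * gr 4 l + 36 * b ^ 3"
proof -
  show "even_graded A"
    unfolding A by (intro even_graded_ser even_graded_power l)
  have z: "n < 2 * k \<Longrightarrow> gr n (l ^ k) = 0" for n k
    by (rule gr_power_even_eq_0[OF l(1,2)])
  have sq: "gr 4 (l\<^sup>2) = 2 * (18 * b\<^sup>2)" "gr 6 (l\<^sup>2) = 2 * (6 * b * gr 4 l)"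
    unfolding power2_eq_square[of l] using l by (simp_all add: gr_even_mult power2_eq_square)
  have "gr 6 (l ^ 3) = 6 * (36 * b ^ 3)"
    unfolding power3_eq_cube[of l] using l by (simp add: gr_even_mult even_graded_mult power3_eq_cube)
  then have cube: "scalar (1 / 6) * gr 6 (l ^ 3) = 36 * b ^ 3"
    by (rule scalar_divide_cancel)
  note half = sq[THEN scalar_divide_cancel]
  note exp = A gr_ser_power[OF l(2)] atMost_nat_numeral fact_numeral
  show "gr 0 A = 1"
    by (simp add: exp gr_1)
  show "gr 2 A = 6 * b"
    using l by (simp add: exp gr_1 z)
  show "gr 4 A = gr 4 l + 18 * b\<^sup>2"
    by (simp add: exp gr_1 z half)
  show "gr 6 A = gr 6 l + 6 * b * gr 4 l + 36 * b ^ 3"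
    by (simp add: exp gr_1 z half cube)
qed

lemma gr_exp_half:
  assumes c: "homogeneous 1 c" "c\<^sup>2 = 240 * d" and E: "E = ser (fps_exp (1 / 2)) (\<lambda>k. c ^ k)"
  shows "gr 0 E = 1" "gr 2 E = 30 * d" "gr 4 E = 150 * d\<^sup>2" "gr 6 E = 300 * d ^ 3"
proof -
  have g: "gr n E = scalar (1 / (2 ^ n * fact n)) * c ^ n" for n
    unfolding E by (subst gr_ser_homogeneous) (use homogeneous_power[OF c(1)] in \<open>simp_all add: power_divide\<close>)
  have "c ^ 4 = (c\<^sup>2)\<^sup>2" "c ^ 6 = (c\<^sup>2) ^ 3"
    by (simp_all flip: power_mult)
  \<comment> \<open>The numbers 8, 384, 46080 are \<open>2 ^ n * n!\<close> for \<open>n\<close> =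
    2, 4, 6.\<close>
  then have p: "c\<^sup>2 = 8 * (30 * d)" "c ^ 4 = 384 * (150 * d\<^sup>2)" "c ^ 6 = 46080 * (300 * d ^ 3)"
    by (simp_all add: c(2) power_mult_distrib)
  note p[THEN scalar_divide_cancel]
  then show "gr 0 E = 1" "gr 2 E = 30 * d" "gr 4 E = 150 * d\<^sup>2" "gr 6 E = 300 * d ^ 3"
    by (simp_all add: g fact_numeral)
qed

text \<open>The rank \<mu> cancels in every degree. The coefficient of \<open>gr n F\<close> is
  \<open>(\<mu> - 2 ^ (n - 1)) - (\<mu> - 32)\<close>, that is 30, 24, 0 for \<open>n\<close> = 2,
  4, 6, which is why \<open>gr 6 F\<close> is absent. The coefficient of \<open>gr n X\<close> is
  \<open>3 * (\<mu> - 31 - \<mu>) = - 93\<close>. Half of \<open>gr 2 F\<close> is called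
  \<open>g\<close> to keep the square from the exterior square integral.\<close>

lemma gr_virtual_character:
  fixes F T L X K g :: "'v eform"
  assumes F: "even_graded F" "gr 0 F = scalar \<mu>" "gr 2 F = 2 * g"
    and T: "even_graded T" "gr 0 T = 10"
    and X: "even_graded X" "gr 0 X = 0"
    and L: "\<And>n. 2 * gr n L = gr n (F * F) - 2 ^ n * gr n F"
    and K: "K = L + T + scalar ((\<mu> - 32) * (\<mu> - 31) / 2 - 2) - scalar (\<mu> - 32) * F
      + 5 * (X * X) + 3 * ((scalar (\<mu> - 31) - F) * X)"
  shows "even_graded K" "gr 0 K = 504" "gr 2 K = 30 * (2 * g) + gr 2 T - 93 * gr 2 X"
    "gr 4 K = 24 * gr 4 F + 2 * g\<^sup>2 + gr 4 T + 5 * (gr 2 X)\<^sup>2 - 93 * gr 4 X - 6 * g * gr 2 X"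
    "gr 6 K = 2 * g * gr 4 F + gr 6 T + 10 * gr 2 X * gr 4 X - 93 * gr 6 X
      - 6 * g * gr 4 X - 3 * gr 4 F * gr 2 X"
proof -
  define \<nu> where "\<nu> = (\<mu> - 32) * (\<mu> - 31) / 2 - 2"
  note K = K[folded \<nu>_def]
  have eL: "even_graded L"
    unfolding even_graded_def
  proof (intro allI impI)
    fix n :: nat assume "odd n"
    then have "2 * gr n L = 2 * 0"
      using L[of n] F(1) even_graded_mult[OF F(1) F(1)] by (simp add: even_graded_def)
    then show "gr n L = 0"
      by (rule eform_cancel_numeral)
  qed
  have 5: "(5 :: 'v eform) = scalar 5" "(3 :: 'v eform) = scalar 3"
    by (simp_all add: scalar_numeral)
  note ev = F(1) T(1) X(1) eL even_graded_add even_graded_diff even_graded_mult even_graded_scalar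
  show "even_graded K"
    unfolding K 5 by (intro ev)
  have "2 * \<nu> = (\<mu> - 32) * (\<mu> - 31) - 4"
    by (simp add: \<nu>_def)
  from arg_cong[OF this, of scalar]
  have N: "2 * scalar \<nu> = (scalar \<mu> - 32) * (scalar \<mu> - 31) - (4 :: 'v eform)"
    by (simp only: scalar_mult scalar_numeral scalar_diff)
  have gK: "2 * gr n K = 2 * gr n L + 2 * gr n T + gr n (2 * scalar \<nu>)
    - 2 * ((scalar \<mu> - 32) * gr n F) + 10 * gr n (X * X) + 6 * ((scalar \<mu> - 31) * gr n X - gr n (F * X))" for n
  proof -
    have "gr n (2 * scalar z) = 2 * gr n (scalar z :: 'v eform)" for z
      using gr_scalar_mult[of n 2] by (simp add: scalar_numeral)
    then show ?thesis
      unfolding K 5 gr_add gr_diff gr_scalar_mult left_diff_distrib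
      by (simp add: scalar_diff scalar_numeral algebra_simps)
  qed
  have gN: "gr n (2 * scalar z) = (if n = 0 then 2 * scalar z else 0 :: 'v eform)" for n and z
    using gr_scalar_mult[of n 2 "scalar z"] by (cases "n = 0") (simp_all add: scalar_numeral gr_scalar)
  note m = gr_even_mult[OF disjI1[OF F(1)]] gr_even_mult[OF disjI1[OF X(1)]]
  have "2 * gr 0 K = 2 * 504"
    unfolding gK L gN unfolding N m F T X by (simp add: algebra_simps)
  then show "gr 0 K = 504"
    by (rule eform_cancel_numeral)
  have "2 * gr 2 K = 2 * (30 * (2 * g) + gr 2 T - 93 * gr 2 X)"
    unfolding gK L gN m F T X by (simp add: algebra_simps)
  then show "gr 2 K = 30 * (2 * g) + gr 2 T - 93 * gr 2 X"
    by (rule eform_cancel_numeral)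
  have "2 * gr 4 K = 2 * (24 * gr 4 F + 2 * g\<^sup>2 + gr 4 T + 5 * (gr 2 X)\<^sup>2 - 93 * gr 4 X - 6 * g * gr 2 X)"
    unfolding gK L gN m F T X by (simp add: algebra_simps power2_eq_square)
  then show "gr 4 K = 24 * gr 4 F + 2 * g\<^sup>2 + gr 4 T + 5 * (gr 2 X)\<^sup>2 - 93 * gr 4 X - 6 * g * gr 2 X"
    by (rule eform_cancel_numeral)
  have "2 * gr 6 K = 2 * (2 * g * gr 4 F + gr 6 T + 10 * gr 2 X * gr 4 X - 93 * gr 6 X
      - 6 * g * gr 4 X - 3 * gr 4 F * gr 2 X)"
    unfolding gK L gN m F T X by (simp add: algebra_simps)
  then show "gr 6 K = 2 * g * gr 4 F + gr 6 T + 10 * gr 2 X * gr 4 X - 93 * gr 6 X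
      - 6 * g * gr 4 X - 3 * gr 4 F * gr 2 X"
    by (rule eform_cancel_numeral)
qed

text \<open>The units \<open>b\<close>, \<open>\<rho>\<close>, \<open>d\<close> with \<open>p\<^sub>1(TZ) = - 144 b\<close>, \<open>p = 144 \<rho>\<close> and
  \<open>c\<^sup>2 = 240 d\<close> are chosen so that all coefficients become integers.\<close>

lemma degree_12_cancellation:
  fixes A E K e q p :: "'v eform"
  assumes A: "even_graded A" "gr 0 A = 1" "gr 2 A = 6 * b" "gr 4 A = a\<^sub>4 + 18 * b\<^sup>2"
      "gr 6 A = a\<^sub>6 + 6 * b * a\<^sub>4 + 36 * b ^ 3"
    and E: "gr 0 E = 1" "gr 2 E = 30 * d" "gr 4 E = 150 * d\<^sup>2" "gr 6 E = 300 * d ^ 3"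
    and K: "even_graded K" "gr 0 K = 504" "gr 2 K = 30 * (2 * g) + t\<^sub>2 - 93 * x\<^sub>2"
      "gr 4 K = 24 * f\<^sub>4 + 2 * g\<^sup>2 + t\<^sub>4 + 5 * x\<^sub>2\<^sup>2 - 93 * x\<^sub>4 - 6 * g * x\<^sub>2"
      "gr 6 K = 2 * g * f\<^sub>4 + t\<^sub>6 + 10 * x\<^sub>2 * x\<^sub>4 - 93 * x\<^sub>6 - 6 * g * x\<^sub>4 - 3 * f\<^sub>4 * x\<^sub>2"
    and t: "t\<^sub>2 = - 144 * b" "t\<^sub>4 = 240 * a\<^sub>4" "t\<^sub>6 = - 504 * a\<^sub>6"
    and x: "x\<^sub>2 = 240 * d" "x\<^sub>4 = 4800 * d\<^sup>2" "x\<^sub>6 = 38400 * d ^ 3"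
    and p: "p = 144 * \<rho>" "2 * g = t\<^sub>2 - p"
    and e: "even_graded e" "gr 0 e = 1" "gr 2 e = 6 * \<rho>" "gr 4 e = 18 * \<rho>\<^sup>2"
    and q: "even_graded q" "p * gr 0 q = 6 * \<rho>" "p * gr 2 q = 18 * \<rho>\<^sup>2" "p * gr 4 q = 36 * \<rho> ^ 3"
  shows "gr 6 (A * E * K) = p * gr 4 (- (q * A * E * K) + e * A * E)"
proof -
  \<comment> \<open>The unknown \<open>g\<close> is eliminated, so that all of degree 4 is expressed
    through \<open>b\<close>, \<rho> and \<open>d\<close>.\<close>
  have "2 * g = 2 * (- 72 * b - 72 * \<rho>)"
    using p t(1) by simp
  then have g: "g = - 72 * b - 72 * \<rho>"
    by (rule eform_cancel_numeral)
  define W where "W = A * E"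
  have W: "gr 0 W = 1" "gr 2 W = 30 * d + 6 * b" "gr 4 W = 150 * d\<^sup>2 + 180 * b * d + a\<^sub>4 + 18 * b\<^sup>2"
    "gr 6 W = 300 * d ^ 3 + 900 * b * d\<^sup>2 + 30 * d * (a\<^sub>4 + 18 * b\<^sup>2) + a\<^sub>6 + 6 * b * a\<^sub>4 + 36 * b ^ 3"
    unfolding W_def gr_even_mult[OF disjI1[OF A(1)]] A E by (simp_all add: algebra_simps)
  \<comment> \<open>There is no division by \<open>p\<close> in the ring. Each part of
    \<open>q\<close> is multiplied by \<open>p\<close>, which gives the parts of
    \<open>e^(p/24) - 1\<close> in degrees 4, 8 and 12.\<close>
  have "p * gr 4 (q * (W * K)) = p * gr 0 q * gr 4 (W * K) + p * gr 2 q * gr 2 (W * K) + p * gr 4 q * gr 0 (W * K)"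
    unfolding gr_even_mult[OF disjI1[OF q(1)]] by (simp only: distrib_left mult.assoc)
  then have "p * gr 4 (- (q * A * E * K) + e * A * E)
    = - (6 * \<rho> * gr 4 (W * K) + 18 * \<rho>\<^sup>2 * gr 2 (W * K) + 36 * \<rho> ^ 3 * gr 0 (W * K)) + p * gr 4 (e * W)"
    unfolding q gr_add gr_minus by (simp add: W_def mult.assoc distrib_left right_diff_distrib)
  \<comment> \<open>The vanishing of the degree 12 part of \<open>e * W * (K - p)\<close>, with the
    part that stems from \<open>e - 1\<close> and \<open>K\<close> moved to the right.\<close>
  moreover have "gr 6 (W * K) = - (6 * \<rho> * gr 4 (W * K) + 18 * \<rho>\<^sup>2 * gr 2 (W * K) + 36 * \<rho> ^ 3 * gr 0 (W * K))
    + p * gr 4 (e * W)"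
    unfolding gr_even_mult[OF disjI2[OF K(1)]] gr_even_mult[OF disjI1[OF e(1)]] W K e p(1) t x g
    by (simp add: algebra_simps power2_eq_square power3_eq_cube)
  ultimately show ?thesis
    by (simp only: W_def)
qed

lemma agrees_component_8_12:
  "agrees V \<alpha> a \<Longrightarrow> agrees V (component 8 \<alpha>) (gr 4 a)"
  "agrees V \<alpha> a \<Longrightarrow> agrees V (component 12 \<alpha>) (gr 6 a)"
  using agrees_component[of V \<alpha> a 4] agrees_component[of V \<alpha> a 6] by simp_all

lemma agrees_unique:
  "agrees V \<alpha> a \<Longrightarrow> agrees V \<beta> b \<Longrightarrow> a = b \<Longrightarrow> set vs \<subseteq> V \<Longrightarrow> \<alpha> vs = \<beta> vs"
  by (simp add: agrees_def)

text \<open>The pointwise claim at \<open>x\<close>, with the geometry condensed into skew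
  connection matrices of ranks 10, \<open>m\<close> and 2.\<close>

lemma degree_12_identity:
  fixes A :: "('x::{t2_space, second_countable_topology}, 'e::real_normed_vector) chart set"
    and T F X :: "'x local_conn"
  assumes A: "smooth_manifold A"
    and T: "skew_conn A x T" "fst T = {..<10}" and F: "skew_conn A x F" "fst F = {..<m}"
    and X: "skew_conn A x X" "fst X = {..<2}"
    and vs: "set vs \<subseteq> tangent_space A x"
  defines "ch \<equiv> (\<lambda>E. chern_character_virtual A E x)"
    and "Ah \<equiv> ahat_form A T x"
    and "ec \<equiv> form_series (fps_exp (1 / 2)) (euler_form2 A X x)"
    and "p \<equiv> pontryagin1 A T x - pontryagin1 A F x"
  defines "e24 \<equiv> form_series (fps_exp (1 / 24)) p"
    and "q24 \<equiv> form_series exp24_quotient p"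
  shows "(component 12 (Ah \<^bold>\<and> ec \<^bold>\<and> ch (actual (exterior_square F)))
      + component 12 (Ah \<^bold>\<and> ec \<^bold>\<and> ch (actual T))
      + ((real m - 32) * (real m - 31) / 2 - 2) *\<^sub>R component 12 (Ah \<^bold>\<and> ec)
      - (real m - 32) *\<^sub>R component 12 (Ah \<^bold>\<and> ec \<^bold>\<and> ch (actual F))
      + 5 *\<^sub>R component 12 (Ah \<^bold>\<and> ec \<^bold>\<and> ch (reduced_virtual X \<otimes> reduced_virtual X))
      + 3 *\<^sub>R component 12
          (Ah \<^bold>\<and> ec \<^bold>\<and> ch ((trivial_virtual (int m - 31) \<ominus> actual F) \<otimes> reduced_virtual X))) vs
    = (p \<^bold>\<and> component 8 (- (q24 \<^bold>\<and> Ah \<^bold>\<and> ec \<^bold>\<and> ch (frakE m T F X)) + e24 \<^bold>\<and> Ah \<^bold>\<and> ec)) vs"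
    (is "?l vs = ?r vs")
    and "(component 12 (Ah \<^bold>\<and> ch (actual (exterior_square F)))
      + component 12 (Ah \<^bold>\<and> ch (actual T))
      + ((real m - 32) * (real m - 31) / 2 - 2) *\<^sub>R component 12 Ah
      - (real m - 32) *\<^sub>R component 12 (Ah \<^bold>\<and> ch (actual F))) vs
    = (p \<^bold>\<and> component 8 (- (q24 \<^bold>\<and> Ah \<^bold>\<and> ch (frakF m T F)) + e24 \<^bold>\<and> Ah)) vs"
    (is "?l' vs = ?r' vs")
proof -
  define V where "V = tangent_space A x"
  define P where "P = gr 2 (chr A T x) - gr 2 (chr A F x)"
  define a where "a = ser (fps_exp 1) (\<lambda>k. log_ahat A T x ^ k)"
  define c where "c = euler A X x"
  define E where "E = ser (fps_exp (1 / 2)) (\<lambda>k. c ^ k)"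
  define e where "e = ser (fps_exp (1 / 24)) (\<lambda>k. P ^ k)"
  define q where "q = ser exp24_quotient (\<lambda>k. P ^ k)"
  define L where "L = chr A (exterior_square F) x"
  define \<nu> where "\<nu> = (real m - 32) * (real m - 31) / 2 - 2"
  define Y where "Y = vchr A (reduced_virtual X) x"
  define K where "K = vchr A (frakE m T F X) x"
  define K' where "K' = vchr A (frakF m T F) x"

  have ag: "agrees V Ah a" "agrees V ec E" "agrees V p P" "agrees V (ch D) (vchr A D x)"
    "agrees V e24 e" "agrees V q24 q" for D
    unfolding Ah_def a_def ec_def E_def c_def p_def P_def ch_def e24_def e_def q24_def q_def V_def
    by (intro agrees_ahat_form agrees_form_series agrees_euler_form2 agrees_diff agrees_pontryagin1
        agrees_chern_character_virtual)+
  note agrees_intros = agrees_add agrees_diff agrees_minus agrees_scaleR agrees_component_8_12 agrees_wedge ag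

  have evT: "even_graded (chr A T x)" and evF: "even_graded (chr A F x)" and evX: "even_graded (chr A X x)"
    using gr_chr_odd[OF A T(1)] gr_chr_odd[OF A F(1)] gr_chr_odd[OF A X(1)]
    by (simp_all add: even_graded_def)
  have T0: "gr 0 (chr A T x) = 10" and F0: "gr 0 (chr A F x) = scalar (of_nat m)"
    using T F by (simp_all add: gr_0_chr scalar_of_nat)

  have Y: "Y = chr A X x - 2"
    using X by (simp add: Y_def reduced_virtual_def vchr_sub vchr_actual vchr_trivial[OF A] scalar_numeral)
  have two: "gr n (2 :: 'x tvec eform) = (if n = 0 then 2 else 0)" for n
    using gr_scalar[of n 2] by (simp add: scalar_numeral split: if_splits)
  have evY: "even_graded Y"
    unfolding Y using evX by (auto simp: even_graded_def gr_diff two)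
  have X0: "gr 0 (chr A X x) = 2"
    using X by (simp add: gr_0_chr)
  have gY: "gr 0 Y = 0" "gr 2 Y = gr 2 (chr A X x)" "gr 4 Y = gr 4 (chr A X x)" "gr 6 Y = gr 6 (chr A X x)"
    by (simp_all add: Y gr_diff two X0)

  have skew_red: "skew_conn A x Q" if "(k, Q) \<in> set (reduced_virtual X)" for k Q
    using that X(1) skew_conn_trivial_line[of A x]
    by (auto simp: reduced_virtual_def actual_def trivial_virtual_def sub_virtual_def scale_virtual_def)
  have skew_F: "skew_conn A x Q" if "(k, Q) \<in> set (trivial_virtual l \<ominus> actual F)" for k l Q
    using that F(1) skew_conn_trivial_line[of A x]
    by (auto simp: actual_def trivial_virtual_def sub_virtual_def scale_virtual_def)
  have XX: "vchr A (reduced_virtual X \<otimes> reduced_virtual X) x = Y * Y"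
    unfolding Y_def by (rule vchr_tensor[OF A skew_red skew_red])
  have FX: "vchr A ((trivial_virtual (int m - 31) \<ominus> actual F) \<otimes> reduced_virtual X) x
      = (scalar (of_nat m - 31) - chr A F x) * Y"
    using vchr_tensor[OF A skew_F skew_red] by (simp add: Y_def vchr_sub vchr_actual vchr_trivial[OF A])

  \<comment> \<open>The integer division is exact, as one of two consecutive integers is even. This
    identifies the rank in \<open>frakF\<close> with the real coefficient of the claim.\<close>
  have \<nu>: "complex_of_int ((int m - 32) * (int m - 31) div 2 - 2) = of_real \<nu>"
  proof -
    have "even ((int m - 32) * (int m - 31))"
      by simp
    then have "real_of_int ((int m - 32) * (int m - 31) div 2 - 2) = \<nu>"
      by (simp add: \<nu>_def real_of_int_div)
    then show ?thesis
      by (metis of_real_of_int_eq)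
  qed
  have \<nu>': "complex_of_real \<nu> = (of_nat m - 32) * (of_nat m - 31) / 2 - 2"
    by (simp add: \<nu>_def)

  have K': "K' = L + chr A T x + scalar (of_real \<nu>) - scalar (of_nat m - 32) * chr A F x"
    unfolding K'_def frakF_def vchr_add vchr_sub vchr_scale vchr_actual vchr_trivial[OF A] \<nu> L_def
    by simp
  have K: "K = K' + 5 * (Y * Y) + 3 * ((scalar (of_nat m - 31) - chr A F x) * Y)"
    unfolding K_def frakE_def vchr_add vchr_scale XX FX K'_def by (simp add: scalar_numeral)

  have L: "2 * gr n L = gr n (chr A F x * chr A F x) - 2 ^ n * gr n (chr A F x)" for n
    unfolding L_def by (rule gr_chr_exterior_square[OF A F(1)])
  define g where "g = scalar (1 / 2) * gr 2 (chr A F x)"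
  have g: "gr 2 (chr A F x) = 2 * g"
    by (simp add: g_def numeral_scalar_cancel)
  note gK = gr_virtual_character[OF evF F0 g evT T0 evY gY(1) L K[unfolded K' \<nu>']]
  \<comment> \<open>The second bundle is the first with the reduced Chern character of \<xi>
    replaced by 0, so the same computation serves both.\<close>
  have K'0: "K' = L + chr A T x + scalar ((of_nat m - 32) * (of_nat m - 31) / 2 - 2)
      - scalar (of_nat m - 32) * chr A F x + 5 * (0 * 0) + 3 * ((scalar (of_nat m - 31) - chr A F x) * 0)"
    by (simp add: K' \<nu>')
  have ev0: "even_graded (0 :: 'x tvec eform)"
    by (simp add: even_graded_def)
  note gK' = gr_virtual_character[OF evF F0 g evT T0 ev0 gr_0 L K'0, unfolded gr_0]

  \<comment> \<open>The constant makes \<open>- t\<^sub>2 / 24\<close>, the degree 4 part of the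
    logarithm, equal to \<open>6 * b\<close>.\<close>
  define b where "b = scalar (- 1 / 144) * gr 2 (chr A T x)"
  have evl: "even_graded (log_ahat A T x)"
    using evT by (simp add: even_graded_def gr_log_ahat)
  have l: "gr 0 (log_ahat A T x) = 0"
    "gr 2 (log_ahat A T x) = scalar (- 1 / 24) * gr 2 (chr A T x)"
    "gr 4 (log_ahat A T x) = scalar (1 / 240) * gr 4 (chr A T x)"
    "gr 6 (log_ahat A T x) = scalar (- 1 / 504) * gr 6 (chr A T x)"
    by (simp_all add: gr_log_ahat ahat_log_nth fact_numeral)
  have l2: "gr 2 (log_ahat A T x) = 6 * b"
  proof -
    have "6 * b = scalar (6 * (- 1 / 144)) * gr 2 (chr A T x)"
      unfolding b_def by (simp only: scalar_mult scalar_numeral mult.assoc)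
    then show ?thesis
      by (simp add: l)
  qed
  note a = gr_exp_even[OF evl l(1) l2 a_def]
  have t: "gr 2 (chr A T x) = - 144 * b" "gr 4 (chr A T x) = 240 * gr 4 (log_ahat A T x)"
    "gr 6 (chr A T x) = - 504 * gr 6 (log_ahat A T x)"
    using numeral_scalar_cancel[of _ "gr 2 (chr A T x)"] numeral_scalar_cancel[of _ "gr 4 (chr A T x)"]
      numeral_scalar_cancel[of _ "gr 6 (chr A T x)"]
    by (simp_all add: b_def l scalar_minus)

  \<comment> \<open>With 240 the even parts of both \<open>e^(c/2)\<close> and
    \<open>e^c + e^(-c)\<close> are integral multiples of powers of \<open>d\<close> up to degree
    12.\<close>
  define d where "d = scalar (1 / 240) * c\<^sup>2"
  have d: "c\<^sup>2 = 240 * d"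
    by (simp add: d_def numeral_scalar_cancel)
  have c1: "homogeneous 1 c"
    unfolding c_def by (rule homogeneous_euler)
  note E = gr_exp_half[OF c1 d E_def]
  have X2: "gr 2 Y = 240 * d" and X4: "gr 4 Y = 4800 * d\<^sup>2" and X6: "gr 6 Y = 38400 * d ^ 3"
  proof -
    note r = gr_chr_rank_2[OF A X, folded c_def, unfolded d]
    \<comment> \<open>The recursion starts from the rank 2 of the unreduced bundle. The factors 2,
      12, 30 are \<open>(n + 2) * (n + 1)\<close> for \<open>n\<close> = 0, 2, 4.\<close>
    have "2 * gr 2 Y = 2 * (240 * d)"
      unfolding gY using r[of 0] by (simp add: X0 numeral_2_eq_2)
    then show 2: "gr 2 Y = 240 * d"
      by (rule eform_cancel_numeral)
    have "12 * gr 4 Y = 12 * (4800 * d\<^sup>2)"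
      using r[of 2] 2 by (simp add: gY power2_eq_square)
    then show 4: "gr 4 Y = 4800 * d\<^sup>2"
      by (rule eform_cancel_numeral)
    have "30 * gr 6 Y = 30 * (38400 * d ^ 3)"
      using r[of 4] 4 by (simp add: gY power2_eq_square power3_eq_cube)
    then show "gr 6 Y = 38400 * d ^ 3"
      by (rule eform_cancel_numeral)
  qed

  \<comment> \<open>As with \<open>b\<close>, the constant makes \<open>P / 24\<close> equal to
    \<open>6 * \<rho>\<close>.\<close>
  define \<rho> where "\<rho> = scalar (1 / 144) * P"
  have P: "P = 144 * \<rho>" "2 * g = gr 2 (chr A T x) - P"
    by (simp_all add: \<rho>_def numeral_scalar_cancel P_def flip: g)
  have hP: "homogeneous 2 P"
    unfolding P_def by (intro homogeneous_diff homogeneous_gr)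
  note ge = gr_ser_power_even[OF hP, of _ "fps_exp (1 / 24)", folded e_def]
  note gq = gr_ser_power_even[OF hP, of _ exp24_quotient, folded q_def]
  have e: "even_graded e" "gr 0 e = 1" "gr 2 e = 6 * \<rho>" "gr 4 e = 18 * \<rho>\<^sup>2"
  proof -
    have "scalar (1 / 24) * P = 6 * \<rho>" "scalar (1 / 1152) * P\<^sup>2 = 18 * \<rho>\<^sup>2"
      by (rule scalar_divide_cancel, simp add: P(1) power2_eq_square)+
    then show "even_graded e" "gr 0 e = 1" "gr 2 e = 6 * \<rho>" "gr 4 e = 18 * \<rho>\<^sup>2"
      using ge(1)[of 0] ge(1)[of 1] ge(1)[of 2] ge(2)
      by (simp_all add: even_graded_def power2_eq_square)
  qed
  have q: "even_graded q" "P * gr 0 q = 6 * \<rho>" "P * gr 2 q = 18 * \<rho>\<^sup>2" "P * gr 4 q = 36 * \<rho> ^ 3"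
  proof -
    have 1: "scalar (1 / 24) * P = 6 * \<rho>" "scalar (1 / 1152) * (P * P) = 18 * \<rho>\<^sup>2"
      "scalar (1 / 82944) * (P * P\<^sup>2) = 36 * \<rho> ^ 3"
      by (rule scalar_divide_cancel, simp add: P(1) power2_eq_square power3_eq_cube)+
    \<comment> \<open>The denominators are \<open>24 ^ k * k!\<close> for \<open>k\<close> = 1, 2,
      3.\<close>
    have "gr 0 q = scalar (1 / 24)" "gr 2 q = scalar (1 / 1152) * P" "gr 4 q = scalar (1 / 82944) * P\<^sup>2"
      using gq(1)[of 0] gq(1)[of 1] gq(1)[of 2] by (simp_all add: exp24_quotient_def fact_numeral)
    then show "even_graded q" "P * gr 0 q = 6 * \<rho>" "P * gr 2 q = 18 * \<rho>\<^sup>2" "P * gr 4 q = 36 * \<rho> ^ 3"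
      using gq(2) 1 by (simp_all add: even_graded_def mult.left_commute[of P] mult.commute[of P "scalar _"])
  qed

  have main: "gr 6 (a * E * K) = P * gr 4 (- (q * a * E * K) + e * a * E)"
    by (rule degree_12_cancellation[OF a E gK t X2 X4 X6 P e q])
  \<comment> \<open>Replacing \<open>E\<close> by 1 and taking \<open>d = 0\<close> is the
    computation for \<open>c = 0\<close>.\<close>
  have main': "gr 6 (a * 1 * K') = P * gr 4 (- (q * a * 1 * K') + e * a * 1)"
    by (rule degree_12_cancellation[OF a _ _ _ _ gK' t _ _ _ P e q, where d = 0]) (simp_all add: gr_1)

  have l: "agrees V ?l (gr 6 (a * E * vchr A (actual (exterior_square F)) x)
      + gr 6 (a * E * vchr A (actual T) x)
      + scalar (of_real ((real m - 32) * (real m - 31) / 2 - 2)) * gr 6 (a * E)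
      - scalar (of_real (real m - 32)) * gr 6 (a * E * vchr A (actual F) x)
      + scalar (of_real 5) * gr 6 (a * E * vchr A (reduced_virtual X \<otimes> reduced_virtual X) x)
      + scalar (of_real 3) * gr 6 (a * E * vchr A ((trivial_virtual (int m - 31) \<ominus> actual F) \<otimes> reduced_virtual X) x))"
    (is "agrees _ _ ?s")
    by (intro agrees_intros)
  \<comment> \<open>Both the Chern character and \<open>gr 6\<close> are additive, so the separate
    terms of the claim collect into the single virtual bundle.\<close>
  have s: "?s = gr 6 (a * E * K)"
    unfolding vchr_actual XX FX \<nu>_def[symmetric] L_def[symmetric] K K' gr_scalar_mult[symmetric] gr_add[symmetric] gr_diff[symmetric]
    by (simp add: scalar_numeral algebra_simps)
  have r: "agrees V ?r (P * gr 4 (- (q * a * E * K) + e * a * E))"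
    unfolding K_def by (intro agrees_intros)
  show "?l vs = ?r vs"
    by (rule agrees_unique[OF l r trans[OF s main] vs[folded V_def]])

  have l': "agrees V ?l' (gr 6 (a * vchr A (actual (exterior_square F)) x)
      + gr 6 (a * vchr A (actual T) x)
      + scalar (of_real ((real m - 32) * (real m - 31) / 2 - 2)) * gr 6 a
      - scalar (of_real (real m - 32)) * gr 6 (a * vchr A (actual F) x))"
    (is "agrees _ _ ?s'")
    by (intro agrees_intros)
  have s': "?s' = gr 6 (a * K')"
    unfolding vchr_actual \<nu>_def[symmetric] L_def[symmetric] K' gr_scalar_mult[symmetric] gr_add[symmetric] gr_diff[symmetric]
    by (simp add: algebra_simps)
  have r': "agrees V ?r' (P * gr 4 (- (q * a * K') + e * a))"
    unfolding K'_def by (intro agrees_intros)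
  show "?l' vs = ?r' vs"
    by (rule agrees_unique[OF l' r' trans[OF s' main'[unfolded mult_1_right]] vs[folded V_def]])
qed

theorem corollary2:
  fixes AX :: "('x::{t2_space, second_countable_topology}, 'ex::euclidean_space) chart set"
    and AB :: "('b::{t2_space, second_countable_topology}, 'eb::real_normed_vector) chart set"
    and AZ :: "('z::{t2_space, second_countable_topology}, 'ez::euclidean_space) chart set"
    and \<pi> :: "'x \<Rightarrow> 'b"
    and gTZ :: "'x \<Rightarrow> 'x tvec \<Rightarrow> 'x tvec \<Rightarrow> real"
    and DTZ :: "('x, 'x tvec) covd"
    and F :: "('x, 'v::real_vector) vbundle" and DF :: "('x, 'v) covd"
    and \<xi> :: "('x, 'w::real_vector) vbundle" and D\<xi> :: "('x, 'w) covd"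
    and m :: nat
  assumes "smooth_manifold AX" and "smooth_manifold AB" and "smooth_manifold AZ"
    and "fibre_bundle AX AB AZ \<pi>"
    and "DIM('ez) = 10"
    and "euclidean_bundle AX 10 (vertical_bundle AX AB \<pi> 10 gTZ)"
    and "vertical_levi_civita AX AB \<pi> 10 gTZ DTZ"
    and "euclidean_bundle AX m F" and "euclidean_connection AX m F DF"
    and "euclidean_bundle AX 2 \<xi>" and "oriented_bundle 2 \<xi>"
    and "euclidean_connection AX 2 \<xi> D\<xi>"
  shows "\<forall>x vs. set vs \<subseteq> tangent_space AX x \<longrightarrow>
    (let T = complexification 10 (vertical_bundle AX AB \<pi> 10 gTZ) DTZ x;
         FC = complexification m F DF x;
         \<xi>C = complexification 2 \<xi> D\<xi> x;
         ch = (\<lambda>E. chern_character_virtual AX E x);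
         A = ahat_form AX T x;
         ec = form_series (fps_exp (1 / 2)) (euler_form2 AX \<xi>C x);
         p = pontryagin1 AX T x - pontryagin1 AX FC x;
         e24 = form_series (fps_exp (1 / 24)) p;
         q24 = form_series exp24_quotient p
     in (component 12 (A \<^bold>\<and> ec \<^bold>\<and> ch (actual (exterior_square FC)))
         + component 12 (A \<^bold>\<and> ec \<^bold>\<and> ch (actual T))
         + ((real m - 32) * (real m - 31) / 2 - 2) *\<^sub>R component 12 (A \<^bold>\<and> ec)
         - (real m - 32) *\<^sub>R component 12 (A \<^bold>\<and> ec \<^bold>\<and> ch (actual FC))
         + 5 *\<^sub>R component 12 (A \<^bold>\<and> ec \<^bold>\<and> ch (reduced_virtual \<xi>C \<otimes> reduced_virtual \<xi>C))
         + 3 *\<^sub>R component 12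
             (A \<^bold>\<and> ec \<^bold>\<and> ch ((trivial_virtual (int m - 31) \<ominus> actual FC) \<otimes> reduced_virtual \<xi>C))) vs
       = (p \<^bold>\<and> component 8 (- (q24 \<^bold>\<and> A \<^bold>\<and> ec \<^bold>\<and> ch (frakE m T FC \<xi>C)) + e24 \<^bold>\<and> A \<^bold>\<and> ec)) vs
     \<and> (trivial_bundle AX 2 \<xi> \<longrightarrow>
         (component 12 (A \<^bold>\<and> ch (actual (exterior_square FC)))
          + component 12 (A \<^bold>\<and> ch (actual T))
          + ((real m - 32) * (real m - 31) / 2 - 2) *\<^sub>R component 12 A
          - (real m - 32) *\<^sub>R component 12 (A \<^bold>\<and> ch (actual FC))) vs
         = (p \<^bold>\<and> component 8 (- (q24 \<^bold>\<and> A \<^bold>\<and> ch (frakF m T FC)) + e24 \<^bold>\<and> A)) vs))"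
proof -
  have TZ: "euclidean_connection AX 10 (vertical_bundle AX AB \<pi> 10 gTZ) DTZ"
    using assms(7) by (simp add: vertical_levi_civita_def)
  note skew = skew_conn_complexification[OF assms(1)]
  note identity = degree_12_identity[OF assms(1)
      skew[OF assms(6) TZ] fst_complexification skew[OF assms(8,9)] fst_complexification
      skew[OF assms(10,12)] fst_complexification]
  show ?thesis
    unfolding Let_def by (intro allI impI conjI identity)
qed

end
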